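(* Let $\varphi_1,\varphi_2\in L^2(\mathbb{R}^d)$. (i) If $1\le p\le 2$ and $V_{\varphi_1}\varphi_2(z)\neq 0$ for almost all $z\in\mathbb{R}^{2d}$, then $\mathcal{B}$ is one-to-one from $\mathscr{S}^p$ to $L^p(\mathbb{R}^{2d})$. In this case, $\{A_a^{\varphi_1,\varphi_2}:a\in L^{p'}(\mathbb{R}^{2d})\}$ is norm-dense in $\mathscr{S}^{p'}$, where $p'=p/(p-1)$ is the conjugate index. (ii) If $p\ge 2$ and $\mathcal{B}$ is one-to-one from $\mathscr{S}^p$ to $L^p(\mathbb{R}^{2d})$, then $V_{\varphi_1}\varphi_2(z)\neq0$ for almost all $z\in\mathbb{R}^{2d}$.
   Context: For $z=(x,\xi)\in\mathbb{R}^{2d}$ the time-frequency shift is $\pi(z)f(t)=e^{2\pi i\xi\cdot t}f(t-x)$. The short-time Fourier transform is $V_gf(z)=\langle f,\pi(z)g\rangle$ (inner product of $L^2(\mathbb{R}^d)$, linear in the first argument). For windows $\varphi_1,\varphi_2\in L^2(\mathbb{R}^d)$ and a symbol $a\in L^{q}(\mathbb{R}^{2d})$, $1\le q\le\infty$, the localization operator $A_a^{\varphi_1,\varphi_2}$ on $L^2(\mathbb{R}^d)$ is defined weakly by $\langle A_a^{\varphi_1,\varphi_2}f,g\rangle=\int_{\mathbb{R}^{2d}}a(z)\,V_{\varphi_1}f(z)\,\overline{V_{\varphi_2}g(z)}\,dz$. The Berezin transform (with respect to $\varphi_1,\varphi_2$) of a bounded operator $T$ on $L^2(\mathbb{R}^d)$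 is the function $\mathcal{B}T(z)=\langle T\pi(z)\varphi_2,\pi(z)\varphi_1\rangle$, $z\in\mathbb{R}^{2d}$; it maps $\mathscr{S}^p$ boundedly into $L^p(\mathbb{R}^{2d})$. $\mathscr{S}^q$, $1\le q<\infty$, is the Schatten $q$-class on $L^2(\mathbb{R}^d)$ with its Schatten norm, and $\mathscr{S}^\infty$ consists of all compact operators on $L^2(\mathbb{R}^d)$, with the operator norm. *)

theory Defs
  imports "HOL-Analysis.Analysis"
begin

definition Lp :: "ennreal \<Rightarrow> ('a::euclidean_space \<Rightarrow> complex) set" where
  "Lp p = {f \<in> borel_measurable lborel.
     if p = \<infinity> then \<exists>C. AE x in lborel. cmod (f x) \<le> C
     else integrable lborel (\<lambda>x. cmod (f x) powr enn2real p)}"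

lemma Lp_2_iff:
  "f \<in> Lp 2 \<longleftrightarrow> f \<in> borel_measurable lborel \<and> integrable lborel (\<lambda>x. (cmod (f x))\<^sup>2)"
proof -
  have "cmod z powr 2 = (cmod z)\<^sup>2" for z
    by (cases "z = 0") (auto simp: powr_numeral)
  then show ?thesis
    by (simp add: Lp_def)
qed

lemma Lp_2_zero: "(\<lambda>x. 0) \<in> Lp 2"
  by (simp add: Lp_2_iff)

lemma Lp_2_add:
  assumes "f \<in> Lp 2" "g \<in> Lp 2"
  shows "(\<lambda>x. f x + g x) \<in> Lp 2"
proof -
  have [measurable]: "f \<in> borel_measurable lborel" "g \<in> borel_measurable lborel"
    using assms by (auto simp: Lp_2_iff)
  have "integrable lborel (\<lambda>x. (cmod (f x + g x))\<^sup>2)"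
  proof (rule Bochner_Integration.integrable_bound)
    show "integrable lborel (\<lambda>x. 2 * (cmod (f x))\<^sup>2 + 2 * (cmod (g x))\<^sup>2)"
      using assms by (auto simp: Lp_2_iff)
    have "(cmod (f x + g x))\<^sup>2 \<le> 2 * (cmod (f x))\<^sup>2 + 2 * (cmod (g x))\<^sup>2" for x
    proof -
      have "(cmod (f x + g x))\<^sup>2 \<le> (cmod (f x) + cmod (g x))\<^sup>2"
        by (simp add: norm_triangle_ineq power_mono)
      also have "\<dots> \<le> 2 * (cmod (f x))\<^sup>2 + 2 * (cmod (g x))\<^sup>2"
        using sum_squares_bound[of "cmod (f x)" "cmod (g x)"] by (simp add: power2_sum)
      finally show ?thesis .
    qed
    then show "AE x in lborel. norm ((cmod (f x + g x))\<^sup>2)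
        \<le> norm (2 * (cmod (f x))\<^sup>2 + 2 * (cmod (g x))\<^sup>2)"
      by auto
  qed measurable
  then show ?thesis
    by (simp add: Lp_2_iff)
qed

lemma Lp_2_scale:
  assumes "f \<in> Lp 2"
  shows "(\<lambda>x. c * f x) \<in> Lp 2"
  using assms by (auto simp: Lp_2_iff norm_mult power_mult_distrib)

lemma Lp_2_integrable_mult:
  assumes "f \<in> Lp 2" "g \<in> Lp 2"
  shows "integrable lborel (\<lambda>x. f x * cnj (g x))"
proof (rule Bochner_Integration.integrable_bound)
  show "integrable lborel (\<lambda>x. (cmod (f x))\<^sup>2 + (cmod (g x))\<^sup>2)"
    using assms by (auto simp: Lp_2_iff)
  have [measurable]: "f \<in> borel_measurable lborel" "g \<in> borel_measurable lborel"
    using assms by (auto simp: Lp_2_iff)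
  show "(\<lambda>x. f x * cnj (g x)) \<in> borel_measurable lborel"
    by (intro borel_measurable_times borel_measurable_continuous_on[of cnj] continuous_intros) auto
  have "cmod (f x) * cmod (g x) \<le> (cmod (f x))\<^sup>2 + (cmod (g x))\<^sup>2" for x
    using sum_squares_bound[of "cmod (f x)" "cmod (g x)"]
      mult_nonneg_nonneg[OF norm_ge_zero[of "f x"] norm_ge_zero[of "g x"]] by linarith
  then show "AE x in lborel. norm (f x * cnj (g x)) \<le> norm ((cmod (f x))\<^sup>2 + (cmod (g x))\<^sup>2)"
    by (auto simp: norm_mult)
qed

lemma AE_lborel_translate:
  fixes x :: "'a::euclidean_space"
  assumes "AE t in lborel. P t"
  shows "AE t in lborel. P (t - x)"
proof -
  have "AE t in distr lborel borel ((+) (- x)). P t"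
    unfolding lborel_distr_plus by (rule assms)
  then have "AE t in lborel. P (- x + t)"
    by (rule AE_distrD[rotated]) simp
  then show ?thesis by simp
qed

lemma Lp_2_shift:
  fixes f :: "'a::euclidean_space \<Rightarrow> complex"
  assumes "f \<in> Lp 2"
  shows "(\<lambda>t. exp (2 * of_real pi * \<i> * of_real (\<xi> \<bullet> t)) * f (t - x)) \<in> Lp 2"
proof -
  have [measurable]: "f \<in> borel_measurable lborel"
    using assms by (auto simp: Lp_2_iff)
  have "integrable (distr lborel borel ((+) (- x))) (\<lambda>t. (cmod (f t))\<^sup>2)"
    using assms by (simp add: Lp_2_iff lborel_distr_plus)
  then have "integrable lborel (\<lambda>t. (cmod (f (- x + t)))\<^sup>2)"
    by (subst (asm) integrable_distr_eq) auto
  moreover have "cmod (exp (2 * of_real pi * \<i> * of_real (\<xi> \<bullet> t))) = 1" for t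
    by simp
  moreover have "(\<lambda>t. exp (2 * of_real pi * \<i> * of_real (\<xi> \<bullet> t)) * f (t - x))
      \<in> borel_measurable lborel"
  proof -
    have "(\<lambda>t::'a. exp (2 * of_real pi * \<i> * of_real (\<xi> \<bullet> t)) :: complex)
        \<in> borel_measurable borel"
      by (intro borel_measurable_continuous_onI continuous_intros)
    then show ?thesis by simp
  qed
  ultimately show ?thesis
    by (simp add: Lp_2_iff norm_mult)
qed

definition l2_rel :: "('a::euclidean_space \<Rightarrow> complex) \<Rightarrow> ('a \<Rightarrow> complex) \<Rightarrow> bool" where
  "l2_rel f g \<longleftrightarrow> f \<in> Lp 2 \<and> g \<in> Lp 2 \<and> (AE x in lborel. f x = g x)"

quotient_type (overloaded) 'a l2 = "'a::euclidean_space \<Rightarrow> complex" / partial: l2_rel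
proof (rule part_equivpI)
  show "\<exists>f. l2_rel f f"
    using Lp_2_zero by (auto simp: l2_rel_def)
  show "symp l2_rel"
    by (auto simp: symp_def l2_rel_def elim: eventually_mono)
  show "transp l2_rel"
  proof (rule transpI)
    fix f g h :: "'b::euclidean_space \<Rightarrow> complex"
    assume "l2_rel f g" "l2_rel g h"
    then show "l2_rel f h"
      unfolding l2_rel_def by (auto elim: eventually_elim2)
  qed
qed

lift_definition scaleC_l2 :: "complex \<Rightarrow> 'a::euclidean_space l2 \<Rightarrow> 'a l2" (infixr \<open>*\<^sub>C\<close> 75)
  is "\<lambda>c f x. c * f x"
  by (auto simp: l2_rel_def Lp_2_scale)

lift_definition cinner :: "'a::euclidean_space l2 \<Rightarrow> 'a l2 \<Rightarrow> complex"
  is "\<lambda>f g. LINT x|lborel. f x * cnj (g x)"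
  unfolding l2_rel_def
  by (intro integral_cong_AE borel_measurable_integrable Lp_2_integrable_mult)
    (auto elim: eventually_elim2)

instantiation l2 :: (euclidean_space) real_vector
begin

lift_definition zero_l2 :: "'a l2" is "\<lambda>x. 0"
  by (simp add: l2_rel_def Lp_2_zero)

lift_definition plus_l2 :: "'a l2 \<Rightarrow> 'a l2 \<Rightarrow> 'a l2" is "\<lambda>f g x. f x + g x"
  unfolding l2_rel_def by (auto simp: Lp_2_add elim: eventually_elim2)

definition uminus_l2 :: "'a l2 \<Rightarrow> 'a l2" where "- f = (- 1) *\<^sub>C f"
definition minus_l2 :: "'a l2 \<Rightarrow> 'a l2 \<Rightarrow> 'a l2" where "f - g = f + - (g :: 'a l2)"
definition scaleR_l2 :: "real \<Rightarrow> 'a l2 \<Rightarrow> 'a l2" where "r *\<^sub>R f = of_real r *\<^sub>C f"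

instance
proof
  fix f g h :: "'a l2" and r s :: real
  show "f + g + h = f + (g + h)"
    by transfer (auto simp: l2_rel_def Lp_2_add algebra_simps)
  show "f + g = g + f"
    by transfer (auto simp: l2_rel_def Lp_2_add algebra_simps)
  show "0 + f = f"
    by transfer (auto simp: l2_rel_def)
  show "- f + f = 0"
    unfolding uminus_l2_def by transfer (auto simp: l2_rel_def Lp_2_add Lp_2_scale Lp_2_zero)
  show "f - g = f + - g"
    by (rule minus_l2_def)
  show "r *\<^sub>R (f + g) = r *\<^sub>R f + r *\<^sub>R g"
    unfolding scaleR_l2_def
    by transfer (auto simp: l2_rel_def Lp_2_add Lp_2_scale ring_distribs mult.assoc)
  show "(r + s) *\<^sub>R f = r *\<^sub>R f + s *\<^sub>R f"
    unfolding scaleR_l2_def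
    by transfer (auto simp: l2_rel_def Lp_2_add Lp_2_scale ring_distribs mult.assoc)
  show "r *\<^sub>R s *\<^sub>R f = (r * s) *\<^sub>R f"
    unfolding scaleR_l2_def
    by transfer (auto simp: l2_rel_def Lp_2_add Lp_2_scale ring_distribs mult.assoc)
  show "1 *\<^sub>R f = f"
    unfolding scaleR_l2_def by transfer (auto simp: l2_rel_def)
qed

end

definition l2_norm :: "'a::euclidean_space l2 \<Rightarrow> real" where
  "l2_norm f = sqrt (Re (cinner f f))"

instantiation l2 :: (euclidean_space) real_inner
begin

definition inner_l2 :: "'a l2 \<Rightarrow> 'a l2 \<Rightarrow> real" where "f \<bullet> g = Re (cinner f g)"
definition norm_l2 :: "'a l2 \<Rightarrow> real" where "norm f = l2_norm f"
definition sgn_l2 :: "'a l2 \<Rightarrow> 'a l2" where "sgn f = f /\<^sub>R l2_norm f"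
definition dist_l2 :: "'a l2 \<Rightarrow> 'a l2 \<Rightarrow> real" where "dist f g = l2_norm (f - g)"
definition uniformity_l2 :: "('a l2 \<times> 'a l2) filter" where
  "uniformity = (INF e\<in>{0 <..}. principal {(f, g :: 'a l2). l2_norm (f - g) < e})"
definition open_l2 :: "'a l2 set \<Rightarrow> bool" where
  "open U \<longleftrightarrow> (\<forall>f\<in>U. eventually (\<lambda>(f', g). f' = f \<longrightarrow> g \<in> U)
     (INF e\<in>{0 <..}. principal {(f, g :: 'a l2). l2_norm (f - g) < e}))"

instance
proof
  fix f g h :: "'a l2" and r :: real
  show "dist f g = norm (f - g)"
    by (simp add: dist_l2_def norm_l2_def)
  show "sgn f = f /\<^sub>R norm f"
    by (simp add: sgn_l2_def norm_l2_def)
  show "uniformity = (INF e\<in>{0 <..}. principal {(f, g :: 'a l2). dist f g < e})"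
    by (simp add: uniformity_l2_def norm_l2_def dist_l2_def)
  show "open U \<longleftrightarrow> (\<forall>f\<in>U. eventually (\<lambda>(f', g). f' = f \<longrightarrow> g \<in> U) uniformity)"
    for U :: "'a l2 set"
    by (simp add: open_l2_def uniformity_l2_def)
  show "norm f = sqrt (f \<bullet> f)"
    by (simp add: norm_l2_def l2_norm_def inner_l2_def)
  show "f \<bullet> g = g \<bullet> f"
    unfolding inner_l2_def
  proof transfer
    fix f g :: "'a \<Rightarrow> complex"
    have "(LINT x|lborel. f x * cnj (g x)) = (LINT x|lborel. cnj (g x * cnj (f x)))"
      by (simp add: mult.commute)
    also have "\<dots> = cnj (LINT x|lborel. g x * cnj (f x))"
      by (rule Bochner_Integration.integral_cnj)
    finally show "Re (LINT x|lborel. f x * cnj (g x)) = Re (LINT x|lborel. g x * cnj (f x))"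
      by simp
  qed
  show "(f + g) \<bullet> h = f \<bullet> h + g \<bullet> h"
    unfolding inner_l2_def
    by transfer (auto simp: l2_rel_def distrib_right Lp_2_integrable_mult)
  show "(r *\<^sub>R f) \<bullet> g = r * (f \<bullet> g)"
    unfolding inner_l2_def scaleR_l2_def by transfer (simp add: mult.assoc)
  have *: "Re (LINT x|lborel. f x * cnj (f x)) = (LINT x|lborel. (cmod (f x))\<^sup>2)"
    for f :: "'a \<Rightarrow> complex"
  proof -
    have "(LINT x|lborel. f x * cnj (f x)) = (LINT x|lborel. complex_of_real ((cmod (f x))\<^sup>2))"
      by (intro Bochner_Integration.integral_cong refl) (rule complex_norm_square[symmetric])
    also have "\<dots> = of_real (LINT x|lborel. (cmod (f x))\<^sup>2)"
      by (rule integral_complex_of_real)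
    finally show ?thesis
      by (simp only: Re_complex_of_real)
  qed
  show "0 \<le> f \<bullet> f"
    unfolding inner_l2_def by transfer (simp add: *)
  show "f \<bullet> f = 0 \<longleftrightarrow> f = 0"
    unfolding inner_l2_def
  proof transfer
    fix f :: "'a \<Rightarrow> complex"
    assume "l2_rel f f"
    then have f: "f \<in> Lp 2" by (simp add: l2_rel_def)
    then have "integrable lborel (\<lambda>x. (cmod (f x))\<^sup>2)"
      by (simp add: Lp_2_iff)
    then have "Re (LINT x|lborel. f x * cnj (f x)) = 0 \<longleftrightarrow> (AE x in lborel. (cmod (f x))\<^sup>2 = 0)"
      unfolding * by (rule integral_nonneg_eq_0_iff_AE) simp
    then show "Re (LINT x|lborel. f x * cnj (f x)) = 0 \<longleftrightarrow> l2_rel f (\<lambda>x. 0)"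
      using f by (simp add: l2_rel_def Lp_2_zero)
  qed
qed

end

lift_definition tf_shift :: "'a::euclidean_space \<times> 'a \<Rightarrow> 'a l2 \<Rightarrow> 'a l2"
  is "\<lambda>(x, \<xi>) f t. exp (2 * of_real pi * \<i> * of_real (\<xi> \<bullet> t)) * f (t - x)"
proof -
  fix z :: "'a \<times> 'a" and f g :: "'a \<Rightarrow> complex"
  assume "l2_rel f g"
  moreover obtain x \<xi> where "z = (x, \<xi>)"
    by (cases z)
  moreover have "AE t in lborel. f (t - x) = g (t - x)"
    using \<open>l2_rel f g\<close> AE_lborel_translate[where P="\<lambda>t. f t = g t" and x=x]
    by (simp add: l2_rel_def)
  ultimately show "l2_rel ((\<lambda>(x, \<xi>) f t. exp (2 * of_real pi * \<i> * of_real (\<xi> \<bullet> t)) * f (t - x)) z f)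
      ((\<lambda>(x, \<xi>) f t. exp (2 * of_real pi * \<i> * of_real (\<xi> \<bullet> t)) * f (t - x)) z g)"
    by (auto simp: l2_rel_def Lp_2_shift elim!: eventually_mono)
qed

definition stft :: "'a::euclidean_space l2 \<Rightarrow> 'a l2 \<Rightarrow> 'a \<times> 'a \<Rightarrow> complex" where
  "stft g f z = cinner f (tf_shift z g)"

definition bounded_ops :: "('a::euclidean_space l2 \<Rightarrow> 'a l2) set" where
  "bounded_ops = {T. bounded_linear T \<and> (\<forall>c f. T (c *\<^sub>C f) = c *\<^sub>C T f)}"

text \<open>For \<open>a\<close> in any \<open>L\<^sup>q\<close>, \<open>1 \<le> q \<le> \<infinity>\<close>, the integrand is integrable and the weak
  identity determines exactly one bounded operator.\<close>

definition loc_op ::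
  "'a::euclidean_space l2 \<Rightarrow> 'a l2 \<Rightarrow> ('a \<times> 'a \<Rightarrow> complex) \<Rightarrow> 'a l2 \<Rightarrow> 'a l2" where
  "loc_op \<phi>1 \<phi>2 a = (THE A. A \<in> bounded_ops \<and>
     (\<forall>f g. cinner (A f) g = (LINT z|lborel. a z * stft \<phi>1 f z * cnj (stft \<phi>2 g z))))"

definition berezin ::
  "'a::euclidean_space l2 \<Rightarrow> 'a l2 \<Rightarrow> ('a l2 \<Rightarrow> 'a l2) \<Rightarrow> 'a \<times> 'a \<Rightarrow> complex" where
  "berezin \<phi>1 \<phi>2 T z = cinner (T (tf_shift z \<phi>2)) (tf_shift z \<phi>1)"

definition compact_ops :: "('a::euclidean_space l2 \<Rightarrow> 'a l2) set" where
  "compact_ops = {T \<in> bounded_ops. compact (closure (T ` cball 0 1))}"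

definition orthonormal_seq :: "(nat \<Rightarrow> 'a::euclidean_space l2) \<Rightarrow> bool" where
  "orthonormal_seq e \<longleftrightarrow> (\<forall>j k. cinner (e j) (e k) = (if j = k then 1 else 0))"

text \<open>Singular value decomposition. Since the space is infinite-dimensional, the orthonormal
  sequences can be taken infinite also for operators of finite rank, whose singular value
  sequence ends in zeros. The sequence of singular values of a compact operator exists and is
  unique.\<close>

definition has_singular_values :: "('a::euclidean_space l2 \<Rightarrow> 'a l2) \<Rightarrow> (nat \<Rightarrow> real) \<Rightarrow> bool" where
  "has_singular_values T s \<longleftrightarrow> decseq s \<and> s \<longlonglongrightarrow> 0 \<and>
     (\<exists>e f. orthonormal_seq e \<and> orthonormal_seq f \<and>
        (\<forall>h. (\<lambda>k. (of_real (s k) * cinner h (e k)) *\<^sub>C f k) sums T h))"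

definition singular_values :: "('a::euclidean_space l2 \<Rightarrow> 'a l2) \<Rightarrow> nat \<Rightarrow> real" where
  "singular_values T = (SOME s. has_singular_values T s)"

definition schatten :: "ennreal \<Rightarrow> ('a::euclidean_space l2 \<Rightarrow> 'a l2) set" where
  "schatten p = {T \<in> compact_ops.
     p \<noteq> \<infinity> \<longrightarrow> summable (\<lambda>k. singular_values T k powr enn2real p)}"

definition schatten_norm :: "ennreal \<Rightarrow> ('a::euclidean_space l2 \<Rightarrow> 'a l2) \<Rightarrow> real" where
  "schatten_norm p T = (if p = \<infinity> then onorm T
     else (\<Sum>k. singular_values T k powr enn2real p) powr (1 / enn2real p))"

text \<open>Elements of \<open>Lp p\<close> are functions, hence injectivity is modulo equality almost everywhere.\<close>

definition berezin_one_to_one :: "'a::euclidean_space l2 \<Rightarrow> 'a l2 \<Rightarrow> ennreal \<Rightarrow> bool" where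
  "berezin_one_to_one \<phi>1 \<phi>2 p \<longleftrightarrow>
     (\<forall>T\<in>schatten p. berezin \<phi>1 \<phi>2 T \<in> Lp p) \<and>
     (\<forall>S\<in>schatten p. \<forall>T\<in>schatten p.
        (AE z in lborel. berezin \<phi>1 \<phi>2 S z = berezin \<phi>1 \<phi>2 T z) \<longrightarrow> S = T)"

text \<open>For \<open>q = \<infinity>\<close> a localization operator with symbol in \<open>L\<^sup>\<infinity>\<close> is bounded but need not be compact
  (the constant symbol 1 can give the identity). Therefore \<open>X\<close> is required to be contained in
  the Schatten class only for finite \<open>q\<close>; in either case the approximating
  operators must belong to the class.\<close>

definition norm_dense_in_schatten :: "ennreal \<Rightarrow> ('a::euclidean_space l2 \<Rightarrow> 'a l2) set \<Rightarrow> bool" where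
  "norm_dense_in_schatten q X \<longleftrightarrow>
     (q \<noteq> \<infinity> \<longrightarrow> X \<subseteq> schatten q) \<and>
     (\<forall>T\<in>schatten q. \<forall>\<epsilon>>0. \<exists>A\<in>X \<inter> schatten q. schatten_norm q (\<lambda>f. T f - A f) < \<epsilon>)"

text \<open>In \<open>ennreal\<close> division by 0 gives \<open>\<infinity>\<close>, so \<open>p / (p - 1)\<close> is the conjugate index also for
  \<open>p = 1\<close>.\<close>

lemma conjugate_index_1: "(1::ennreal) / (1 - 1) = \<infinity>"
  by simp

end

theory Submission
  imports Defs "HOL-Probability.Characteristic_Functions"
begin

text \<open>
  By Moyal's identity, sending \<open>F \<in> L\<^sup>2(\<real>\<^sup>2\<^sup>d)\<close> to the operator \<open>A\<^sub>F\<close> with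
  \<open>\<langle>A\<^sub>F f, g\<rangle> = \<integral> F(w) V\<^sub>g f(w) dw\<close> is an isometry onto the Hilbert--Schmidt operators. Since time-frequency
  shifts commute up to a phase, the Berezin transform of \<open>A\<^sub>F\<close> is the symplectic Fourier transform of the
  integrable function \<open>F V\<^bsub>\<phi>1\<^esub>\<phi>2\<close>. Every operator in \<open>S\<^sup>p\<close>, \<open>p \<le> 2\<close>, is Hilbert--Schmidt, so uniqueness of the Fourier
  transform gives injectivity when \<open>V\<^bsub>\<phi>1\<^esub>\<phi>2\<close> is almost everywhere non-zero; conversely, an \<open>F\<close> supported on the zero set
  of \<open>V\<^bsub>\<phi>1\<^esub>\<phi>2\<close> gives an operator in the kernel. In the same way the localization operator whose symbol is the symplectic
  Fourier transform of \<open>b\<close> is \<open>A\<^sub>F\<close> with \<open>F = b \<cdot> cnj (V\<^bsub>\<phi>2\<^esub>\<phi>1)\<close>, and such \<open>F\<close> with \<open>b\<close> a modulated Gaussian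
  span a dense subspace of \<open>L\<^sup>2\<close>. Density in \<open>S\<^sup>q\<close>, \<open>q \<ge> 2\<close>, follows by truncating the singular value decomposition,
  because \<open>\<Sum> \<parallel>T e\<^sub>k\<parallel>\<^sup>q\<close> over an orthonormal sequence never exceeds the sum of the \<open>q\<close>-th powers of the singular values,
  which replaces the triangle inequality for the Schatten norm.
\<close>

section \<open>The Fourier transform on Euclidean spaces\<close>

text \<open>Density in a Schatten class is commonly deduced from injectivity by trace duality. Here
  both claims are instead reduced to the one Hilbert space of kernels \<open>F\<close>. This is
  possible because 2 separates the exponents: operators with \<open>p \<le> 2\<close> have such
  kernels, and for \<open>q \<ge> 2\<close> closeness of kernels in square norm forces closeness in
  the Schatten sense, for all \<open>q\<close> at once and also in operator norm. The obstacle is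
  that \<open>singular_values\<close> is a sequence picked by a choice operator, so a difference of
  two operators cannot be estimated from the singular values of its parts. Estimates are therefore
  proved along every orthonormal sequence and only at the end read along the singular vectors of the
  operator in question. Gaussians carry the analysis in four roles: as mollifiers, as functions on
  which Plancherel's identity is computed by hand, as windows whose ambiguity function vanishes
  nowhere, and as a source of symbols that are both bounded and integrable.\<close>

definition echar :: "'a::euclidean_space \<Rightarrow> 'a \<Rightarrow> complex" where
  "echar u t = exp (2 * of_real pi * \<i> * of_real (u \<bullet> t))"

lemma echar_cis: "echar u t = cis (2 * pi * (u \<bullet> t))"
  by (simp add: echar_def cis_conv_exp mult_ac)

lemma norm_echar [simp]: "cmod (echar u t) = 1"
  by (simp add: echar_cis)

lemma echar_0 [simp]: "echar 0 t = 1" "echar u 0 = 1"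
  by (simp_all add: echar_def)

lemma echar_commute: "echar u t = echar t u"
  by (simp add: echar_def inner_commute)

lemma echar_add: "echar (u + v) t = echar u t * echar v t"
  and echar_add_right: "echar t (u + v) = echar t u * echar t v"
  by (simp_all add: echar_def inner_add_left inner_add_right ring_distribs exp_add)

lemma cnj_echar [simp]: "cnj (echar u t) = echar (- u) t"
  by (simp add: echar_cis cis_cnj)

lemma echar_minus_right: "echar u (- t) = echar (- u) t"
  by (simp add: echar_def)

lemma echar_diff: "echar (u - v) t = echar u t * echar (- v) t"
  using echar_add[of u "- v" t] by simp

lemma echar_minus_cancel [simp]: "echar u t * echar (- u) t = 1" "echar (- u) t * echar u t = 1"
  using echar_add[of u "- u" t] echar_add[of "- u" u t] by simp_all

lemma borel_measurable_echar [measurable (raw)]: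
  assumes [measurable]: "f \<in> borel_measurable M" "g \<in> borel_measurable M"
  shows "(\<lambda>x. echar (f x) (g x)) \<in> borel_measurable M"
  unfolding echar_cis cis_conv_exp
  by (rule borel_measurable_continuous_on[where f="\<lambda>x::real. exp (\<i> * of_real x)"])
    (auto intro!: continuous_intros)

lemma borel_measurable_cis [measurable]: "cis \<in> borel_measurable borel"
  unfolding cis_conv_exp by (intro borel_measurable_continuous_onI continuous_intros)

lemma borel_measurable_cnj [measurable (raw)]:
  "f \<in> borel_measurable M \<Longrightarrow> (\<lambda>x. cnj (f x)) \<in> borel_measurable M"
  by (rule borel_measurable_continuous_on[of cnj]) (intro continuous_intros)

section \<open>The Gaussian and its Fourier transform\<close>

definition gauss :: "'a::euclidean_space \<Rightarrow> real" where
  "gauss t = exp (- pi * (norm t)\<^sup>2)"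

lemma gauss_pos [simp]: "0 < gauss t" "0 \<le> gauss t" "gauss t \<noteq> 0"
  by (simp_all add: gauss_def)

lemma gauss_le_1 [simp]: "gauss t \<le> 1"
  by (simp add: gauss_def)

lemma gauss_minus [simp]: "gauss (- t) = gauss t"
  by (simp add: gauss_def)

lemma borel_measurable_gauss [measurable]: "gauss \<in> borel_measurable borel"
  unfolding gauss_def by measurable

lemma gauss_prod: "gauss (\<Sum>b\<in>Basis. f b *\<^sub>R b :: 'a::euclidean_space) = (\<Prod>b\<in>Basis. gauss (f b :: real))"
proof -
  have "(norm (\<Sum>b\<in>Basis. f b *\<^sub>R b :: 'a))\<^sup>2 = (\<Sum>b\<in>Basis. (f b)\<^sup>2)"
    unfolding power2_norm_eq_inner
    by (subst euclidean_inner) (simp add: power2_eq_square)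
  then show ?thesis
    by (simp add: gauss_def exp_sum[symmetric] sum_distrib_left sum_negf)
qed

lemma
  fixes f :: "'a::euclidean_space \<Rightarrow> 'b::{banach, second_countable_topology}" and g :: "'a \<Rightarrow> ennreal"
  shows lborel_integral_affine: "c \<noteq> 0 \<Longrightarrow> f \<in> borel_measurable borel \<Longrightarrow>
      (LINT x|lborel. f x) = \<bar>c\<bar> ^ DIM('a) *\<^sub>R (LINT x|lborel. f (t + c *\<^sub>R x))"
    and lborel_nn_integral_affine: "c \<noteq> 0 \<Longrightarrow> g \<in> borel_measurable borel \<Longrightarrow>
      (\<integral>\<^sup>+x. g x \<partial>lborel) = \<bar>c\<bar> ^ DIM('a) * (\<integral>\<^sup>+x. g (t + c *\<^sub>R x) \<partial>lborel)"
   apply (subst lborel_affine[of c t], simp)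
   apply (subst integral_density)
      apply (simp_all add: integral_distr)
  apply (subst lborel_affine[of c t], simp)
  apply (simp add: nn_integral_density nn_integral_distr nn_integral_cmult ennreal_power)
  done

lemma lborel_integrable_affine:
  fixes f :: "'a::euclidean_space \<Rightarrow> 'b::{banach, second_countable_topology}"
  assumes "c \<noteq> 0" "integrable lborel f"
  shows "integrable lborel (\<lambda>x. f (t + c *\<^sub>R x))"
proof -
  have [measurable]: "f \<in> borel_measurable borel" using assms by auto
  show ?thesis
    using assms(2) lborel_nn_integral_affine[of c "\<lambda>x. ennreal (norm (f x))" t] assms(1)
    by (auto simp: integrable_iff_bounded ennreal_mult_less_top)
qed

text \<open>This is the characteristic function of the standard normal law after the substitution
  \<open>sqrt (2 * pi) * t\<close>. The factor \<open>pi\<close> in \<open>gauss\<close> makes the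
  function its own Fourier transform with total mass 1, so that no constants enter the
  mollifiers.\<close>

lemma ft_gauss_real:
  "integrable lborel (\<lambda>t::real. gauss t)"
  "(LINT t|lborel. of_real (gauss t) * cis (2 * pi * (u * t))) = of_real (gauss (u::real))"
proof -
  have eq: "gauss t = sqrt (2 * pi) * std_normal_density (0 + sqrt (2 * pi) * t)" for t :: real
    by (simp add: gauss_def std_normal_density_def power_mult_distrib)
  show "integrable lborel (\<lambda>t::real. gauss t)"
    unfolding eq by (intro integrable_mult_right lborel_integrable_real_affine) auto
  have "of_real (exp (- (u * sqrt (2 * pi))\<^sup>2 / 2)) = char std_normal_distribution (u * sqrt (2 * pi))"
    by (simp add: char_std_normal_distribution)
  also have "\<dots> = (LINT x|lborel. std_normal_density x *\<^sub>R iexp (u * sqrt (2 * pi) * x))"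
    unfolding char_def by (subst integral_density) auto
  also have "\<dots> = (LINT x|lborel. of_real (gauss x) * cis (2 * pi * (u * x)))"
  proof -
    have s: "sqrt (2*pi) * (sqrt (2*pi) * x) = 2 * pi * x" for x
      by (simp add: mult.assoc[symmetric])
    show ?thesis
      by (subst lborel_integral_real_affine[of "sqrt (2 * pi)" _ 0])
        (simp_all add: eq cis_conv_exp scaleR_conv_of_real mult_ac s)
  qed
  finally show "(LINT t|lborel. of_real (gauss t) * cis (2 * pi * (u * t))) = of_real (gauss (u::real))"
    by (simp add: gauss_def power_mult_distrib mult_ac)
qed

lemma integrable_gauss [simp]: "integrable lborel (gauss :: 'a::euclidean_space \<Rightarrow> real)"
proof -
  interpret product_sigma_finite "\<lambda>_::'a. lborel :: real measure" ..
  show ?thesis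
    apply (subst lborel_eq)
    apply (subst integrable_distr_eq)
      apply (simp_all add: gauss_prod)
    apply (intro product_integrable_prod ft_gauss_real)
    by simp
qed

lemma integral_gauss_echar:
  "(LINT t|lborel. of_real (gauss t) * echar u t) = of_real (gauss (u :: 'a::euclidean_space))"
proof -
  interpret product_sigma_finite "\<lambda>_::'a. lborel :: real measure" ..
  have cp: "cis (\<Sum>b\<in>B. f b) = (\<Prod>b\<in>B. cis (f b))" for f :: "'a \<Rightarrow> real" and B
    by (induction B rule: infinite_finite_induct) (auto simp: cis_mult[symmetric])
  have "(LINT t|lborel. of_real (gauss t) * echar u t) =
     (LINT f|(\<Pi>\<^sub>M b\<in>(Basis::'a set). (lborel :: real measure)). (\<Prod>b\<in>Basis. of_real (gauss (f b)) * cis (2 * pi * ((u \<bullet> b) * f b))))"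
    apply (subst lborel_eq)
    apply (subst integral_distr)
      apply (simp_all add: gauss_prod echar_cis inner_sum_right cp sum_distrib_left prod.distrib mult_ac)
    done
  also have "\<dots> = (\<Prod>b\<in>Basis. (LINT t|lborel. of_real (gauss t) * cis (2 * pi * ((u \<bullet> b) * t))))"
  proof (rule product_integral_prod)
    fix i :: 'a
    show "integrable lborel (\<lambda>t. complex_of_real (gauss t) * cis (2 * pi * (u \<bullet> i * t)))"
      apply (rule Bochner_Integration.integrable_bound[OF ft_gauss_real(1)])
       apply (simp_all add: norm_mult cis_conv_exp)
      done
  qed simp
  also have "\<dots> = of_real (\<Prod>b\<in>Basis. gauss (u \<bullet> b))"
    by (simp add: ft_gauss_real(2))
  also have "\<dots> = of_real (gauss u)"
    by (subst gauss_prod[symmetric]) (simp add: euclidean_representation)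
  finally show ?thesis .
qed

lemma integral_gauss: "(LINT t|lborel. gauss (t :: 'a::euclidean_space)) = 1"
proof -
  have "complex_of_real (LINT t|lborel. gauss (t :: 'a)) = 1"
    using integral_gauss_echar[of "0::'a"] by (simp add: gauss_def)
  then show ?thesis by simp
qed

section \<open>The Fourier transform of integrable functions\<close>

definition ft :: "('a::euclidean_space \<Rightarrow> complex) \<Rightarrow> 'a \<Rightarrow> complex" where
  "ft h u = (LINT t|lborel. h t * echar u t)"

lemma integrable_mult_echar [simp]:
  assumes "integrable lborel h"
  shows "integrable lborel (\<lambda>t. h t * echar u t)"
proof (rule Bochner_Integration.integrable_bound[OF assms])
  have [measurable]: "h \<in> borel_measurable borel" using assms by auto
  show "(\<lambda>t. h t * echar u t) \<in> borel_measurable lborel" by simp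
qed (simp add: norm_mult)

lemma borel_measurable_ft [measurable]:
  assumes [measurable]: "h \<in> borel_measurable borel"
  shows "ft h \<in> borel_measurable borel"
proof -
  have "(\<lambda>u. LINT t|lborel. h t * echar u t) \<in> borel_measurable borel"
    by (rule lborel.borel_measurable_lebesgue_integral) measurable
  then show ?thesis by (simp add: ft_def[abs_def])
qed

lemma norm_ft_le: "cmod (ft h u) \<le> (LINT t|lborel. cmod (h t))"
proof -
  have "cmod (ft h u) \<le> (LINT t|lborel. cmod (h t * echar u t))"
    unfolding ft_def by (rule integral_norm_bound)
  then show ?thesis by (simp add: norm_mult)
qed

text \<open>Fubini for \<open>h t * m u * echar (A u) t\<close>, read in both orders. The adjoint
  pair \<open>A\<close>, \<open>B\<close> covers the ordinary formula, where both are the identity,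
  and the symplectic one, where \<open>A\<close> is \<open>sympJ\<close> and \<open>B\<close> is its
  negative.\<close>

lemma ft_multiplication_formula_adjoint:
  fixes h m :: "'a::euclidean_space \<Rightarrow> complex"
  assumes h: "integrable lborel h" and m: "integrable lborel m"
    and A [measurable]: "A \<in> borel_measurable borel" and adj: "\<And>u t. A u \<bullet> t = B t \<bullet> u"
  shows "(LINT u|lborel. ft h (A u) * m u) = (LINT t|lborel. h t * ft m (B t))"
proof -
  have [measurable]: "h \<in> borel_measurable borel" "m \<in> borel_measurable borel" using h m by auto
  have echar_adj: "echar (A u) t = echar (B t) u" for u t by (simp add: echar_def adj)
  have "integrable (lborel \<Otimes>\<^sub>M lborel) (\<lambda>(t, u). h t * m u * echar (A u) t)"
  proof (rule lborel_pair.Fubini_integrable)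
    show "integrable lborel (\<lambda>x. LINT y|lborel. cmod (case (x, y) of (t, u) \<Rightarrow> h t * m u * echar (A u) t))"
      using h by (simp add: norm_mult)
    show "AE x in lborel. integrable lborel (\<lambda>y. case (x, y) of (t, u) \<Rightarrow> h t * m u * echar (A u) t)"
    proof (rule AE_I2)
      fix x
      have "integrable lborel (\<lambda>y. h x * (m y * echar (B x) y))"
        using m by (intro integrable_mult_right integrable_mult_echar)
      then show "integrable lborel (\<lambda>y. case (x, y) of (t, u) \<Rightarrow> h t * m u * echar (A u) t)"
        by (simp add: echar_adj mult_ac)
    qed
  qed measurable
  from lborel_pair.Fubini_integral[OF this]
  have "(LINT u|lborel. LINT t|lborel. h t * m u * echar (A u) t) = (LINT t|lborel. LINT u|lborel. h t * m u * echar (A u) t)"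
    by simp
  moreover have "(LINT t|lborel. h t * m u * echar (A u) t) = ft h (A u) * m u" for u
    by (simp add: ft_def mult.left_commute[of "h _" "m u"] mult.assoc)
  moreover have "(LINT u|lborel. h t * m u * echar (A u) t) = h t * ft m (B t)" for t
    by (simp add: ft_def mult.assoc echar_adj)
  ultimately show ?thesis by simp
qed

lemma ft_multiplication_formula:
  fixes h m :: "'a::euclidean_space \<Rightarrow> complex"
  assumes "integrable lborel h" "integrable lborel m"
  shows "(LINT u|lborel. ft h u * m u) = (LINT t|lborel. h t * ft m t)"
  by (rule ft_multiplication_formula_adjoint[OF assms]) (simp_all add: inner_commute)

lemma integral_scaled_gauss_echar:
  fixes x :: "'a::euclidean_space"
  assumes "r > 0"
  shows "(LINT u|lborel. of_real (gauss (r *\<^sub>R u)) * echar x u) = of_real (gauss (x /\<^sub>R r) / r ^ DIM('a))"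
proof -
  have "of_real (gauss (x /\<^sub>R r)) = (LINT u|lborel. of_real (gauss u) * echar (x /\<^sub>R r) u)"
    by (simp add: integral_gauss_echar)
  also have "\<dots> = r ^ DIM('a) *\<^sub>R (LINT u|lborel. of_real (gauss (r *\<^sub>R u)) * echar x u)"
    using assms by (subst lborel_integral_affine[of r _ 0]) (auto simp: echar_cis mult.assoc[symmetric])
  finally show ?thesis using assms by (simp add: scaleR_conv_of_real)
qed

lemma integrable_scaled_gauss:
  fixes x :: "'a::euclidean_space"
  assumes "r \<noteq> 0"
  shows "integrable lborel (\<lambda>u. gauss (x + r *\<^sub>R u))"
  using assms by (intro lborel_integrable_affine) auto

text \<open>The multiplication formula with a dilated and modulated Gaussian as test function. It is
  an approximate inversion formula: the damped inverse transform of \<open>ft h\<close> at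
  \<open>x\<close> averages \<open>h\<close> over a Gaussian of width \<open>r\<close> around
  \<open>x\<close>.\<close>

lemma ft_scaled_gauss:
  fixes h :: "'a::euclidean_space \<Rightarrow> complex"
  assumes h: "integrable lborel h" and r: "r > 0"
  shows "(LINT u|lborel. ft h u * (of_real (gauss (r *\<^sub>R u)) * echar (- x) u)) =
         (LINT t|lborel. h t * of_real (gauss ((t - x) /\<^sub>R r) / r ^ DIM('a)))"
proof -
  have "integrable lborel (\<lambda>u. complex_of_real (gauss (0 + r *\<^sub>R u)) * echar (- x) u)"
    using r by (intro integrable_mult_echar integrable_of_real integrable_scaled_gauss) auto
  then have i: "integrable lborel (\<lambda>u. complex_of_real (gauss (r *\<^sub>R u)) * echar (- x) u)" by simp
  have "ft (\<lambda>u. complex_of_real (gauss (r *\<^sub>R u)) * echar (- x) u) t =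
        of_real (gauss ((t - x) /\<^sub>R r) / r ^ DIM('a))" for t
  proof -
    have "ft (\<lambda>u. complex_of_real (gauss (r *\<^sub>R u)) * echar (- x) u) t =
       (LINT u|lborel. of_real (gauss (r *\<^sub>R u)) * echar (t - x) u)"
      by (simp add: ft_def echar_diff mult_ac)
    then show ?thesis using integral_scaled_gauss_echar[OF r] by simp
  qed
  then show ?thesis
    by (subst ft_multiplication_formula[OF h i]) simp
qed

text \<open>Away from the frontier the indicator is locally constant, so for every \<open>y\<close>
  the integrand is eventually constant, and \<open>gauss\<close> dominates. The excluded frontier is
  a null set.\<close>

lemma gauss_mollifier_tendsto_box:
  fixes a b :: "'a::euclidean_space"
  assumes t: "t \<notin> cbox a b - box a b"
  shows "(\<lambda>n. LINT y|lborel. gauss y * indicat_real (box a b) (t + (1 / real (Suc n)) *\<^sub>R y))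
    \<longlonglongrightarrow> indicat_real (box a b) t"
proof -
  have lim: "(\<lambda>n. t + (1 / real (Suc n)) *\<^sub>R y) \<longlonglongrightarrow> t" for y
    using tendsto_add[OF tendsto_const[of t] tendsto_scaleR[OF LIMSEQ_inverse_real_of_nat tendsto_const[of y]]]
    by (simp add: inverse_eq_divide)
  have pw: "(\<lambda>n. indicat_real (box a b) (t + (1 / real (Suc n)) *\<^sub>R y)) \<longlonglongrightarrow> indicat_real (box a b) t" for y
  proof -
    have "t \<in> box a b \<or> t \<in> - cbox a b" using t by auto
    then have "\<forall>\<^sub>F n in sequentially. indicat_real (box a b) (t + (1 / real (Suc n)) *\<^sub>R y) = indicat_real (box a b) t"
    proof
      assume "t \<in> box a b"
      with topological_tendstoD[OF lim[of y] open_box this] show ?thesis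
        by (auto elim!: eventually_mono)
    next
      assume "t \<in> - cbox a b"
      with topological_tendstoD[OF lim[of y] _ this] show ?thesis
        using box_subset_cbox[of a b] by (fastforce elim!: eventually_mono simp: indicator_def open_Compl[OF closed_cbox] simp del: of_nat_Suc)
    qed
    then show ?thesis
      by (rule tendsto_eventually)
  qed
  have "(\<lambda>n. LINT y|lborel. gauss y * indicat_real (box a b) (t + (1 / real (Suc n)) *\<^sub>R y))
      \<longlonglongrightarrow> (LINT y|(lborel::'a measure). gauss y * indicat_real (box a b) t)"
    by (rule integral_dominated_convergence[where w="gauss :: 'a \<Rightarrow> real"])
      (auto intro!: AE_I2 pw simp: abs_mult mult_left_le simp del: of_nat_Suc)
  then show ?thesis by (simp add: integral_gauss)
qed

text \<open>Dynkin's argument: boxes are stable under intersection and generate the Borel sets, and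
  the sets over which \<open>h\<close> integrates to 0 are closed under complements and countable
  disjoint unions.\<close>

lemma integral_box_zero_imp_AE_zero:
  fixes h :: "'a::euclidean_space \<Rightarrow> complex"
  assumes h: "integrable lborel h"
    and box: "\<And>a b. (LINT t:box a b|lborel. h t) = 0"
  shows "AE t in lborel. h t = 0"
proof (rule sigma_finite_measure.density_zero[OF sigma_finite_lborel h])
  fix A :: "'a set" assume "A \<in> sets lborel"
  then have A: "A \<in> sigma_sets UNIV (range (\<lambda>(a, b). box a b))"
    by (simp add: borel_eq_box)
  have i: "set_integrable lborel A h" if "A \<in> sets borel" for A
    using h that by (simp add: set_integrable_def integrable_mult_indicator)
  \<comment> \<open>The complement step needs the integral over the whole space, which is not a box
    but an increasing union of boxes.\<close>
  have UNIV: "(LINT t|lborel. h t) = 0"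
  proof -
    let ?A = "\<lambda>n::nat. box (- (real n *\<^sub>R One)) (real n *\<^sub>R One) :: 'a set"
    have U: "(\<Union>n. ?A n) = UNIV" by (rule UN_box_eq_UNIV)
    have "(\<lambda>n. LINT t:?A n|lborel. h t) \<longlonglongrightarrow> (LINT t:(\<Union>n. ?A n)|lborel. h t)"
    proof (rule set_integral_cont_up)
      show "incseq ?A"
        by (intro incseq_SucI subset_box_imp) (auto simp: inner_Basis)
      show "set_integrable lborel (\<Union>n. ?A n) h" unfolding U by (rule i) simp
    qed simp
    then show ?thesis unfolding U box by (simp add: set_lebesgue_integral_def LIMSEQ_const_iff)
  qed
  have "Int_stable (range (\<lambda>(a, b). box a b :: 'a set))"
    by (force simp: Int_stable_def box_Int_box image_iff)
  moreover have "range (\<lambda>(a, b). box a b) \<subseteq> Pow (UNIV :: 'a set)" by simp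
  ultimately show "(LINT t:A|lborel. h t) = 0" using A
  proof (induction A rule: sigma_sets_induct_disjoint)
    case (union A)
    have "range A \<subseteq> sets borel" using union(2) by (simp add: borel_eq_box)
    then have "(LINT t:(\<Union>n. A n)|lborel. h t) = (\<Sum>n. LINT t:A n|lborel. h t)"
      using union(1) by (intro lebesgue_integral_countable_add i) (auto simp: disjoint_family_on_def)
    then show ?case by (simp add: union)
  next
    case (compl A)
    then have "A \<in> sets borel" by (simp add: borel_eq_box)
    have "(LINT t|lborel. h t) = (LINT t:A|lborel. h t) + (LINT t:UNIV - A|lborel. h t)"
      using set_integral_Un[of A "UNIV - A" lborel h] i \<open>A \<in> sets borel\<close>
      by (simp add: set_lebesgue_integral_def[of _ UNIV])
    then show ?case using compl UNIV by simp
  qed (use box in \<open>auto simp: set_lebesgue_integral_def\<close>)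
qed

text \<open>Letting the mollifier shrink pointwise would require Lebesgue points of
  \<open>h\<close>. Integrating over a box first and exchanging the integrals moves the mollifier
  onto the indicator of the box, where its limit is elementary.\<close>

theorem ft_eq_zero_imp_AE_zero:
  fixes h :: "'a::euclidean_space \<Rightarrow> complex"
  assumes h: "integrable lborel h" and ft0: "AE u in lborel. ft h u = 0"
  shows "AE t in lborel. h t = 0"
proof (rule integral_box_zero_imp_AE_zero[OF h])
  fix a b :: 'a
  have [measurable]: "h \<in> borel_measurable borel" using h by auto
  let ?d = "DIM('a)"
  define Q where "Q = box a b"
  have [measurable]: "Q \<in> sets borel" by (simp add: Q_def)
  have 0: "(LINT t|lborel. h t * of_real (gauss ((t - x) /\<^sub>R r) / r ^ ?d)) = 0" if "r > 0" for x r
  proof -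
    have "(LINT u|lborel. ft h u * (of_real (gauss (r *\<^sub>R u)) * echar (- x) u)) = (LINT u|(lborel::'a measure). 0)"
      by (intro integral_cong_AE) (use ft0 in auto)
    then show ?thesis using ft_scaled_gauss[OF h that] by simp
  qed
  have 1: "(LINT t|lborel. h t * of_real (LINT y|lborel. gauss y * indicat_real Q (t + r *\<^sub>R y))) = 0"
    if r: "r > 0" for r
  proof -
    \<comment> \<open>For fixed \<open>x\<close> the integral of \<open>h t * G t x\<close> over
      \<open>t\<close> vanishes by \<open>0\<close>; for fixed \<open>t\<close> the integral of
      \<open>G t x\<close> over \<open>x\<close> is the mollified indicator. Fubini compares the
      two.\<close>
    define G where "G t x = gauss ((t - x) /\<^sub>R r) / r ^ ?d * indicat_real Q x" for t x
    have [measurable]: "case_prod G \<in> borel_measurable (borel \<Otimes>\<^sub>M borel)"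
      unfolding G_def by measurable
    have Gi: "integrable lborel (\<lambda>x. gauss ((t - x) /\<^sub>R r) / r ^ ?d)" for t
      using integrable_scaled_gauss[of "- 1 / r" "t /\<^sub>R r"] r
      by (simp add: scaleR_diff_right divide_inverse)
    then have Gi: "integrable lborel (G t)" for t
      unfolding G_def by (intro integrable_real_mult_indicator) auto
    have GI: "(LINT x|lborel. G t x) = (LINT y|lborel. gauss y * indicat_real Q (t + r *\<^sub>R y))" for t
      unfolding G_def using r
      by (subst lborel_integral_affine[of r _ t]) simp_all
    have GI_le: "(LINT x|lborel. G t x) \<le> 1" for t
    proof -
      have "(LINT x|lborel. G t x) \<le> (LINT y|lborel. gauss (y::'a))"
        unfolding GI by (rule integral_mono) (auto simp: indicator_def intro!: Bochner_Integration.integrable_bound[OF integrable_gauss])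
      then show ?thesis by (simp add: integral_gauss)
    qed
    have G0: "0 \<le> G t x" for t x using r by (simp add: G_def)
    have "integrable (lborel \<Otimes>\<^sub>M lborel) (\<lambda>(t, x). h t * of_real (G t x))"
    proof (rule lborel_pair.Fubini_integrable)
      have "integrable lborel (\<lambda>t. cmod (h t) * (LINT x|lborel. G t x))"
      proof (rule Bochner_Integration.integrable_bound)
        show "integrable lborel (\<lambda>t. cmod (h t))" using h by simp
        show "AE t in lborel. norm (cmod (h t) * (LINT x|lborel. G t x)) \<le> norm (cmod (h t))"
          using GI_le G0 by (auto simp: abs_mult intro!: mult_left_le)
      qed measurable
      then show "integrable lborel (\<lambda>t. LINT x|lborel. cmod (case (t, x) of (t, x) \<Rightarrow> h t * of_real (G t x)))"
        using G0 by (simp add: norm_mult)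
      show "AE t in lborel. integrable lborel (\<lambda>x. case (t, x) of (t, x) \<Rightarrow> h t * of_real (G t x))"
        using Gi by (simp add: integrable_of_real)
    qed measurable
    from lborel_pair.Fubini_integral[OF this]
    have "(LINT t|lborel. LINT x|lborel. h t * of_real (G t x)) = (LINT x|lborel. LINT t|lborel. h t * of_real (G t x))"
      by simp
    also have "\<dots> = (LINT x|(lborel::'a measure). 0)"
      using 0[OF r] by (intro Bochner_Integration.integral_cong) (auto simp: G_def indicator_def)
    finally show ?thesis by (simp add: GI)
  qed
  have "(\<lambda>n. LINT t|lborel. h t * of_real (LINT y|lborel. gauss y * indicat_real Q (t + (1 / real (Suc n)) *\<^sub>R y)))
     \<longlonglongrightarrow> (LINT t|lborel. h t * of_real (indicat_real Q t))"
  proof (rule integral_dominated_convergence[where w="\<lambda>t. cmod (h t)"])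
    have "cbox a b - box a b \<in> null_sets lborel"
      using negligible_frontier_interval[of a b]
      by (simp add: negligible_iff_null_sets null_sets_completion_iff)
    then have "AE t in lborel. t \<notin> cbox a b - box a b" by (rule AE_not_in)
    then show "AE t in lborel. (\<lambda>n. h t * of_real (LINT y|lborel. gauss y * indicat_real Q (t + (1 / real (Suc n)) *\<^sub>R y)))
        \<longlonglongrightarrow> h t * of_real (indicat_real Q t)"
      by (auto elim!: eventually_mono intro!: tendsto_mult tendsto_of_real gauss_mollifier_tendsto_box simp: Q_def simp del: of_nat_Suc)
    have "(LINT y|lborel. gauss y * indicat_real Q (t + c *\<^sub>R y)) \<le> 1" for t c
    proof -
      have "(LINT y|lborel. gauss y * indicat_real Q (t + c *\<^sub>R y)) \<le> (LINT y|lborel. gauss (y::'a))"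
        by (rule integral_mono) (auto simp: indicator_def intro!: Bochner_Integration.integrable_bound[OF integrable_gauss])
      then show ?thesis by (simp add: integral_gauss)
    qed
    then show "AE t in lborel. cmod (h t * of_real (LINT y|lborel. gauss y * indicat_real Q (t + (1 / real (Suc n)) *\<^sub>R y))) \<le> cmod (h t)" for n
      by (auto simp: norm_mult simp del: of_nat_Suc intro!: mult_left_le)
  qed (use h in auto)
  then have "(LINT t|lborel. h t * of_real (indicat_real Q t)) = 0"
    by (subst (asm) 1) (auto simp: LIMSEQ_const_iff)
  then show "(LINT t:box a b|lborel. h t) = 0"
    by (simp add: Q_def set_lebesgue_integral_def scaleR_conv_of_real mult.commute)
qed


lemma norm_integral_le_nn_integral:
  fixes f :: "'a \<Rightarrow> 'b::{banach, second_countable_topology}"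
  shows "ennreal (norm (LINT x|M. f x)) \<le> (\<integral>\<^sup>+x. norm (f x) \<partial>M)"
  by (cases "integrable M f") (auto intro: integral_norm_bound_ennreal simp: not_integrable_integral_eq)

lemma nn_integral_scaled_gauss:
  fixes s :: "'a::euclidean_space"
  assumes "r > 0"
  shows "(\<integral>\<^sup>+t. gauss ((t - s) /\<^sub>R r) / r ^ DIM('a) \<partial>lborel) = 1"
proof -
  have "(\<integral>\<^sup>+t. gauss ((t - s) /\<^sub>R r) / r ^ DIM('a) \<partial>lborel)
      = r ^ DIM('a) * (\<integral>\<^sup>+t. gauss (t::'a) / r ^ DIM('a) \<partial>lborel)"
    using assms by (subst lborel_nn_integral_affine[of r _ s]) (simp_all add: ennreal_power)
  also have "\<dots> = (\<integral>\<^sup>+t. gauss (t::'a) \<partial>lborel)"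
    using assms by (subst nn_integral_cmult[symmetric]) (simp_all add: ennreal_mult[symmetric])
  also have "\<dots> = 1"
    by (subst nn_integral_eq_integral) (simp_all add: integral_gauss)
  finally show ?thesis .
qed

text \<open>The damped energy of \<open>ft h\<close> is a double integral of \<open>h\<close>
  against a positive kernel of unit mass in either variable, and such a kernel does not increase the
  square norm. Fatou's lemma removes the damping. Equality has to wait for a dense class on which it
  can be computed.\<close>

theorem ft_contraction:
  fixes h :: "'a::euclidean_space \<Rightarrow> complex"
  assumes h: "integrable lborel h"
  shows "(\<integral>\<^sup>+u. (cmod (ft h u))\<^sup>2 \<partial>lborel) \<le> (\<integral>\<^sup>+t. (cmod (h t))\<^sup>2 \<partial>lborel)"
proof -
  let ?hh = "\<lambda>t. ennreal ((cmod (h t))\<^sup>2 / 2)"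
  have [measurable]: "h \<in> borel_measurable borel" using h by auto
  have hc: "integrable lborel (\<lambda>t. cnj (h t))" using h by simp
  let ?d = "DIM('a)"
  have regular: "(\<integral>\<^sup>+u. (cmod (ft h u))\<^sup>2 * gauss (r *\<^sub>R u) \<partial>lborel) \<le> (\<integral>\<^sup>+t. (cmod (h t))\<^sup>2 \<partial>lborel)"
    if r: "r > 0" for r
  proof -
    define K where "K x = gauss (x /\<^sub>R r) / r ^ ?d" for x :: 'a
    have [measurable]: "K \<in> borel_measurable borel" unfolding K_def by measurable
    have K0: "0 \<le> K x" for x using r by (simp add: K_def)
    have K1: "(\<integral>\<^sup>+t. K (t - s) \<partial>lborel) = 1" for s
      unfolding K_def by (rule nn_integral_scaled_gauss[OF r])
    have K1': "(\<integral>\<^sup>+s. K (t - s) \<partial>lborel) = 1" for t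
    proof -
      have "K (t - s) = K (s - t)" for s
        using gauss_minus[of "(t - s) /\<^sub>R r"] by (simp add: K_def flip: scaleR_minus_right)
      then show ?thesis using K1[of t] by simp
    qed
    \<comment> \<open>Chosen so that \<open>ft h u * m u\<close> is the damped energy density, while
      \<open>ft m\<close> is the conjugate of \<open>h\<close> averaged with the kernel
      \<open>K\<close>.\<close>
    define m where "m u = cnj (ft h u) * of_real (gauss (r *\<^sub>R u))" for u
    have gi: "integrable lborel (\<lambda>u. gauss (r *\<^sub>R (u::'a)))"
      using integrable_scaled_gauss[of r "0::'a"] r by simp
    have m: "integrable lborel m"
    proof (rule Bochner_Integration.integrable_bound)
      show "integrable lborel (\<lambda>u::'a. (LINT t|lborel. cmod (h t)) * gauss (r *\<^sub>R u))"
        using gi by simp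
      show "m \<in> borel_measurable lborel" unfolding m_def by measurable
      show "AE u in lborel. norm (m u) \<le> norm ((LINT t|lborel. cmod (h t)) * gauss (r *\<^sub>R u))"
        by (auto simp: m_def norm_mult intro!: mult_right_mono norm_ft_le order_trans[OF norm_ft_le abs_ge_self])
    qed
    have ftm: "ft m t = (LINT s|lborel. cnj (h s) * of_real (K (s - t)))" for t
    proof -
      have "cnj (ft h u) = ft (\<lambda>s. cnj (h s)) (- u)" for u
        by (simp add: ft_def flip: Bochner_Integration.integral_cnj)
      then have "ft m t = (LINT u|lborel. ft (\<lambda>s. cnj (h s)) (- u) * (of_real (gauss (r *\<^sub>R u)) * echar t u))"
        by (simp add: ft_def[of m] m_def mult_ac echar_commute)
      also have "\<dots> = (LINT u|lborel. ft (\<lambda>s. cnj (h s)) u * (of_real (gauss (r *\<^sub>R u)) * echar (- t) u))"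
        by (subst lborel_integral_affine[of "- 1" _ 0]) (simp_all add: echar_minus_right)
      also have "\<dots> = (LINT s|lborel. cnj (h s) * of_real (K (s - t)))"
        unfolding K_def by (rule ft_scaled_gauss[OF hc r])
      finally show ?thesis .
    qed
    have i: "integrable lborel (\<lambda>u. (cmod (ft h u))\<^sup>2 * gauss (r *\<^sub>R u))"
    proof (rule Bochner_Integration.integrable_bound)
      show "integrable lborel (\<lambda>u::'a. (LINT t|lborel. cmod (h t))\<^sup>2 * gauss (r *\<^sub>R u))"
        using gi by simp
      show "AE u in lborel. norm ((cmod (ft h u))\<^sup>2 * gauss (r *\<^sub>R u)) \<le> norm ((LINT t|lborel. cmod (h t))\<^sup>2 * gauss (r *\<^sub>R u))"
        by (auto simp: abs_mult intro!: mult_right_mono power_mono norm_ft_le)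
    qed measurable
    have "(\<integral>\<^sup>+u. (cmod (ft h u))\<^sup>2 * gauss (r *\<^sub>R u) \<partial>lborel) = ennreal (LINT u|lborel. (cmod (ft h u))\<^sup>2 * gauss (r *\<^sub>R u))"
      using i by (intro nn_integral_eq_integral) auto
    also have "\<dots> = ennreal (cmod (LINT u|lborel. ft h u * m u))"
    proof -
      have "(LINT u|lborel. ft h u * m u) = of_real (LINT u|lborel. (cmod (ft h u))\<^sup>2 * gauss (r *\<^sub>R u))"
        unfolding integral_complex_of_real[symmetric]
        by (intro Bochner_Integration.integral_cong) (auto simp: m_def complex_norm_square simp flip: of_real_power mult.assoc)
      then show ?thesis by (simp add: norm_of_real abs_of_nonneg)
    qed
    also have "\<dots> = ennreal (cmod (LINT t|lborel. h t * ft m t))"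
      by (simp add: ft_multiplication_formula[OF h m])
    also have "\<dots> \<le> (\<integral>\<^sup>+t. cmod (h t * ft m t) \<partial>lborel)"
      by (rule norm_integral_le_nn_integral)
    also have "\<dots> \<le> (\<integral>\<^sup>+t. (\<integral>\<^sup>+s. cmod (h t) * (cmod (h s) * K (s - t)) \<partial>lborel) \<partial>lborel)"
    proof (rule nn_integral_mono)
      fix t
      have "ennreal (cmod (ft m t)) \<le> (\<integral>\<^sup>+s. cmod (h s) * K (s - t) \<partial>lborel)"
        unfolding ftm by (rule order_trans[OF norm_integral_le_nn_integral]) (simp add: norm_mult K0)
      then have "ennreal (cmod (h t)) * ennreal (cmod (ft m t)) \<le> ennreal (cmod (h t)) * (\<integral>\<^sup>+s. cmod (h s) * K (s - t) \<partial>lborel)"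
        by (intro mult_left_mono) auto
      also have "\<dots> = (\<integral>\<^sup>+s. cmod (h t) * (cmod (h s) * K (s - t)) \<partial>lborel)"
        by (subst nn_integral_cmult[symmetric]) (auto simp: K0 ennreal_mult)
      finally show "ennreal (cmod (h t * ft m t)) \<le> (\<integral>\<^sup>+s. cmod (h t) * (cmod (h s) * K (s - t)) \<partial>lborel)"
        by (simp add: norm_mult ennreal_mult)
    qed
    \<comment> \<open>The arithmetic-geometric mean inequality separates the two values of
      \<open>h\<close>; in each summand the kernel then integrates to 1 in the free
      variable.\<close>
    also have "\<dots> \<le> (\<integral>\<^sup>+t. (\<integral>\<^sup>+s. ?hh t * K (s - t) + ?hh s * K (s - t) \<partial>lborel) \<partial>lborel)"
    proof (intro nn_integral_mono)
      fix t s
      have "cmod (h t) * cmod (h s) \<le> (cmod (h t))\<^sup>2 / 2 + (cmod (h s))\<^sup>2 / 2"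
        using sum_squares_bound[of "cmod (h t)" "cmod (h s)"] by simp
      then have "cmod (h t) * cmod (h s) * K (s - t) \<le> ((cmod (h t))\<^sup>2 / 2 + (cmod (h s))\<^sup>2 / 2) * K (s - t)"
        by (intro mult_right_mono K0)
      then show "ennreal (cmod (h t) * (cmod (h s) * K (s - t))) \<le> ?hh t * K (s - t) + ?hh s * K (s - t)"
        by (simp add: K0 ring_distribs mult.assoc flip: ennreal_mult ennreal_plus)
    qed
    also have "\<dots> = (\<integral>\<^sup>+t. (\<integral>\<^sup>+s. ?hh t * K (s - t) \<partial>lborel) \<partial>lborel)
        + (\<integral>\<^sup>+t. (\<integral>\<^sup>+s. ?hh s * K (s - t) \<partial>lborel) \<partial>lborel)"
      by (simp add: nn_integral_add)
    also have "(\<integral>\<^sup>+t. (\<integral>\<^sup>+s. ?hh t * K (s - t) \<partial>lborel) \<partial>lborel)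
       = (\<integral>\<^sup>+t. ?hh t \<partial>lborel)"
      by (simp add: nn_integral_cmult K1)
    also have "(\<integral>\<^sup>+t. (\<integral>\<^sup>+s. ?hh s * K (s - t) \<partial>lborel) \<partial>lborel)
       = (\<integral>\<^sup>+s. (\<integral>\<^sup>+t. ?hh s * K (s - t) \<partial>lborel) \<partial>lborel)"
      by (rule lborel_pair.Fubini') measurable
    also have "\<dots> = (\<integral>\<^sup>+t. ?hh t \<partial>lborel)"
      by (simp add: nn_integral_cmult K1')
    also have "(\<integral>\<^sup>+t. ?hh t \<partial>lborel) + (\<integral>\<^sup>+t. ?hh t \<partial>lborel)
       = (\<integral>\<^sup>+t. (cmod (h t))\<^sup>2 \<partial>lborel)"
      by (simp add: nn_integral_add[symmetric] flip: ennreal_plus)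
    finally show ?thesis .
  qed
  have "(\<integral>\<^sup>+u. (cmod (ft h u))\<^sup>2 \<partial>lborel)
      = (\<integral>\<^sup>+u. liminf (\<lambda>n. ennreal ((cmod (ft h u))\<^sup>2 * gauss ((1 / real (Suc n)) *\<^sub>R u))) \<partial>lborel)"
  proof (intro nn_integral_cong)
    fix u
    have "(\<lambda>n. (cmod (ft h u))\<^sup>2 * gauss (inverse (real (Suc n)) *\<^sub>R u)) \<longlonglongrightarrow> (cmod (ft h u))\<^sup>2 * gauss (0 *\<^sub>R u)"
      unfolding gauss_def by (intro tendsto_intros LIMSEQ_inverse_real_of_nat)
    then have "(\<lambda>n. ennreal ((cmod (ft h u))\<^sup>2 * gauss ((1 / real (Suc n)) *\<^sub>R u))) \<longlonglongrightarrow> ennreal ((cmod (ft h u))\<^sup>2)"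
      by (intro tendsto_ennrealI) (simp add: inverse_eq_divide gauss_def)
    from lim_imp_Liminf[OF sequentially_bot this]
    show "ennreal ((cmod (ft h u))\<^sup>2) = liminf (\<lambda>n. ennreal ((cmod (ft h u))\<^sup>2 * gauss ((1 / real (Suc n)) *\<^sub>R u)))"
      by simp
  qed
  also have "\<dots> \<le> liminf (\<lambda>n. \<integral>\<^sup>+u. ennreal ((cmod (ft h u))\<^sup>2 * gauss ((1 / real (Suc n)) *\<^sub>R u)) \<partial>lborel)"
    by (rule nn_integral_liminf) measurable
  also have "\<dots> \<le> (\<integral>\<^sup>+t. (cmod (h t))\<^sup>2 \<partial>lborel)"
    by (rule order_trans[OF Liminf_mono[where g="\<lambda>_. (\<integral>\<^sup>+t. (cmod (h t))\<^sup>2 \<partial>lborel)"]])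
      (auto simp: Liminf_const regular simp del: of_nat_Suc)
  finally show ?thesis .
qed

section \<open>The complex Hilbert space of square-integrable functions\<close>

lemma l2_rel_rep: "l2_rel (rep_l2 f) (rep_l2 f)"
  using Quotient_rep_reflp[OF Quotient_l2] .

lemma abs_rep_l2 [simp]: "abs_l2 (rep_l2 f) = f"
  using Quotient_abs_rep[OF Quotient_l2] .

lemma rep_l2_Lp [simp]: "rep_l2 f \<in> Lp 2"
  using l2_rel_rep[of f] by (simp add: l2_rel_def)

lemma borel_measurable_rep_l2 [measurable]: "rep_l2 f \<in> borel_measurable borel"
  using rep_l2_Lp[of f] by (simp add: Lp_2_iff)

lemma rep_abs_l2: "f \<in> Lp 2 \<Longrightarrow> AE x in lborel. rep_l2 (abs_l2 f) x = f x"
  using Quotient_rep_abs[OF Quotient_l2, of f] by (auto simp: l2_rel_def)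

lemma abs_l2_eqI: "f \<in> Lp 2 \<Longrightarrow> g \<in> Lp 2 \<Longrightarrow> AE x in lborel. f x = g x \<Longrightarrow> abs_l2 f = abs_l2 g"
  by (rule Quotient_rel_abs[OF Quotient_l2]) (simp add: l2_rel_def)

lemma l2_eqI: "AE x in lborel. rep_l2 f x = rep_l2 g x \<Longrightarrow> f = g"
  using abs_l2_eqI[of "rep_l2 f" "rep_l2 g"] by simp

lemma cinner_abs: "f \<in> Lp 2 \<Longrightarrow> g \<in> Lp 2 \<Longrightarrow> cinner (abs_l2 f) (abs_l2 g) = (LINT x|lborel. f x * cnj (g x))"
  by (simp add: cinner.abs_eq l2_rel_def)

lemma cinner_rep: "cinner f g = (LINT x|lborel. rep_l2 f x * cnj (rep_l2 g x))"
  using cinner_abs[of "rep_l2 f" "rep_l2 g"] by simp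

lemma integrable_rep_mult: "integrable lborel (\<lambda>x. rep_l2 f x * cnj (rep_l2 g x))"
  by (simp add: Lp_2_integrable_mult)

lemma abs_l2_add: "f \<in> Lp 2 \<Longrightarrow> g \<in> Lp 2 \<Longrightarrow> abs_l2 f + abs_l2 g = abs_l2 (\<lambda>x. f x + g x)"
  by (simp add: plus_l2.abs_eq l2_rel_def)

lemma abs_l2_scale: "f \<in> Lp 2 \<Longrightarrow> c *\<^sub>C abs_l2 f = abs_l2 (\<lambda>x. c * f x)"
  by (simp add: scaleC_l2.abs_eq l2_rel_def)

lemma rep_l2_add: "AE x in lborel. rep_l2 (f + g) x = rep_l2 f x + rep_l2 g x"
  using rep_abs_l2[OF Lp_2_add[OF rep_l2_Lp[of f] rep_l2_Lp[of g]]] abs_l2_add[of "rep_l2 f" "rep_l2 g"] by simp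

lemma rep_l2_scale: "AE x in lborel. rep_l2 (c *\<^sub>C f) x = c * rep_l2 f x"
  using rep_abs_l2[OF Lp_2_scale[OF rep_l2_Lp[of f]], of c] abs_l2_scale[of "rep_l2 f"] by simp

lemma rep_l2_diff: "AE x in lborel. rep_l2 (f - g) x = rep_l2 f x - rep_l2 g x"
proof -
  have "f - g = f + (- 1) *\<^sub>C g" by (simp only: minus_l2_def uminus_l2_def)
  show ?thesis
    unfolding \<open>f - g = _\<close> using rep_l2_add[of f "(- 1) *\<^sub>C g"] rep_l2_scale[of "- 1" g]
    by eventually_elim simp
qed

lemma cinner_commute: "cinner f g = cnj (cinner g f)"
proof -
  have "cnj (cinner g f) = (LINT x|lborel. cnj (rep_l2 g x * cnj (rep_l2 f x)))"
    unfolding cinner_rep by (rule Bochner_Integration.integral_cnj[symmetric])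
  then show ?thesis by (simp add: cinner_rep mult.commute)
qed

lemma cinner_add_left: "cinner (f + g) h = cinner f h + cinner g h"
proof -
  have "cinner (f + g) h = (LINT x|lborel. rep_l2 f x * cnj (rep_l2 h x) + rep_l2 g x * cnj (rep_l2 h x))"
    unfolding cinner_rep
    by (rule integral_cong_AE) (use rep_l2_add[of f g] in \<open>auto elim!: eventually_mono simp: distrib_right\<close>)
  then show ?thesis by (simp add: cinner_rep integrable_rep_mult)
qed

lemma cinner_scaleC_left [simp]: "cinner (c *\<^sub>C f) h = c * cinner f h"
proof -
  have "cinner (c *\<^sub>C f) h = (LINT x|lborel. c * (rep_l2 f x * cnj (rep_l2 h x)))"
    unfolding cinner_rep
    by (rule integral_cong_AE) (use rep_l2_scale[of c f] in \<open>auto elim!: eventually_mono\<close>)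
  then show ?thesis by (simp add: cinner_rep)
qed

lemma cinner_add_right: "cinner h (f + g) = cinner h f + cinner h g"
  by (subst (1 2 3) cinner_commute) (simp add: cinner_add_left)

lemma cinner_scaleC_right [simp]: "cinner h (c *\<^sub>C f) = cnj c * cinner h f"
  by (subst (1 2) cinner_commute) simp

lemma cinner_zero [simp]: "cinner 0 f = 0" "cinner f 0 = 0"
  using cinner_add_left[of 0 0 f] cinner_add_right[of f 0 0] by simp_all

lemma cinner_minus_left [simp]: "cinner (- f) g = - cinner f g"
  and cinner_minus_right [simp]: "cinner g (- f) = - cinner g f"
  by (simp_all add: uminus_l2_def)

lemma cinner_diff_left: "cinner (f - g) h = cinner f h - cinner g h"
  using cinner_add_left[of f "- g" h] by simp

lemma cinner_sum_left: "cinner (\<Sum>i\<in>I. f i) h = (\<Sum>i\<in>I. cinner (f i) h)"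
  and cinner_sum_right: "cinner h (\<Sum>i\<in>I. f i) = (\<Sum>i\<in>I. cinner h (f i))"
  by (induction I rule: infinite_finite_induct) (simp_all add: cinner_add_left cinner_add_right)

lemma inner_eq_Re_cinner: "f \<bullet> g = Re (cinner f g)" for f :: "'a::euclidean_space l2"
  by (rule inner_l2_def)

lemma scaleR_eq_scaleC: "r *\<^sub>R f = of_real r *\<^sub>C f" for f :: "'a::euclidean_space l2"
  by (rule scaleR_l2_def)

lemma cinner_self: "cinner f f = of_real ((norm f)\<^sup>2)"
proof -
  have "Im (cinner f f) = 0" using cinner_commute[of f f] by (simp add: complex_eq_iff)
  then show ?thesis by (simp add: complex_eq_iff power2_norm_eq_inner inner_eq_Re_cinner)
qed

lemma norm_l2_nn_integral: "ennreal ((norm f)\<^sup>2) = (\<integral>\<^sup>+x. (cmod (rep_l2 f x))\<^sup>2 \<partial>lborel)"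
proof -
  have "of_real ((norm f)\<^sup>2) = (LINT x|lborel. complex_of_real ((cmod (rep_l2 f x))\<^sup>2))"
    unfolding cinner_self[symmetric] cinner_rep by (simp only: complex_norm_square)
  then have "(norm f)\<^sup>2 = (LINT x|lborel. (cmod (rep_l2 f x))\<^sup>2)"
    unfolding integral_complex_of_real by (simp only: of_real_eq_iff)
  then show ?thesis
    using rep_l2_Lp[of f] unfolding Lp_2_iff by (subst nn_integral_eq_integral) auto
qed

lemma Lp_2_iff_nn: "f \<in> Lp 2 \<longleftrightarrow> f \<in> borel_measurable borel \<and> (\<integral>\<^sup>+x. (cmod (f x))\<^sup>2 \<partial>lborel) < \<infinity>"
  by (auto simp: Lp_2_iff integrable_iff_bounded)

lemma norm_abs_l2: "f \<in> Lp 2 \<Longrightarrow> ennreal ((norm (abs_l2 f))\<^sup>2) = (\<integral>\<^sup>+x. (cmod (f x))\<^sup>2 \<partial>lborel)"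
  unfolding norm_l2_nn_integral
  by (rule nn_integral_cong_AE) (use rep_abs_l2[of f] in \<open>auto elim!: eventually_mono\<close>)

lemma scaleC_add_right: "c *\<^sub>C (f + g) = c *\<^sub>C f + c *\<^sub>C g"
  by (rule l2_eqI)
    (use rep_l2_add[of f g] rep_l2_scale[of c "f + g"] rep_l2_add[of "c *\<^sub>C f" "c *\<^sub>C g"] rep_l2_scale[of c f] rep_l2_scale[of c g]
      in \<open>auto simp: ring_distribs\<close>)

lemma scaleC_add_left: "(c + d) *\<^sub>C f = c *\<^sub>C f + d *\<^sub>C f"
  by (rule l2_eqI)
    (use rep_l2_scale[of "c + d" f] rep_l2_add[of "c *\<^sub>C f" "d *\<^sub>C f"] rep_l2_scale[of c f] rep_l2_scale[of d f]
      in \<open>auto simp: ring_distribs\<close>)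

lemma scaleC_scaleC [simp]: "c *\<^sub>C d *\<^sub>C f = (c * d) *\<^sub>C f"
  by (rule l2_eqI)
    (use rep_l2_scale[of "c * d" f] rep_l2_scale[of c "d *\<^sub>C f"] rep_l2_scale[of d f] in auto)

lemma scaleC_one [simp]: "1 *\<^sub>C f = f"
  by (rule l2_eqI) (use rep_l2_scale[of 1 f] in auto)

lemma norm_scaleC [simp]: "norm (c *\<^sub>C f) = cmod c * norm f"
proof -
  have "complex_of_real ((norm (c *\<^sub>C f))\<^sup>2) = c * cnj c * of_real ((norm f)\<^sup>2)"
    by (simp only: cinner_self[symmetric] cinner_scaleC_left cinner_scaleC_right mult_ac)
  also have "\<dots> = of_real ((cmod c * norm f)\<^sup>2)"
    by (simp only: complex_norm_square[symmetric] of_real_mult[symmetric] power_mult_distrib)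
  finally have "complex_of_real ((norm (c *\<^sub>C f))\<^sup>2) = of_real ((cmod c * norm f)\<^sup>2)" .
  then show ?thesis
    unfolding of_real_eq_iff by (simp add: power2_eq_iff_nonneg)
qed

lemma scaleC_zero [simp]: "c *\<^sub>C 0 = 0" "0 *\<^sub>C f = 0"
  using norm_scaleC[of c 0] norm_scaleC[of 0 f] by (auto simp del: norm_scaleC)

lemma scaleC_minus [simp]: "(- c) *\<^sub>C f = - (c *\<^sub>C f)" "c *\<^sub>C (- f) = - (c *\<^sub>C f)"
  by (simp_all add: uminus_l2_def)

lemma scaleC_diff_right: "c *\<^sub>C (f - g) = c *\<^sub>C f - c *\<^sub>C g"
  using scaleC_add_right[of c f "- g"] by simp

text \<open>A unimodular factor \<open>c\<close> makes the inner product real and non-negative,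
  which reduces the claim to the real Cauchy--Schwarz inequality.\<close>

lemma l2_Cauchy_Schwarz: "cmod (cinner f g) \<le> norm f * norm g"
proof (cases "cinner f g = 0")
  case False
  define c where "c = cnj (sgn (cinner f g))"
  have c: "cmod c = 1" using False by (simp add: c_def norm_sgn)
  have "c * cinner f g = of_real (cmod (cinner f g))"
    using False by (simp add: c_def sgn_eq complex_norm_square[symmetric] field_simps power2_eq_square)
  then have "cmod (cinner f g) = (c *\<^sub>C f) \<bullet> g"
    by (simp add: inner_eq_Re_cinner)
  also have "\<dots> \<le> norm (c *\<^sub>C f) * norm g" by (rule norm_cauchy_schwarz)
  finally show ?thesis by (simp add: c)
qed simp

lemma bounded_linear_cinner_left: "bounded_linear (\<lambda>f. cinner f g)"
  by (rule bounded_linear_intro[where K="norm g"])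
    (simp_all add: cinner_add_left scaleR_eq_scaleC scaleR_conv_of_real l2_Cauchy_Schwarz)

lemma bounded_linear_cinner_right: "bounded_linear (\<lambda>g. cinner f g)"
  by (rule bounded_linear_intro[where K="norm f"])
    (simp_all add: cinner_add_right scaleR_eq_scaleC scaleR_conv_of_real l2_Cauchy_Schwarz mult.commute[of "norm _" "norm f"])

lemma tendsto_cinner_left: "(X \<longlongrightarrow> f) F \<Longrightarrow> ((\<lambda>n. cinner (X n) g) \<longlongrightarrow> cinner f g) F"
  by (rule bounded_linear.tendsto[OF bounded_linear_cinner_left])

lemma cinner_eqI: "(\<And>g. cinner f g = cinner f' g) \<Longrightarrow> f = f'"
proof -
  assume "\<And>g. cinner f g = cinner f' g"
  then have "cinner (f - f') (f - f') = 0" by (simp add: cinner_diff_left)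
  then show "f = f'" by (simp add: cinner_self)
qed

text \<open>Evaluation at \<open>x + y\<close> kills the sum of \<open>S x y\<close> and
  \<open>S y x\<close>, evaluation at \<open>x + \<i> *\<^sub>C y\<close> kills their difference.
  This is how norm identities become Moyal's identity.\<close>

lemma cinner_polarization:
  fixes S :: "'a::euclidean_space l2 \<Rightarrow> 'a l2 \<Rightarrow> complex"
  assumes "\<And>x x' y. S (x + x') y = S x y + S x' y" "\<And>x y y'. S x (y + y') = S x y + S x y'"
    and "\<And>c x y. S (c *\<^sub>C x) y = c * S x y" "\<And>c x y. S x (c *\<^sub>C y) = cnj c * S x y"
    and 0: "\<And>x. S x x = 0"
  shows "S x y = 0"
proof -
  have "S x y + S y x = 0"
    using 0[of "x + y"] unfolding assms(1,2) by (simp add: 0 add.commute)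
  moreover have "\<i> * S y x - \<i> * S x y = 0"
    using 0[of "x + \<i> *\<^sub>C y"] unfolding assms(1,2,3,4) by (simp add: 0)
  then have "S y x = S x y" by simp
  ultimately show ?thesis by simp
qed

section \<open>Completeness (Riesz--Fischer)\<close>

lemma l2_subsequence_converges_AE:
  fixes X :: "nat \<Rightarrow> 'a::euclidean_space l2"
  assumes X: "\<And>n. norm (X (Suc n) - X n) \<le> (1 / 2) ^ n"
  shows "AE x in lborel. convergent (\<lambda>n. rep_l2 (X n) x)"
proof -
  define d where "d n x = cmod (rep_l2 (X (Suc n)) x - rep_l2 (X n) x)" for n x
  \<comment> \<open>The squared differences have integrals at most \<open>(1 / 4) ^ n\<close>, so
    the weight \<open>2 ^ n\<close> still leaves a convergent series. Finiteness of the weighted sum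
    at \<open>x\<close> then forces geometric decay of \<open>d n x\<close> with ratio
    \<open>sqrt (1 / 2)\<close>.\<close>
  let ?S = "\<lambda>x. \<Sum>n. ennreal (2 ^ n * (d n x)\<^sup>2)"
  have [measurable]: "d n \<in> borel_measurable borel" for n unfolding d_def by measurable
  have d: "(\<integral>\<^sup>+x. (d n x)\<^sup>2 \<partial>lborel) \<le> ennreal ((1 / 4) ^ n)" for n
  proof -
    have "(\<integral>\<^sup>+x. (d n x)\<^sup>2 \<partial>lborel) = ennreal ((norm (X (Suc n) - X n))\<^sup>2)"
      unfolding norm_l2_nn_integral
      by (rule nn_integral_cong_AE) (use rep_l2_diff[of "X (Suc n)" "X n"] in \<open>auto simp: d_def elim!: eventually_mono\<close>)
    also have "\<dots> \<le> ennreal (((1 / 2) ^ n)\<^sup>2)"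
      by (intro ennreal_leI power_mono X) auto
    finally show ?thesis by (simp add: power2_eq_square power_mult_distrib[symmetric])
  qed
  have "(\<integral>\<^sup>+x. (?S x) \<partial>lborel) = (\<Sum>n. \<integral>\<^sup>+x. ennreal (2 ^ n * (d n x)\<^sup>2) \<partial>lborel)"
    by (rule nn_integral_suminf) measurable
  also have "\<dots> \<le> (\<Sum>n. ennreal ((1 / 2) ^ n))"
  proof (intro suminf_le)
    fix n
    have "(\<integral>\<^sup>+x. ennreal (2 ^ n * (d n x)\<^sup>2) \<partial>lborel) = ennreal (2 ^ n) * (\<integral>\<^sup>+x. (d n x)\<^sup>2 \<partial>lborel)"
      by (subst nn_integral_cmult[symmetric]) (auto simp: ennreal_mult)
    also have "\<dots> \<le> ennreal (2 ^ n) * ennreal ((1 / 4) ^ n)"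
      by (intro mult_left_mono d) auto
    also have "\<dots> = ennreal ((1 / 2) ^ n)"
      by (subst ennreal_mult[symmetric]) (auto simp: power_mult_distrib[symmetric])
    finally show "(\<integral>\<^sup>+x. ennreal (2 ^ n * (d n x)\<^sup>2) \<partial>lborel) \<le> ennreal ((1 / 2) ^ n)" .
  qed auto
  also have "\<dots> < \<infinity>"
    by (subst suminf_ennreal2) (simp_all add: summable_geometric)
  finally have fin: "(\<integral>\<^sup>+x. (?S x) \<partial>lborel) < \<infinity>" .
  have "AE x in lborel. (?S x) \<noteq> \<infinity>"
  proof (rule nn_integral_noteq_infinite)
    show "(\<integral>\<^sup>+x. (?S x) \<partial>lborel) \<noteq> \<infinity>"
      using fin by (rule less_imp_neq)
  qed measurable
  then show ?thesis
  proof eventually_elim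
    case (elim x)
    define C where "C = enn2real (?S x)"
    have C: "2 ^ n * (d n x)\<^sup>2 \<le> C" for n
    proof -
      have "ennreal (2 ^ n * (d n x)\<^sup>2) \<le> (?S x)"
        by (rule order_trans[OF _ sum_le_suminf[of _ "{n}"]]) simp_all
      moreover have "(?S x) < top"
        using elim unfolding infinity_ennreal_def by (rule top.not_eq_extremum[THEN iffD1])
      ultimately have "enn2real (ennreal (2 ^ n * (d n x)\<^sup>2)) \<le> C"
        unfolding C_def by (rule enn2real_mono)
      then show ?thesis by (subst (asm) enn2real_ennreal) auto
    qed
    have C0: "0 \<le> C" by (rule order_trans[OF _ C[of 0]]) simp
    have dC: "d n x \<le> sqrt C * sqrt (1 / 2) ^ n" for n
    proof -
      have "(d n x)\<^sup>2 \<le> C * (1 / 2) ^ n"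
        using C[of n] by (simp add: power_one_over field_simps)
      also have "\<dots> = (sqrt C)\<^sup>2 * (sqrt (1 / 2) ^ 2) ^ n"
        using C0 by simp
      also have "\<dots> = (sqrt C * sqrt (1 / 2) ^ n)\<^sup>2"
        unfolding power_mult_distrib power_mult[symmetric] by (subst mult.commute[of 2 n]) (rule refl)
      finally show ?thesis
        by (rule power2_le_imp_le) (simp add: C0)
    qed
    have "summable (\<lambda>n. sqrt C * sqrt (1 / 2) ^ n)"
      by (intro summable_mult summable_geometric) simp
    then have "summable (\<lambda>n. rep_l2 (X (Suc n)) x - rep_l2 (X n) x)"
      by (rule summable_comparison_test'[where N=0]) (use dC in \<open>simp add: d_def\<close>)
    then have "convergent (\<lambda>N. \<Sum>n<N. rep_l2 (X (Suc n)) x - rep_l2 (X n) x)"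
      by (simp add: summable_iff_convergent)
    then have "convergent (\<lambda>N. rep_l2 (X N) x - rep_l2 (X 0) x)"
      unfolding sum_lessThan_telescope[of "\<lambda>n. rep_l2 (X n) x"] .
    then have "convergent (\<lambda>N. (rep_l2 (X N) x - rep_l2 (X 0) x) + rep_l2 (X 0) x)"
      by (intro convergent_add convergent_const)
    then show ?case by simp
  qed
qed

instance l2 :: (euclidean_space) complete_space
proof
  fix X :: "nat \<Rightarrow> 'a l2" assume X: "Cauchy X"
  have "\<exists>M. \<forall>m\<ge>M. \<forall>n\<ge>M. norm (X m - X n) < (1 / 2) ^ k" for k
    using X by (intro CauchyD) auto
  then obtain M where M: "\<And>k m n. m \<ge> M k \<Longrightarrow> n \<ge> M k \<Longrightarrow> norm (X m - X n) < (1 / 2) ^ k"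
    by metis
  \<comment> \<open>Summing the thresholds makes the indices strictly increasing while keeping
    \<open>r k\<close> beyond \<open>M k\<close>.\<close>
  define r where "r k = (\<Sum>i\<le>k. Suc (M i))" for k
  have rM: "M k \<le> r k" for k by (induction k) (auto simp: r_def)
  have r: "strict_mono r" by (rule strict_monoI_Suc) (simp add: r_def)
  define Y where "Y n = X (r n)" for n
  have "AE x in lborel. convergent (\<lambda>n. rep_l2 (Y n) x)"
  proof (rule l2_subsequence_converges_AE)
    fix n
    have "r (Suc n) \<ge> r n" using r by (simp add: strict_mono_leD)
    then show "norm (Y (Suc n) - Y n) \<le> (1 / 2) ^ n"
      using M[of n "r (Suc n)" "r n"] rM[of n] by (simp add: Y_def)
  qed
  define y where "y x = lim (\<lambda>n. rep_l2 (Y n) x)" for x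
  have [measurable]: "y \<in> borel_measurable borel"
    unfolding y_def by measurable
  have lim: "AE x in lborel. (\<lambda>n. rep_l2 (Y n) x) \<longlonglongrightarrow> y x"
    using \<open>AE x in lborel. convergent _\<close> by eventually_elim (simp add: y_def convergent_LIMSEQ_iff)
  \<comment> \<open>Fatou's lemma carries a bound on the distances from \<open>g\<close> to
    \<open>Y n\<close> over to the pointwise limit. It yields both that \<open>y\<close> is
    square-integrable and that the whole sequence converges to it.\<close>
  have fatou: "(\<integral>\<^sup>+x. (cmod (rep_l2 g x - y x))\<^sup>2 \<partial>lborel) \<le> e\<^sup>2"
    if e: "\<forall>\<^sub>F n in sequentially. norm (g - Y n) \<le> e" for e g
  proof -
    have e0: "e \<ge> 0" using eventually_happens[OF e] by (auto intro: order_trans[OF norm_ge_zero])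
    have "(\<integral>\<^sup>+x. (cmod (rep_l2 g x - y x))\<^sup>2 \<partial>lborel)
        = (\<integral>\<^sup>+x. liminf (\<lambda>n. ennreal ((cmod (rep_l2 g x - rep_l2 (Y n) x))\<^sup>2)) \<partial>lborel)"
    proof (rule nn_integral_cong_AE)
      show "AE x in lborel. ennreal ((cmod (rep_l2 g x - y x))\<^sup>2) = liminf (\<lambda>n. ennreal ((cmod (rep_l2 g x - rep_l2 (Y n) x))\<^sup>2))"
        using lim
      proof eventually_elim
        case (elim x)
        then have "(\<lambda>n. ennreal ((cmod (rep_l2 g x - rep_l2 (Y n) x))\<^sup>2)) \<longlonglongrightarrow> ennreal ((cmod (rep_l2 g x - y x))\<^sup>2)"
          by (intro tendsto_ennrealI tendsto_intros)
        from lim_imp_Liminf[OF sequentially_bot this] show ?case by simp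
      qed
    qed
    also have "\<dots> \<le> liminf (\<lambda>n. \<integral>\<^sup>+x. ennreal ((cmod (rep_l2 g x - rep_l2 (Y n) x))\<^sup>2) \<partial>lborel)"
      by (rule nn_integral_liminf) measurable
    also have "\<dots> \<le> liminf (\<lambda>n. ennreal (e\<^sup>2))"
    proof (rule Liminf_mono)
      show "\<forall>\<^sub>F n in sequentially. (\<integral>\<^sup>+x. ennreal ((cmod (rep_l2 g x - rep_l2 (Y n) x))\<^sup>2) \<partial>lborel) \<le> ennreal (e\<^sup>2)"
        using e
      proof eventually_elim
        case (elim n)
        have "(\<integral>\<^sup>+x. ennreal ((cmod (rep_l2 g x - rep_l2 (Y n) x))\<^sup>2) \<partial>lborel) = ennreal ((norm (g - Y n))\<^sup>2)"
          unfolding norm_l2_nn_integral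
          by (rule nn_integral_cong_AE) (use rep_l2_diff[of g "Y n"] in \<open>auto elim!: eventually_mono\<close>)
        also have "\<dots> \<le> ennreal (e\<^sup>2)" by (intro ennreal_leI power_mono elim) auto
        finally show ?case .
      qed
    qed
    also have "\<dots> = ennreal (e\<^sup>2)" by (simp add: Liminf_const)
    finally show ?thesis .
  qed
  have ev: "\<forall>\<^sub>F n in sequentially. norm (X m - Y n) \<le> (1 / 2) ^ k" if "m \<ge> M k" for k m
    using eventually_ge_at_top[of "M k"]
  proof eventually_elim
    case (elim n)
    then have "r n \<ge> M k" using strict_mono_imp_increasing[OF r, of n] by simp
    then show ?case using M[OF that] by (simp add: Y_def less_imp_le)
  qed
  have z: "(\<lambda>x. rep_l2 (X (M 0)) x - y x) \<in> Lp 2"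
    using fatou[OF ev[of 0 "M 0"]] by (auto simp: Lp_2_iff_nn intro: le_less_trans)
  from Lp_2_add[OF rep_l2_Lp[of "X (M 0)"] Lp_2_scale[OF this, of "- 1"]]
  have y: "y \<in> Lp 2" by simp
  have "X \<longlonglongrightarrow> abs_l2 y"
  proof (rule LIMSEQ_I)
    fix e :: real assume "e > 0"
    then obtain k where k: "(1 / 2) ^ k < e" using real_arch_pow_inv[of e "1 / 2"] by auto
    have "norm (X m - abs_l2 y) < e" if "m \<ge> M k" for m
    proof -
      have "ennreal ((norm (X m - abs_l2 y))\<^sup>2) = (\<integral>\<^sup>+x. (cmod (rep_l2 (X m) x - y x))\<^sup>2 \<partial>lborel)"
        unfolding norm_l2_nn_integral
        by (rule nn_integral_cong_AE) (use rep_l2_diff[of "X m" "abs_l2 y"] rep_abs_l2[OF y] in auto)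
      also have "\<dots> \<le> ennreal (((1 / 2) ^ k)\<^sup>2)" by (rule fatou[OF ev[OF that]])
      finally have "(norm (X m - abs_l2 y))\<^sup>2 \<le> ((1 / 2) ^ k)\<^sup>2" by (simp add: ennreal_le_iff)
      then have "norm (X m - abs_l2 y) \<le> (1 / 2) ^ k" by (rule power2_le_imp_le) simp
      with k show ?thesis by simp
    qed
    then show "\<exists>n0. \<forall>n\<ge>n0. norm (X n - abs_l2 y) < e" by blast
  qed
  then show "convergent X" by (auto simp: convergent_def)
qed


instance l2 :: (euclidean_space) banach ..

section \<open>Riesz representation, dense subspaces and bounded operators\<close>

lemma riesz_closed_subspace:
  fixes S :: "'h::{real_inner, complete_space} set"
  assumes S: "subspace S" "closed S" and l: "bounded_linear l"
  shows "\<exists>h\<in>S. \<forall>x\<in>S. l x = h \<bullet> x"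
proof -
  interpret l: bounded_linear l by (rule l)
  \<comment> \<open>The minimiser of \<open>J\<close> over \<open>S\<close> represents
    \<open>l\<close> on \<open>S\<close>. Over the whole space this is the Riesz theorem; for
    \<open>l\<close> the inner product with a vector it is the orthogonal projection of that
    vector.\<close>
  define J where "J x = (norm x)\<^sup>2 - 2 * l x" for x
  define m where "m = (INF x\<in>S. J x)"
  obtain K where K: "\<And>x. \<bar>l x\<bar> \<le> norm x * K" using l.bounded by auto
  have "- K\<^sup>2 \<le> J x" for x
  proof -
    have "0 \<le> (norm x - K)\<^sup>2" by simp
    moreover have "l x \<le> norm x * K" using K[of x] by simp
    ultimately show ?thesis by (simp add: J_def power2_diff)
  qed
  then have bdd: "bdd_below (J ` S)" by (auto intro!: bdd_belowI)
  have m_le: "m \<le> J x" if "x \<in> S" for x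
    unfolding m_def by (rule cINF_lower[OF bdd that])
  have "\<exists>x\<in>S. J x < m + 1 / real (Suc n)" for n
    using cINF_less_iff[OF _ bdd, of "m + 1 / real (Suc n)"] subspace_0[OF S(1)]
    by (force simp: m_def)
  then obtain x where x: "\<And>n. x n \<in> S" "\<And>n. J (x n) < m + 1 / real (Suc n)" by metis
  have par: "(norm (u - v))\<^sup>2 \<le> 2 * (J u - m) + 2 * (J v - m)" if "u \<in> S" "v \<in> S" for u v
  proof -
    have "(1 / 2) *\<^sub>R (u + v) \<in> S"
      using S(1) that by (intro subspace_scale subspace_add)
    from m_le[OF this] have "m \<le> (norm (u + v))\<^sup>2 / 4 - (l u + l v)"
      unfolding J_def l.scaleR l.add by (simp add: power_divide add_divide_distrib del: scaleR_add_right)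
    then have "4 * m \<le> (norm (u + v))\<^sup>2 - 4 * (l u + l v)" by simp
    moreover have "(norm (u - v))\<^sup>2 = 2 * (norm u)\<^sup>2 + 2 * (norm v)\<^sup>2 - (norm (u + v))\<^sup>2"
      by (simp add: power2_norm_eq_inner inner_simps inner_commute)
    ultimately show ?thesis by (simp add: J_def)
  qed
  have "Cauchy x"
  proof (rule metric_CauchyI)
    fix e :: real assume e: "e > 0"
    obtain N where N: "inverse (real (Suc N)) < e\<^sup>2 / 4"
      using reals_Archimedean[of "e\<^sup>2 / 4"] e by auto
    have "dist (x i) (x j) < e" if "i \<ge> N" "j \<ge> N" for i j
    proof -
      have *: "J (x k) - m < e\<^sup>2 / 4" if "k \<ge> N" for k
      proof -
        have "1 / real (Suc k) \<le> inverse (real (Suc N))"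
          using that by (simp add: divide_simps)
        then show ?thesis using x(2)[of k] N by linarith
      qed
      have "(dist (x i) (x j))\<^sup>2 < e\<^sup>2"
        using par[OF x(1) x(1), of i j] *[OF that(1)] *[OF that(2)] by (simp add: dist_norm)
      then show ?thesis using e by (simp add: power2_less_imp_less)
    qed
    then show "\<exists>M. \<forall>m\<ge>M. \<forall>n\<ge>M. dist (x m) (x n) < e" by blast
  qed
  then obtain h where h: "x \<longlonglongrightarrow> h" by (auto simp: Cauchy_convergent_iff convergent_def)
  have hS: "h \<in> S" using closed_sequentially[OF S(2) x(1) h] .
  have "(\<lambda>n. J (x n)) \<longlonglongrightarrow> J h"
    unfolding J_def by (intro tendsto_intros h l.tendsto)
  moreover have "(\<lambda>n. m + 1 / real (Suc n)) \<longlonglongrightarrow> m + 0"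
    using LIMSEQ_inverse_real_of_nat by (intro tendsto_add tendsto_const) (simp add: inverse_eq_divide)
  ultimately have Jh: "J h \<le> m"
    using x(2) by (intro LIMSEQ_le) (auto intro: less_imp_le)
  have "l y = h \<bullet> y" if y: "y \<in> S" for y
  proof -
    define D where "D = h \<bullet> y - l y"
    have D: "0 \<le> t\<^sup>2 * (norm y)\<^sup>2 + 2 * t * D" for t
    proof -
      have "h + t *\<^sub>R y \<in> S" using S(1) hS y by (intro subspace_add subspace_scale)
      from m_le[OF this] Jh have "J h \<le> J (h + t *\<^sub>R y)" by simp
      moreover have "(norm (h + t *\<^sub>R y))\<^sup>2 = (norm h)\<^sup>2 + 2 * t * (h \<bullet> y) + t\<^sup>2 * (norm y)\<^sup>2"
        unfolding power2_norm_eq_inner by (simp add: inner_simps inner_commute power2_eq_square)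
      ultimately show ?thesis
        by (simp add: J_def D_def l.add l.scaleR algebra_simps)
    qed
    have "D = 0"
    proof (rule ccontr)
      assume "D \<noteq> 0"
      define N where "N = (norm y)\<^sup>2"
      \<comment> \<open>The summand 1 keeps the divisor positive even for \<open>y = 0\<close>; at
        \<open>t = - D / q\<close> the quadratic expression would be negative.\<close>
      define q where "q = N + 1"
      have "N \<ge> 0" by (simp add: N_def)
      then have q: "q > 0" "N - 2 * q < 0" by (simp_all add: q_def)
      define t where "t = - D / q"
      have "t\<^sup>2 * N + 2 * t * D = D\<^sup>2 * (N - 2 * q) / q\<^sup>2"
        using q(1) unfolding t_def by (simp add: field_simps power2_eq_square)
      also have "\<dots> < 0"
        using q \<open>D \<noteq> 0\<close> by (intro divide_neg_pos mult_pos_neg) simp_all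
      finally show False using D[of t] by (simp add: N_def)
    qed
    then show ?thesis by (simp add: D_def)
  qed
  with hS show ?thesis by blast
qed

lemma subspace_closure_normed:
  fixes S :: "'h::real_normed_vector set"
  assumes "subspace S"
  shows "subspace (closure S)"
  unfolding subspace_def
proof (intro conjI ballI allI)
  show "0 \<in> closure S" using subspace_0[OF assms] closure_subset by blast
  fix x assume "x \<in> closure S"
  then obtain X where X: "\<And>n. X n \<in> S" "X \<longlonglongrightarrow> x" unfolding closure_sequential by blast
  show "c *\<^sub>R x \<in> closure S" for c
    unfolding closure_sequential using X subspace_scale[OF assms]
    by (intro exI[of _ "\<lambda>n. c *\<^sub>R X n"]) (auto intro!: tendsto_intros)
  fix y assume "y \<in> closure S"
  then obtain Y where "\<And>n. Y n \<in> S" "Y \<longlonglongrightarrow> y" unfolding closure_sequential by blast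
  with X show "x + y \<in> closure S"
    unfolding closure_sequential using subspace_add[OF assms]
    by (intro exI[of _ "\<lambda>n. X n + Y n"]) (auto intro!: tendsto_intros)
qed

lemma l2_dense_subspace:
  fixes S :: "'a::euclidean_space l2 set"
  assumes add: "\<And>f g. f \<in> S \<Longrightarrow> g \<in> S \<Longrightarrow> f + g \<in> S"
    and scale: "\<And>c f. f \<in> S \<Longrightarrow> c *\<^sub>C f \<in> S" and ne: "0 \<in> S"
    and orth: "\<And>h. (\<And>g. g \<in> S \<Longrightarrow> cinner h g = 0) \<Longrightarrow> h = 0"
    and e: "e > 0"
  shows "\<exists>g\<in>S. norm (f - g) < e"
proof -
  have sub: "subspace S"
    using add scale ne by (auto simp: subspace_def scaleR_eq_scaleC)
  have "\<exists>h\<in>closure S. \<forall>x\<in>closure S. f \<bullet> x = h \<bullet> x"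
    by (rule riesz_closed_subspace) (auto intro: subspace_closure_normed sub bounded_linear_inner_right)
  then obtain h where h: "h \<in> closure S" "\<And>x. x \<in> S \<Longrightarrow> f \<bullet> x = h \<bullet> x"
    using closure_subset by blast
  have "f - h = 0"
  proof (rule orth)
    fix g assume g: "g \<in> S"
    \<comment> \<open>The projection is taken in the real Hilbert space and controls real parts
      only; testing with \<open>\<i> *\<^sub>C g\<close>, which is again in \<open>S\<close>,
      supplies the imaginary part.\<close>
    have "Re (cinner (f - h) x) = 0" if "x \<in> S" for x
      using h(2)[OF that] by (simp add: inner_eq_Re_cinner cinner_diff_left)
    from this[OF g] this[OF scale[OF g, of \<i>]] show "cinner (f - h) g = 0"
      by (simp add: complex_eq_iff)
  qed
  then have "f \<in> closure S" using h by simp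
  then obtain g where "g \<in> S" "dist g f < e" using e by (auto simp: closure_approachable)
  then show ?thesis by (auto simp: dist_norm norm_minus_commute)
qed

lemma bounded_ops_add: "T \<in> bounded_ops \<Longrightarrow> T (f + g) = T f + T g"
  and bounded_ops_diff: "T \<in> bounded_ops \<Longrightarrow> T (f - g) = T f - T g"
  and bounded_ops_zero: "T \<in> bounded_ops \<Longrightarrow> T 0 = 0"
  and bounded_ops_scale: "T \<in> bounded_ops \<Longrightarrow> T (c *\<^sub>C f) = c *\<^sub>C T f"
  and bounded_ops_sum: "T \<in> bounded_ops \<Longrightarrow> T (sum h I) = (\<Sum>i\<in>I. T (h i))"
  by (auto simp: bounded_ops_def linear_simps linear_sum[OF bounded_linear.linear])

lemma bounded_ops_bound: "T \<in> bounded_ops \<Longrightarrow> norm (T f) \<le> onorm T * norm f"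
  by (auto simp: bounded_ops_def onorm)

lemma bounded_opsI:
  assumes "\<And>f g. T (f + g) = T f + T g" "\<And>c f. T (c *\<^sub>C f) = c *\<^sub>C T f" "\<And>f. norm (T f) \<le> K * norm f"
  shows "T \<in> bounded_ops"
  unfolding bounded_ops_def using assms
  by (auto intro!: bounded_linear_intro[where K=K] simp: scaleR_eq_scaleC mult.commute)

lemma bounded_ops_minus:
  assumes S: "S \<in> bounded_ops" and T: "T \<in> bounded_ops"
  shows "(\<lambda>f. S f - T f) \<in> bounded_ops"
proof (rule bounded_opsI)
  fix f
  have "norm (S f - T f) \<le> onorm S * norm f + onorm T * norm f"
    by (rule order_trans[OF norm_triangle_ineq4 add_mono[OF bounded_ops_bound[OF S] bounded_ops_bound[OF T]]])
  then show "norm (S f - T f) \<le> (onorm S + onorm T) * norm f" by (simp add: distrib_right)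
qed (auto simp: bounded_ops_add[OF S] bounded_ops_add[OF T] bounded_ops_scale[OF S] bounded_ops_scale[OF T] scaleC_diff_right)

text \<open>The real Riesz theorem is applied to the real part of \<open>B f\<close>; conjugate
  linearity in the second argument recovers the imaginary part from the values at
  \<open>\<i> *\<^sub>C g\<close>.\<close>

lemma sesquilinear_operator_exists:
  fixes B :: "'a::euclidean_space l2 \<Rightarrow> 'a l2 \<Rightarrow> complex"
  assumes add: "\<And>x x' y. B (x + x') y = B x y + B x' y" "\<And>x y y'. B x (y + y') = B x y + B x y'"
    and scale: "\<And>c x y. B (c *\<^sub>C x) y = c * B x y" "\<And>c x y. B x (c *\<^sub>C y) = cnj c * B x y"
    and bound: "\<And>x y. cmod (B x y) \<le> C * norm x * norm y"
  shows "\<exists>A\<in>bounded_ops. (\<forall>f g. cinner (A f) g = B f g) \<and> (\<forall>f. norm (A f) \<le> C * norm f)"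
proof -
  have "\<exists>h. \<forall>g. cinner h g = B f g" for f
  proof -
    have "bounded_linear (\<lambda>g. Re (B f g))"
    proof (rule bounded_linear_intro[where K="C * norm f"])
      show "norm (Re (B f x)) \<le> norm x * (C * norm f)" for x
        using order_trans[OF abs_Re_le_cmod bound[of f x]] by (simp add: mult_ac)
    qed (simp_all add: add scaleR_eq_scaleC scale)
    from riesz_closed_subspace[OF subspace_UNIV closed_UNIV this]
    obtain h where h: "\<And>g. Re (B f g) = h \<bullet> g" by auto
    have "cinner h g = B f g" for g
      using h[of g] h[of "\<i> *\<^sub>C g"] by (simp add: inner_eq_Re_cinner scale complex_eq_iff)
    then show ?thesis by blast
  qed
  then obtain A where A: "\<And>f g. cinner (A f) g = B f g" by metis
  have bd: "norm (A f) \<le> C * norm f" for f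
  proof (cases "A f = 0")
    case True
    \<comment> \<open>The sign of \<open>C\<close> has to be read off the bound itself, taken at
      \<open>f\<close> and \<open>f\<close>.\<close>
    have "0 \<le> C * norm f"
    proof (cases "f = 0")
      case False
      have "0 \<le> C * norm f * norm f" using bound[of f f] order_trans[OF norm_ge_zero] by blast
      then show ?thesis using False by (simp add: zero_le_mult_iff)
    qed simp
    with True show ?thesis by simp
  next
    case False
    have "(norm (A f))\<^sup>2 = cmod (B f (A f))"
      by (simp add: A[symmetric] cinner_self norm_power)
    also have "\<dots> \<le> C * norm f * norm (A f)" by (rule bound)
    finally show ?thesis using False by (simp add: power2_eq_square)
  qed
  have "A \<in> bounded_ops"
    by (rule bounded_opsI[OF _ _ bd]) (auto intro!: cinner_eqI simp: A add scale cinner_add_left)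
  with A bd show ?thesis by blast
qed

section \<open>Orthonormal systems and Bessel's inequality\<close>

definition orthonormal_on :: "nat set \<Rightarrow> (nat \<Rightarrow> 'a::euclidean_space l2) \<Rightarrow> bool" where
  "orthonormal_on I e \<longleftrightarrow> (\<forall>j\<in>I. \<forall>k\<in>I. cinner (e j) (e k) = (if j = k then 1 else 0))"

lemma orthonormal_seq_imp_on: "orthonormal_seq e \<Longrightarrow> orthonormal_on I e"
  by (simp add: orthonormal_seq_def orthonormal_on_def)

lemma norm_eq_1_iff_cinner: "norm v = 1 \<longleftrightarrow> cinner v v = 1"
proof -
  have "cinner v v = 1 \<longleftrightarrow> (norm v)\<^sup>2 = 1"
    unfolding cinner_self by (metis of_real_eq_1_iff)
  also have "\<dots> \<longleftrightarrow> norm v = 1"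
    using norm_ge_zero[of v] unfolding power2_eq_1_iff by linarith
  finally show ?thesis by simp
qed

lemma orthonormal_seq_norm: "orthonormal_seq e \<Longrightarrow> norm (e k) = 1"
  by (simp add: orthonormal_seq_def norm_eq_1_iff_cinner)

lemma norm_orthonormal_sum:
  assumes "finite I" "orthonormal_on I e"
  shows "(norm (\<Sum>k\<in>I. a k *\<^sub>C e k))\<^sup>2 = (\<Sum>k\<in>I. (cmod (a k))\<^sup>2)"
proof -
  have "complex_of_real ((norm (\<Sum>k\<in>I. a k *\<^sub>C e k))\<^sup>2) = (\<Sum>j\<in>I. \<Sum>k\<in>I. cnj (a j) * (a k * cinner (e k) (e j)))"
    by (simp only: cinner_self[symmetric] cinner_sum_left cinner_sum_right cinner_scaleC_left cinner_scaleC_right sum_distrib_left)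
  also have "\<dots> = (\<Sum>j\<in>I. \<Sum>k\<in>I. if k = j then cnj (a j) * a k else 0)"
    using assms(2) by (intro sum.cong refl) (auto simp: orthonormal_on_def)
  also have "\<dots> = of_real (\<Sum>k\<in>I. (cmod (a k))\<^sup>2)"
    using assms(1) by (simp add: sum.delta complex_norm_square mult.commute del: of_real_power)
  finally show ?thesis unfolding of_real_eq_iff .
qed

lemma norm_minus_projection:
  assumes "finite I" "orthonormal_on I e"
  shows "(norm (h - (\<Sum>k\<in>I. cinner h (e k) *\<^sub>C e k)))\<^sup>2 = (norm h)\<^sup>2 - (\<Sum>k\<in>I. (cmod (cinner h (e k)))\<^sup>2)"
proof -
  define p where "p = (\<Sum>k\<in>I. cinner h (e k) *\<^sub>C e k)"
  have "cinner h p = of_real (\<Sum>k\<in>I. (cmod (cinner h (e k)))\<^sup>2)"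
    by (simp add: p_def cinner_sum_right complex_norm_square mult.commute del: of_real_power)
  then have "h \<bullet> p = (\<Sum>k\<in>I. (cmod (cinner h (e k)))\<^sup>2)" by (simp add: inner_eq_Re_cinner)
  moreover have "p \<bullet> p = (\<Sum>k\<in>I. (cmod (cinner h (e k)))\<^sup>2)"
    unfolding p_def power2_norm_eq_inner[symmetric] by (rule norm_orthonormal_sum[OF assms])
  moreover have "(norm (h - p))\<^sup>2 = (norm h)\<^sup>2 - 2 * (h \<bullet> p) + p \<bullet> p"
    by (simp add: power2_norm_eq_inner inner_simps inner_commute)
  ultimately show ?thesis by (simp add: p_def)
qed

lemma bessel:
  assumes "finite I" "orthonormal_on I e"
  shows "(\<Sum>k\<in>I. (cmod (cinner h (e k)))\<^sup>2) \<le> (norm h)\<^sup>2"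
  using norm_minus_projection[OF assms, of h] zero_le_power2[of "norm (h - (\<Sum>k\<in>I. cinner h (e k) *\<^sub>C e k))"] by linarith

lemma norm_minus_projection_le:
  assumes "finite I" "orthonormal_on I e"
  shows "norm (h - (\<Sum>k\<in>I. cinner h (e k) *\<^sub>C e k)) \<le> norm h"
proof (rule power2_le_imp_le)
  have "0 \<le> (\<Sum>k\<in>I. (cmod (cinner h (e k)))\<^sup>2)" by (intro sum_nonneg) auto
  then show "(norm (h - (\<Sum>k\<in>I. cinner h (e k) *\<^sub>C e k)))\<^sup>2 \<le> (norm h)\<^sup>2"
    using norm_minus_projection[OF assms, of h] by simp
qed simp

lemma projection_orthogonal:
  assumes "finite I" "orthonormal_on I e" "j \<in> I"
  shows "cinner (h - (\<Sum>k\<in>I. cinner h (e k) *\<^sub>C e k)) (e j) = 0"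
proof -
  have "(\<Sum>k\<in>I. cinner h (e k) * cinner (e k) (e j)) = (\<Sum>k\<in>I. if k = j then cinner h (e k) else 0)"
    using assms(2,3) by (intro sum.cong refl) (auto simp: orthonormal_on_def)
  then show ?thesis
    using assms(1,3) by (simp add: cinner_diff_left cinner_sum_left sum.delta)
qed

lemma bessel_seq:
  assumes e: "orthonormal_seq e"
  shows "summable (\<lambda>k. (cmod (cinner h (e k)))\<^sup>2)" "(\<Sum>k. (cmod (cinner h (e k)))\<^sup>2) \<le> (norm h)\<^sup>2"
proof -
  have *: "(\<Sum>k<n. (cmod (cinner h (e k)))\<^sup>2) \<le> (norm h)\<^sup>2" for n
    using e by (intro bessel) (auto intro: orthonormal_seq_imp_on)
  show s: "summable (\<lambda>k. (cmod (cinner h (e k)))\<^sup>2)"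
    by (rule summableI_nonneg_bounded[OF _ *]) simp
  show "(\<Sum>k. (cmod (cinner h (e k)))\<^sup>2) \<le> (norm h)\<^sup>2"
    by (rule suminf_le_const[OF s *])
qed

lemma orthonormal_series:
  assumes e: "orthonormal_seq e" and a: "summable (\<lambda>k. (cmod (a k))\<^sup>2)"
  shows "summable (\<lambda>k. a k *\<^sub>C e k)" "(norm (\<Sum>k. a k *\<^sub>C e k))\<^sup>2 = (\<Sum>k. (cmod (a k))\<^sup>2)"
proof -
  show s: "summable (\<lambda>k. a k *\<^sub>C e k)"
    unfolding summable_Cauchy
  proof (intro allI impI)
    fix r :: real assume r: "r > 0"
    then have "r\<^sup>2 > 0" by simp
    with a obtain N where N: "\<And>m n. m \<ge> N \<Longrightarrow> norm (\<Sum>k=m..<n. (cmod (a k))\<^sup>2) < r\<^sup>2"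
      unfolding summable_Cauchy by blast
    have "norm (\<Sum>k=m..<n. a k *\<^sub>C e k) < r" if "m \<ge> N" for m n
    proof -
      have "(norm (\<Sum>k=m..<n. a k *\<^sub>C e k))\<^sup>2 < r\<^sup>2"
        using N[OF that, of n] norm_orthonormal_sum[OF _ orthonormal_seq_imp_on[OF e], of "{m..<n}" a] by simp
      then show ?thesis using r by (simp add: power2_less_imp_less)
    qed
    then show "\<exists>N. \<forall>m\<ge>N. \<forall>n. norm (\<Sum>k=m..<n. a k *\<^sub>C e k) < r" by blast
  qed
  have "(\<lambda>n. (norm (\<Sum>k<n. a k *\<^sub>C e k))\<^sup>2) \<longlonglongrightarrow> (norm (\<Sum>k. a k *\<^sub>C e k))\<^sup>2"
    by (intro tendsto_intros summable_LIMSEQ s)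
  moreover have "(\<lambda>n. (norm (\<Sum>k<n. a k *\<^sub>C e k))\<^sup>2) \<longlonglongrightarrow> (\<Sum>k. (cmod (a k))\<^sup>2)"
    using summable_LIMSEQ[OF a] norm_orthonormal_sum[OF _ orthonormal_seq_imp_on[OF e], of "{..<_}" a] by simp
  ultimately show "(norm (\<Sum>k. a k *\<^sub>C e k))\<^sup>2 = (\<Sum>k. (cmod (a k))\<^sup>2)" by (rule LIMSEQ_unique)
qed

text \<open>Indicators of disjoint unit cubes along the diagonal. Infinite dimension enters here;
  through \<open>orthonormal_extend\<close> it lets singular vectors be continued to infinite
  sequences even when the operator has finite rank.\<close>

lemma orthonormal_seq_exists: "\<exists>u :: nat \<Rightarrow> 'a::euclidean_space l2. orthonormal_seq u"
proof -
  define B where "B k = box (real k *\<^sub>R One) ((real k + 1) *\<^sub>R One :: 'a)" for k :: nat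
  have B_meas [measurable]: "B k \<in> sets borel" for k by (simp add: B_def)
  have emB: "emeasure lborel (B k) = 1" for k
    unfolding B_def by (subst emeasure_lborel_box) (auto simp: algebra_simps)
  have disj: "B j \<inter> B k = {}" if "j \<noteq> k" for j k
  proof -
    obtain b :: 'a where b: "b \<in> Basis" using nonempty_Basis by blast
    have False if "x \<in> B j" "x \<in> B k" for x
    proof -
      have "real j < x \<bullet> b" "x \<bullet> b < real j + 1" "real k < x \<bullet> b" "x \<bullet> b < real k + 1"
        using that b by (auto simp: B_def mem_box)
      then show False using \<open>j \<noteq> k\<close> by linarith
    qed
    then show ?thesis by blast
  qed
  define i where "i k x = (indicator (B k) x :: complex)" for k x
  have i: "i k \<in> Lp 2" for k
  proof -
    have "(\<integral>\<^sup>+x. (cmod (i k x))\<^sup>2 \<partial>lborel) = (\<integral>\<^sup>+x. indicator (B k) x \<partial>lborel)"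
      by (intro nn_integral_cong) (auto simp: i_def indicator_def)
    moreover have "i k \<in> borel_measurable borel" unfolding i_def by measurable
    ultimately show ?thesis unfolding Lp_2_iff_nn by (simp add: emB)
  qed
  have "cinner (abs_l2 (i j)) (abs_l2 (i k)) = (if j = k then 1 else 0)" for j k
  proof -
    have "cinner (abs_l2 (i j)) (abs_l2 (i k)) = (LINT x|lborel. complex_of_real (indicator (B j \<inter> B k) x))"
      unfolding cinner_abs[OF i i] by (intro Bochner_Integration.integral_cong) (auto simp: i_def indicator_def)
    also have "\<dots> = of_real (measure lborel (B j \<inter> B k))"
      by simp
    finally show ?thesis using disj[of j k] emB[of k] by (auto simp: measure_def)
  qed
  then have "orthonormal_seq (\<lambda>k. abs_l2 (i k))" by (simp add: orthonormal_seq_def)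
  then show ?thesis by blast
qed

text \<open>A dimension count by Bessel's inequality: if none of the \<open>n + 1\<close> vectors
  \<open>u 0, ..., u n\<close> had a residual outside the span of \<open>e\<close>, exchanging the
  double sum would give \<open>n + 1 \<le> n\<close>. A non-zero residual is normalised.\<close>

lemma orthonormal_extend:
  assumes "orthonormal_on {..<n} e"
  shows "\<exists>v::'a::euclidean_space l2. norm v = 1 \<and> (\<forall>k<n. cinner v (e k) = 0)"
proof -
  obtain u :: "nat \<Rightarrow> 'a l2" where u: "orthonormal_seq u" using orthonormal_seq_exists by blast
  have en: "norm (e k) = 1" if "k < n" for k
    using assms that by (simp add: orthonormal_on_def norm_eq_1_iff_cinner)
  have "\<exists>j\<le>n. (\<Sum>k<n. (cmod (cinner (u j) (e k)))\<^sup>2) < 1"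
  proof (rule ccontr)
    assume "\<not> ?thesis"
    then have "(\<Sum>j\<le>n. (1::real)) \<le> (\<Sum>j\<le>n. \<Sum>k<n. (cmod (cinner (u j) (e k)))\<^sup>2)"
      by (intro sum_mono) force
    also have "\<dots> = (\<Sum>k<n. \<Sum>j\<le>n. (cmod (cinner (e k) (u j)))\<^sup>2)"
      by (subst sum.swap) (simp add: cinner_commute[of "u _"])
    also have "\<dots> \<le> (\<Sum>k<n. (norm (e k))\<^sup>2)"
      by (intro sum_mono bessel orthonormal_seq_imp_on u) simp
    also have "\<dots> = n" by (simp add: en)
    finally show False by simp
  qed
  then obtain j where j: "(\<Sum>k<n. (cmod (cinner (u j) (e k)))\<^sup>2) < 1" by blast
  define w where "w = u j - (\<Sum>k<n. cinner (u j) (e k) *\<^sub>C e k)"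
  have "(norm w)\<^sup>2 > 0"
    unfolding w_def using norm_minus_projection[OF _ assms, of "u j"] j orthonormal_seq_norm[OF u, of j] by simp
  then have w0: "norm w > 0" by simp
  have "cinner w (e k) = 0" if "k < n" for k
    unfolding w_def using that by (intro projection_orthogonal[OF _ assms]) auto
  then show ?thesis
    using w0 by (intro exI[of _ "of_real (1 / norm w) *\<^sub>C w"]) (simp add: norm_divide)
qed

section \<open>Singular values and Schatten classes\<close>

lemma powr_minus_one_mult: "x > 0 \<Longrightarrow> x powr (p - 1) * x = x powr p" for x p :: real
  by (simp add: powr_diff)

lemma powr_tangent:
  fixes m s p :: real
  assumes m: "m > 0" and s: "s \<ge> 0" and p: "p \<ge> 1"
  shows "m powr p + p * m powr (p - 1) * (s - m) \<le> s powr p"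
proof (cases "s = 0")
  case True
  have "m powr p * 1 \<le> m powr p * p" using p by (intro mult_left_mono) auto
  then show ?thesis using True powr_minus_one_mult[OF m, of p] by (simp add: algebra_simps)
next
  case False
  have "p * m powr (p - 1) * (s - m) \<le> s powr p - m powr p"
    by (rule convex_on_imp_above_tangent[OF powr_convex])
      (use assms False in \<open>auto intro!: derivative_eq_intros simp: interior_open\<close>)
  then show ?thesis by simp
qed

lemma le_one_plus_powr:
  fixes x p :: real
  assumes "1 \<le> p" "0 \<le> x"
  shows "x \<le> 1 + x powr p"
  using powr_mono[of 1 p x] assms by (cases "x \<le> 1") (auto simp: add_increasing2)

text \<open>The tangent of the power function at \<open>m = I / C\<close> is integrated against the
  weight. Lebesgue measure serves the localization operators, counting measure the sums over
  singular values.\<close>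

lemma weighted_powr_jensen:
  fixes s w :: "'a \<Rightarrow> real"
  assumes p: "p \<ge> 1" and C: "C > 0"
    and w: "integrable M w" "\<And>x. x \<in> space M \<Longrightarrow> 0 \<le> w x" "(LINT x|M. w x) \<le> C"
    and s: "s \<in> borel_measurable M" "\<And>x. x \<in> space M \<Longrightarrow> 0 \<le> s x"
    and sw: "integrable M (\<lambda>x. s x powr p * w x)"
  shows "integrable M (\<lambda>x. s x * w x)"
    and "(LINT x|M. s x * w x) powr p \<le> C powr (p - 1) * (LINT x|M. s x powr p * w x)"
proof -
  show i: "integrable M (\<lambda>x. s x * w x)"
  proof (rule Bochner_Integration.integrable_bound)
    show "integrable M (\<lambda>x. w x + s x powr p * w x)" using w(1) sw by simp
    show "(\<lambda>x. s x * w x) \<in> borel_measurable M" using w(1) s(1) by measurable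
    have "s x * w x \<le> w x + s x powr p * w x" if "x \<in> space M" for x
      using mult_right_mono[OF le_one_plus_powr[OF p s(2)[OF that]] w(2)[OF that]] by (simp add: distrib_right)
    then show "AE x in M. norm (s x * w x) \<le> norm (w x + s x powr p * w x)"
      using s(2) w(2) by (auto intro!: AE_I2)
  qed
  define I where "I = (LINT x|M. s x * w x)"
  define J where "J = (LINT x|M. s x powr p * w x)"
  define m where "m = I / C"
  have I0: "0 \<le> I" unfolding I_def using s(2) w(2) by (intro integral_nonneg_AE AE_I2) auto
  have J0: "0 \<le> J" unfolding J_def using w(2) by (intro integral_nonneg_AE AE_I2) auto
  have "I powr p \<le> C powr (p - 1) * J"
  proof (cases "I = 0")
    case False
    then have m: "m > 0" using I0 C by (simp add: m_def)
    have "(LINT x|M. m powr p * w x + p * m powr (p - 1) * (s x * w x - m * w x)) \<le> J"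
      unfolding J_def
    proof (rule integral_mono_AE)
      show "integrable M (\<lambda>x. m powr p * w x + p * m powr (p - 1) * (s x * w x - m * w x))"
        using w(1) i by simp
      show "AE x in M. m powr p * w x + p * m powr (p - 1) * (s x * w x - m * w x) \<le> s x powr p * w x"
      proof (rule AE_I2)
        fix x assume x: "x \<in> space M"
        have "(m powr p + p * m powr (p - 1) * (s x - m)) * w x \<le> s x powr p * w x"
          by (intro mult_right_mono powr_tangent m s p x w)
        then show "m powr p * w x + p * m powr (p - 1) * (s x * w x - m * w x) \<le> s x powr p * w x"
          by (simp add: algebra_simps)
      qed
    qed (rule sw)
    also have "(LINT x|M. m powr p * w x + p * m powr (p - 1) * (s x * w x - m * w x))
        = m powr p * (LINT x|M. w x) + p * m powr (p - 1) * (I - m * (LINT x|M. w x))"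
      unfolding I_def using w(1) i by simp
    finally have *: "m powr p * (LINT x|M. w x) + p * m powr (p - 1) * (I - m * (LINT x|M. w x)) \<le> J" .
    have mp: "m powr p = m powr (p - 1) * m"
      using powr_minus_one_mult[OF m] by simp
    have Im: "I = m * C" using C by (simp add: m_def)
    \<comment> \<open>The missing mass \<open>C - (LINT x|M. w x)\<close> enters with the
      non-negative factor \<open>p - 1\<close>, so that a weight of mass below \<open>C\<close> only
      helps.\<close>
    have "C * m powr p \<le> m powr p * (LINT x|M. w x) + p * m powr (p - 1) * (I - m * (LINT x|M. w x))"
    proof -
      have "0 \<le> (p - 1) * (m powr p * (C - (LINT x|M. w x)))"
        using p w(3) m by simp
      then show ?thesis unfolding Im mp by (simp add: algebra_simps)
    qed
    with * have "C * m powr p \<le> J" by linarith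
    then have "C powr (p - 1) * (C * m powr p) \<le> C powr (p - 1) * J"
      by (intro mult_left_mono) auto
    moreover have "C powr (p - 1) * (C * m powr p) = I powr p"
    proof -
      have "C powr (p - 1) * C = C powr p" by (rule powr_minus_one_mult[OF C])
      then show ?thesis unfolding Im using C m by (simp add: powr_mult mult.assoc[symmetric] mult.commute)
    qed
    ultimately show ?thesis by simp
  qed (use J0 in simp)
  then show "(LINT x|M. s x * w x) powr p \<le> C powr (p - 1) * (LINT x|M. s x powr p * w x)"
    by (simp add: I_def J_def)
qed

lemma weighted_powr_jensen_suminf:
  fixes s w :: "nat \<Rightarrow> real"
  assumes p: "p \<ge> 1" and C: "C > 0"
    and w: "summable w" "\<And>k. 0 \<le> w k" "(\<Sum>k. w k) \<le> C"
    and s: "\<And>k. 0 \<le> s k" and sw: "summable (\<lambda>k. s k powr p * w k)"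
  shows "summable (\<lambda>k. s k * w k)"
    and "(\<Sum>k. s k * w k) powr p \<le> C powr (p - 1) * (\<Sum>k. s k powr p * w k)"
proof -
  have iff: "integrable (count_space UNIV) f \<longleftrightarrow> summable f" if "\<And>k. 0 \<le> f k" for f :: "nat \<Rightarrow> real"
    using that by (simp add: integrable_count_space_nat_iff)
  have eq: "integral\<^sup>L (count_space UNIV) f = (\<Sum>k. f k)" if "summable f" "\<And>k. 0 \<le> f k" for f :: "nat \<Rightarrow> real"
    using that by (intro sums_unique sums_integral_count_space_nat) (simp add: iff)
  note J = weighted_powr_jensen[OF p C, of "count_space UNIV" w s]
  have "integrable (count_space UNIV) (\<lambda>k. s k * w k)"
    by (rule J) (use w s sw in \<open>simp_all add: iff eq\<close>)
  then show sm: "summable (\<lambda>k. s k * w k)" using w(2) s by (simp add: iff)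
  have "(LINT k|count_space UNIV. s k * w k) powr p \<le> C powr (p - 1) * (LINT k|count_space UNIV. s k powr p * w k)"
    by (rule J) (use w s sw in \<open>simp_all add: iff eq\<close>)
  then show "(\<Sum>k. s k * w k) powr p \<le> C powr (p - 1) * (\<Sum>k. s k powr p * w k)"
    using w s sw sm by (simp add: eq)
qed

section \<open>Singular value decomposition of compact operators\<close>

lemma compact_opsD: "T \<in> compact_ops \<Longrightarrow> T \<in> bounded_ops"
  by (simp add: compact_ops_def)

lemma compact_ops_subseq:
  assumes T: "T \<in> compact_ops" and h: "\<And>n::nat. norm (h n) \<le> 1"
  obtains r y where "strict_mono r" "(\<lambda>n. T (h (r n))) \<longlonglongrightarrow> y"
proof -
  have "compact (closure (T ` cball 0 1))" using T by (simp add: compact_ops_def)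
  moreover have "\<And>n. T (h n) \<in> closure (T ` cball 0 1)"
    using h closure_subset by fastforce
  ultimately obtain y r where "strict_mono r" "((\<lambda>n. T (h n)) \<circ> r) \<longlonglongrightarrow> y"
    unfolding compact_def by metis
  then show ?thesis by (intro that) (auto simp: o_def)
qed

lemma orthonormal_on_lessThanI:
  assumes "\<And>n. n < N \<Longrightarrow> norm (f n) = 1 \<and> (\<forall>k<n. cinner (f n) (f k) = 0)"
  shows "orthonormal_on {..<N} f"
  unfolding orthonormal_on_def
proof (intro ballI)
  fix j k assume "j \<in> {..<N}" "k \<in> {..<N}"
  then show "cinner (f j) (f k) = (if j = k then 1 else 0)"
    using assms[of j] assms[of k] cinner_commute[of "f j" "f k"]
    by (cases j k rule: linorder_cases) (auto simp: norm_eq_1_iff_cinner)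
qed

lemma orthonormal_seqI:
  assumes "\<And>n. norm (f n) = 1 \<and> (\<forall>k<n. cinner (f n) (f k) = 0)"
  shows "orthonormal_seq f"
proof -
  have "cinner (f j) (f k) = (if j = k then 1 else 0)" for j k
    using orthonormal_on_lessThanI[of "Suc (max j k)" f] assms by (simp add: orthonormal_on_def)
  then show ?thesis by (simp add: orthonormal_seq_def)
qed

lemma norm_on_complement_sup:
  fixes e :: "nat \<Rightarrow> 'a::euclidean_space l2"
  assumes Tb: "T \<in> bounded_ops" and e: "orthonormal_on {..<n} e"
  defines "U \<equiv> {h. (\<forall>k<n. cinner h (e k) = 0) \<and> norm h = 1}"
  obtains \<sigma> where "0 \<le> \<sigma>" "\<And>h. (\<forall>k<n. cinner h (e k) = 0) \<Longrightarrow> norm (T h) \<le> \<sigma> * norm h"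
    "\<And>r. r < \<sigma> \<Longrightarrow> \<exists>h\<in>U. r < norm (T h)" "U \<noteq> {}"
proof -
  define \<sigma> where "\<sigma> = (SUP h\<in>U. norm (T h))"
  have ne: "U \<noteq> {}" using orthonormal_extend[OF e] by (auto simp: U_def)
  have bdd: "bdd_above ((\<lambda>h. norm (T h)) ` U)"
    using bounded_ops_bound[OF Tb] by (auto intro!: bdd_aboveI[where M="onorm T"] simp: U_def) (metis mult.right_neutral)
  have U_le: "norm (T h) \<le> \<sigma>" if "h \<in> U" for h
    unfolding \<sigma>_def by (rule cSUP_upper[OF that bdd])
  have M_le: "norm (T h) \<le> \<sigma> * norm h" if h: "\<forall>k<n. cinner h (e k) = 0" for h
  proof (cases "h = 0")
    case False
    have "of_real (1 / norm h) *\<^sub>C h \<in> U" using h False by (simp add: U_def norm_divide)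
    from U_le[OF this] show ?thesis
      using False by (simp add: bounded_ops_scale[OF Tb] norm_divide field_simps)
  qed (simp add: bounded_ops_zero[OF Tb])
  have "0 \<le> \<sigma>" using ne U_le by (meson ex_in_conv norm_ge_zero order_trans)
  moreover have "\<exists>h\<in>U. r < norm (T h)" if "r < \<sigma>" for r
    using less_cSUP_iff[OF ne bdd, of r] that by (simp add: \<sigma>_def)
  ultimately show thesis using M_le ne by (intro that[of \<sigma>])
qed

text \<open>Attainment of the norm on the orthogonal complement of the vectors found so far;
  iteration produces the right singular vectors.\<close>

lemma compact_op_max_vector:
  fixes e :: "nat \<Rightarrow> 'a::euclidean_space l2"
  assumes T: "T \<in> compact_ops" and e: "orthonormal_on {..<n} e"
  shows "\<exists>v. norm v = 1 \<and> (\<forall>k<n. cinner v (e k) = 0) \<and>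
    (\<forall>h. (\<forall>k<n. cinner h (e k) = 0) \<longrightarrow> norm (T h) \<le> norm (T v) * norm h)"
proof -
  note Tb = compact_opsD[OF T]
  define M where "M = {h. \<forall>k<n. cinner h (e k) = 0}"
  define U where "U = {h. (\<forall>k<n. cinner h (e k) = 0) \<and> norm h = 1}"
  obtain \<sigma> where \<sigma>0: "0 \<le> \<sigma>" and M_le: "\<And>h. h \<in> M \<Longrightarrow> norm (T h) \<le> \<sigma> * norm h"
    and near: "\<And>r. r < \<sigma> \<Longrightarrow> \<exists>h\<in>U. r < norm (T h)" and ne: "U \<noteq> {}"
    by (rule norm_on_complement_sup[OF Tb e]) (auto simp: U_def M_def)
  have U_le: "norm (T h) \<le> \<sigma>" if "h \<in> U" for h
    using M_le[of h] that by (simp add: U_def M_def)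
  have "\<exists>v\<in>U. norm (T v) = \<sigma>"
  \<comment> \<open>For \<open>\<sigma> = 0\<close> every unit vector of the complement will do. The
    Cauchy argument of the other case cancels a factor \<open>\<sigma>\<^sup>2\<close>.\<close>
  proof (cases "\<sigma> = 0")
    case True
    then show ?thesis using ne U_le by (metis ex_in_conv norm_ge_zero order_antisym)
  next
    case False
    with \<sigma>0 have \<sigma>: "\<sigma> > 0" by simp
    have "\<exists>h\<in>U. \<sigma> - 1 / real (Suc m) < norm (T h)" for m
      by (rule near) simp
    then obtain h where h: "\<And>m. h m \<in> U" "\<And>m. \<sigma> - 1 / real (Suc m) < norm (T (h m))" by metis
    have "norm (h m) \<le> 1" for m using h(1)[of m] by (simp add: U_def)
    then obtain r y where r: "strict_mono r" and y: "(\<lambda>m. T (h (r m))) \<longlonglongrightarrow> y"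
      by (rule compact_ops_subseq[OF T])
    define g where "g m = h (r m)" for m
    have gU: "g m \<in> U" for m using h by (simp add: g_def)
    have "(\<lambda>m. norm (T (h m))) \<longlonglongrightarrow> \<sigma>"
    proof (rule tendsto_sandwich)
      have "(\<lambda>m. \<sigma> - 1 / real (Suc m)) \<longlonglongrightarrow> \<sigma> - 0"
        using LIMSEQ_inverse_real_of_nat by (intro tendsto_diff tendsto_const) (simp add: inverse_eq_divide)
      then show "(\<lambda>m. \<sigma> - 1 / real (Suc m)) \<longlonglongrightarrow> \<sigma>" by simp
      show "\<forall>\<^sub>F m in sequentially. \<sigma> - 1 / real (Suc m) \<le> norm (T (h m))"
        by (intro always_eventually allI less_imp_le h(2))
      show "\<forall>\<^sub>F m in sequentially. norm (T (h m)) \<le> \<sigma>"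
        using U_le h(1) by simp
    qed simp
    from LIMSEQ_subseq_LIMSEQ[OF this r] have gs: "(\<lambda>m. norm (T (g m))) \<longlonglongrightarrow> \<sigma>"
      by (simp add: g_def o_def)
    \<comment> \<open>\<open>Q\<close> is non-negative on \<open>M\<close> and satisfies the parallelogram law, which makes a maximizing sequence
      with convergent images a Cauchy sequence, without recourse to the adjoint or to weak compactness.\<close>
    define Q where "Q x = \<sigma>\<^sup>2 * (norm x)\<^sup>2 - (norm (T x))\<^sup>2" for x
    have Q0: "0 \<le> Q x" if "x \<in> M" for x
      using power_mono[OF M_le[OF that] norm_ge_zero, of 2] by (simp add: Q_def power_mult_distrib)
    have par: "(norm (x - y))\<^sup>2 = 2 * (norm x)\<^sup>2 + 2 * (norm y)\<^sup>2 - (norm (x + y))\<^sup>2" for x y :: "'a l2"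
      by (simp add: power2_norm_eq_inner inner_simps inner_commute)
    have Qpar: "Q (x - y) = 2 * Q x + 2 * Q y - Q (x + y)" for x y
      unfolding Q_def bounded_ops_diff[OF Tb] par by (simp add: bounded_ops_add[OF Tb] algebra_simps)
    have Mclosed: "x + y \<in> M" if "x \<in> M" "y \<in> M" for x y
      using that by (simp add: M_def cinner_add_left)
    have gM: "g m \<in> M" for m using gU by (simp add: U_def M_def)
    have Qg: "Q (g m) = \<sigma>\<^sup>2 - (norm (T (g m)))\<^sup>2" for m
      using gU[of m] by (simp add: Q_def U_def)
    have Qg0: "(\<lambda>m. Q (g m)) \<longlonglongrightarrow> 0"
    proof -
      have "(\<lambda>m. \<sigma>\<^sup>2 - (norm (T (g m)))\<^sup>2) \<longlonglongrightarrow> \<sigma>\<^sup>2 - \<sigma>\<^sup>2" by (intro tendsto_intros gs)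
      then show ?thesis by (simp add: Qg)
    qed
    have "Cauchy g"
    proof (rule metric_CauchyI)
      fix \<epsilon> :: real assume \<epsilon>: "\<epsilon> > 0"
      \<comment> \<open>The budget \<open>\<sigma>\<^sup>2 * \<epsilon>\<^sup>2\<close> is split in
        halves: the values of \<open>Q\<close>, each below \<open>d / 8\<close> and counted twice,
        give one half, the squared distance of the images the other.\<close>
      define d where "d = \<sigma>\<^sup>2 * \<epsilon>\<^sup>2"
      have d: "d > 0" using \<epsilon> \<sigma> by (simp add: d_def)
      have "\<forall>\<^sub>F m in sequentially. Q (g m) < d / 8"
        using order_tendstoD(2)[OF Qg0, of "d / 8"] d by simp
      then obtain N1 where N1: "\<And>m. m \<ge> N1 \<Longrightarrow> Q (g m) < d / 8" by (auto simp: eventually_sequentially)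
      have "Cauchy (\<lambda>m. T (g m))" using y LIMSEQ_imp_Cauchy by (auto simp: g_def)
      moreover have "sqrt (d / 2) > 0" using d by simp
      ultimately obtain N2 where N2: "\<And>i j. i \<ge> N2 \<Longrightarrow> j \<ge> N2 \<Longrightarrow> dist (T (g i)) (T (g j)) < sqrt (d / 2)"
        unfolding Cauchy_def by blast
      have "dist (g i) (g j) < \<epsilon>" if "i \<ge> max N1 N2" "j \<ge> max N1 N2" for i j
      proof -
        have "Q (g i - g j) \<le> 2 * Q (g i) + 2 * Q (g j)"
          unfolding Qpar using Q0[OF Mclosed[OF gM gM], of i j] by simp
        then have "Q (g i - g j) < d / 2" using N1[of i] N1[of j] that by simp
        moreover have "(norm (T (g i - g j)))\<^sup>2 < d / 2"
        proof -
          have "norm (T (g i - g j)) < sqrt (d / 2)"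
            using N2[of i j] that by (simp add: dist_norm bounded_ops_diff[OF Tb])
          then have "(norm (T (g i - g j)))\<^sup>2 < (sqrt (d / 2))\<^sup>2"
            by (intro power_strict_mono) auto
          then show ?thesis using d by simp
        qed
        ultimately have "\<sigma>\<^sup>2 * (norm (g i - g j))\<^sup>2 < \<sigma>\<^sup>2 * \<epsilon>\<^sup>2" by (simp add: Q_def d_def)
        then have "(norm (g i - g j))\<^sup>2 < \<epsilon>\<^sup>2" using \<sigma> by simp
        then show ?thesis using \<epsilon> by (simp add: dist_norm power2_less_imp_less)
      qed
      then show "\<exists>N. \<forall>m\<ge>N. \<forall>n\<ge>N. dist (g m) (g n) < \<epsilon>" by blast
    qed
    then obtain v where v: "g \<longlonglongrightarrow> v" by (auto simp: Cauchy_convergent_iff convergent_def)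
    have "cinner v (e k) = 0" if "k < n" for k
    proof -
      have "(\<lambda>m. cinner (g m) (e k)) \<longlonglongrightarrow> cinner v (e k)" by (rule tendsto_cinner_left[OF v])
      moreover have "cinner (g m) (e k) = 0" for m using gM that by (simp add: M_def)
      ultimately show ?thesis by (simp add: LIMSEQ_const_iff)
    qed
    moreover have "norm v = 1"
      using tendsto_norm[OF v] gU by (simp add: U_def LIMSEQ_const_iff)
    moreover have "(\<lambda>m. T (g m)) \<longlonglongrightarrow> T v"
      using Tb v by (auto simp: bounded_ops_def intro: bounded_linear.tendsto)
    from LIMSEQ_unique[OF tendsto_norm[OF this] gs] have "norm (T v) = \<sigma>" .
    ultimately show ?thesis by (auto simp: U_def M_def)
  qed
  then obtain v where "v \<in> U" "norm (T v) = \<sigma>" by blast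
  then show ?thesis using M_le by (intro exI[of _ v]) (auto simp: U_def M_def)
qed

text \<open>First-order optimality: moving from \<open>v\<close> along an orthogonal
  \<open>h\<close> changes the norm only to second order, but the norm of the image to first order
  unless the images are orthogonal. This replaces the spectral theorem for the product of
  \<open>T\<close> with its adjoint.\<close>

lemma maximal_imp_images_orthogonal:
  fixes v h :: "'a::euclidean_space l2"
  assumes T: "T \<in> bounded_ops" and v: "norm v = 1" and vh: "cinner h v = 0"
    and max: "\<And>c. norm (T (v + c *\<^sub>C h)) \<le> norm (T v) * norm (v + c *\<^sub>C h)"
  shows "cinner (T h) (T v) = 0"
proof (rule ccontr)
  define w where "w = cinner (T h) (T v)"
  assume "cinner (T h) (T v) \<noteq> 0"
  then have w: "cmod w > 0" by (simp add: w_def)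
  have expand: "(norm (x + c *\<^sub>C y))\<^sup>2 = (norm x)\<^sup>2 + 2 * Re (c * cinner y x) + (cmod c)\<^sup>2 * (norm y)\<^sup>2"
    for x y :: "'a l2" and c
  proof -
    have "(norm (x + c *\<^sub>C y))\<^sup>2 = (norm x)\<^sup>2 + 2 * ((c *\<^sub>C y) \<bullet> x) + (norm (c *\<^sub>C y))\<^sup>2"
      unfolding power2_norm_eq_inner by (simp add: inner_simps inner_commute)
    then show ?thesis by (simp only: inner_eq_Re_cinner power_mult_distrib norm_scaleC cinner_scaleC_left)
  qed
  define K where "K = (norm (T v))\<^sup>2 * (norm h)\<^sup>2"
  have K: "K \<ge> 0" by (simp add: K_def)
  \<comment> \<open>Small enough for the gain, of order \<open>2 * t\<close>, to exceed the loss
    \<open>t\<^sup>2 * K\<close>, both up to the factor \<open>(cmod w)\<^sup>2\<close>. The phase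
    of \<open>c\<close> makes the gain real and positive.\<close>
  define t where "t = 1 / (K + 1)"
  have t: "t > 0" "t * K < 1" using K by (simp_all add: t_def)
  define c where "c = of_real t * cnj w"
  have "c * w = of_real (t * (cmod w)\<^sup>2)"
    unfolding of_real_mult complex_norm_square by (simp add: c_def)
  then have cw: "Re (c * w) = t * (cmod w)\<^sup>2" by simp
  have cc: "(cmod c)\<^sup>2 = t\<^sup>2 * (cmod w)\<^sup>2" by (simp add: c_def norm_mult power_mult_distrib)
  have "(norm (T (v + c *\<^sub>C h)))\<^sup>2 \<le> (norm (T v) * norm (v + c *\<^sub>C h))\<^sup>2"
    by (intro power_mono max) simp
  then have "(norm (T v + c *\<^sub>C T h))\<^sup>2 \<le> (norm (T v))\<^sup>2 * (norm (v + c *\<^sub>C h))\<^sup>2"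
    by (simp add: bounded_ops_add[OF T] bounded_ops_scale[OF T] power_mult_distrib)
  then have "2 * (t * (cmod w)\<^sup>2) + t\<^sup>2 * (cmod w)\<^sup>2 * (norm (T h))\<^sup>2 \<le> t\<^sup>2 * (cmod w)\<^sup>2 * K"
    unfolding expand w_def[symmetric] cw cc vh v K_def by (simp add: algebra_simps)
  moreover have "0 \<le> t\<^sup>2 * (cmod w)\<^sup>2 * (norm (T h))\<^sup>2" by simp
  ultimately have "2 * (t * (cmod w)\<^sup>2) \<le> (t * K) * (t * (cmod w)\<^sup>2)"
    by (simp add: power2_eq_square mult_ac)
  moreover have "t * (cmod w)\<^sup>2 > 0" using t w by simp
  ultimately have "2 \<le> t * K" by (simp only: mult_le_cancel_right_pos)
  with t show False by simp
qed

abbreviation svd_terms ::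
    "(nat \<Rightarrow> real) \<Rightarrow> (nat \<Rightarrow> 'a::euclidean_space l2) \<Rightarrow> (nat \<Rightarrow> 'a l2) \<Rightarrow> 'a l2 \<Rightarrow> nat \<Rightarrow> 'a l2" where
  "svd_terms s e f h \<equiv> \<lambda>k. (of_real (s k) * cinner h (e k)) *\<^sub>C f k"

text \<open>Greedy choice: each \<open>e n\<close> maximises the norm of \<open>T\<close>
  orthogonally to its predecessors, and maximality makes the images orthogonal. After
  \<open>n\<close> terms the remainder is the image of a vector orthogonal to the first
  \<open>n\<close> of the \<open>e k\<close>, hence at most \<open>s n * norm h\<close>.\<close>

lemma has_singular_values_exists:
  fixes T :: "'a::euclidean_space l2 \<Rightarrow> 'a l2"
  assumes T: "T \<in> compact_ops"
  shows "\<exists>s. has_singular_values T s"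
proof -
  note Tb = compact_opsD[OF T]
  let ?P = "\<lambda>f (n::nat) v. norm v = 1 \<and> (\<forall>k<n. cinner v (f k) = 0) \<and>
    (\<forall>h. (\<forall>k<n. cinner h (f k) = 0) \<longrightarrow> norm (T h) \<le> norm (T v) * norm h)"
  have "\<exists>f. \<forall>n. ?P f n (f n)"
  proof (rule dependent_wellorder_choice[where P="?P"])
    fix n :: nat and f assume "\<And>y. y < n \<Longrightarrow> ?P f y (f y)"
    then have "orthonormal_on {..<n} f" by (intro orthonormal_on_lessThanI) blast
    then show "\<exists>v. ?P f n v" by (rule compact_op_max_vector[OF T])
  qed auto
  then obtain e where e: "\<And>n. ?P e n (e n)" by blast
  have eo: "orthonormal_seq e"
    by (rule orthonormal_seqI) (use e in blast)
  define s where "s n = norm (T (e n))" for n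
  have s0: "0 \<le> s n" for n by (simp add: s_def)
  have max: "norm (T h) \<le> s n * norm h" if "\<And>k. k < n \<Longrightarrow> cinner h (e k) = 0" for n h
    using e that by (simp add: s_def)
  have e1: "norm (e n) = 1" for n using e by blast
  have dec: "decseq s"
  proof (rule decseq_SucI)
    fix n show "s (Suc n) \<le> s n"
      using max[of n "e (Suc n)"] e1[of "Suc n"] eo by (simp add: s_def orthonormal_seq_def)
  qed
  have orth: "cinner (T (e k)) (T (e j)) = 0" if "j < k" for j k
  proof (rule maximal_imp_images_orthogonal[OF Tb e1])
    show "cinner (e k) (e j) = 0" using eo that by (simp add: orthonormal_seq_def)
    show "norm (T (e j + c *\<^sub>C e k)) \<le> norm (T (e j)) * norm (e j + c *\<^sub>C e k)" for c
      using max[of j "e j + c *\<^sub>C e k"] eo that by (simp add: s_def cinner_add_left orthonormal_seq_def)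
  qed
  have orth': "cinner (T (e k)) (T (e j)) = 0" if "j \<noteq> k" for j k
    using orth[of j k] orth[of k j] cinner_commute[of "T (e k)" "T (e j)"] that by (cases j k rule: linorder_cases) auto
  \<comment> \<open>Orthogonal images of norm at least \<open>L\<close> are at distance at least
    \<open>L\<close> from each other, so no subsequence of them could converge.\<close>
  have lim: "s \<longlonglongrightarrow> 0"
  proof -
    obtain L where L: "s \<longlonglongrightarrow> L" "\<And>n. L \<le> s n"
      using decseq_convergent[OF dec, of 0] s0 by blast
    have "L = 0"
    proof (rule ccontr)
      assume "L \<noteq> 0"
      moreover have "L \<ge> 0" using LIMSEQ_le_const[OF L(1)] s0 by blast
      ultimately have Lp: "L > 0" by simp
      obtain r y where r: "strict_mono r" and y: "(\<lambda>n. T (e (r n))) \<longlonglongrightarrow> y"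
        by (rule compact_ops_subseq[OF T, of e]) (simp_all add: e1)
      from LIMSEQ_imp_Cauchy[OF y] Lp obtain N where "dist (T (e (r N))) (T (e (r (Suc N)))) < L"
        unfolding Cauchy_def by (metis le_refl le_Suc_eq)
      then have "(norm (T (e (r N)) - T (e (r (Suc N)))))\<^sup>2 < L\<^sup>2"
        by (intro power_strict_mono) (auto simp: dist_norm)
      moreover have "r N \<noteq> r (Suc N)" using r by (metis less_irrefl lessI strict_mono_less)
      then have "(norm (T (e (r N)) - T (e (r (Suc N)))))\<^sup>2 = (s (r N))\<^sup>2 + (s (r (Suc N)))\<^sup>2"
        using orth'[of "r N" "r (Suc N)"] orth'[of "r (Suc N)" "r N"]
        by (simp add: s_def power2_norm_eq_inner inner_diff_left inner_diff_right) (simp add: inner_eq_Re_cinner)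
      moreover have "L\<^sup>2 \<le> (s (r N))\<^sup>2" using L(2) Lp by (intro power_mono) auto
      ultimately show False using zero_le_power2[of "s (r (Suc N))"] by linarith
    qed
    with L show ?thesis by simp
  qed
  let ?R = "\<lambda>f (n::nat) v. norm v = 1 \<and> (\<forall>k<n. cinner v (f k) = 0) \<and> T (e n) = of_real (s n) *\<^sub>C v"
  have "\<exists>f. \<forall>n. ?R f n (f n)"
  proof (rule dependent_wellorder_choice[where P="?R"])
    fix n :: nat and f assume f: "\<And>y. y < n \<Longrightarrow> ?R f y (f y)"
    show "\<exists>v. ?R f n v"
    \<comment> \<open>A zero singular value leaves \<open>f n\<close> free, and any unit vector
      orthogonal to the earlier ones is taken. If \<open>s n\<close> is non-zero, then so are all
      earlier values by monotonicity, and the earlier \<open>f k\<close> are normalised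
      images.\<close>
    proof (cases "s n = 0")
      case True
      have "orthonormal_on {..<n} f" by (intro orthonormal_on_lessThanI) (use f in blast)
      from orthonormal_extend[OF this] show ?thesis using True by (auto simp: s_def)
    next
      case False
      define v where "v = of_real (1 / s n) *\<^sub>C T (e n)"
      have "cinner v (f k) = 0" if k: "k < n" for k
      proof -
        have "s k \<ge> s n" using dec k by (simp add: decseq_def)
        then have sk: "s k \<noteq> 0" using False s0[of n] by linarith
        have "cinner (T (e n)) (T (e k)) = of_real (s k) * cinner (T (e n)) (f k)"
          using f[OF k] by simp
        then show ?thesis using orth[OF k] sk by (simp add: v_def)
      qed
      then show ?thesis using False s0[of n]
        by (intro exI[of _ v]) (simp add: v_def norm_divide flip: s_def)
    qed
  qed auto
  then obtain f where f: "\<And>n. ?R f n (f n)" by blast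
  have fo: "orthonormal_seq f"
    by (rule orthonormal_seqI) (use f in blast)
  have "svd_terms s e f h sums T h" for h
    unfolding sums_def
  proof (rule Lim_null[THEN iffD2], rule Lim_null_comparison)
    let ?p = "\<lambda>n. h - (\<Sum>k<n. cinner h (e k) *\<^sub>C e k)"
    have eq: "(\<Sum>k<n. (of_real (s k) * cinner h (e k)) *\<^sub>C f k) - T h = - T (?p n)" for n
      using f by (simp add: bounded_ops_diff[OF Tb] bounded_ops_sum[OF Tb] bounded_ops_scale[OF Tb] mult.commute)
    have "norm (T (?p n)) \<le> s n * norm h" for n
    proof -
      have "norm (T (?p n)) \<le> s n * norm (?p n)"
        by (intro max projection_orthogonal orthonormal_seq_imp_on[OF eo]) auto
      also have "\<dots> \<le> s n * norm h"
        by (intro mult_left_mono s0 norm_minus_projection_le orthonormal_seq_imp_on[OF eo]) auto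
      finally show ?thesis .
    qed
    then show "\<forall>\<^sub>F n in sequentially. norm ((\<Sum>k<n. (of_real (s k) * cinner h (e k)) *\<^sub>C f k) - T h) \<le> s n * norm h"
      unfolding eq by simp
    show "(\<lambda>n. s n * norm h) \<longlonglongrightarrow> 0" using tendsto_mult_left_zero[OF lim] .
  qed
  then have "has_singular_values T s" unfolding has_singular_values_def using dec lim eo fo by blast
  then show ?thesis by blast
qed

text \<open>The chosen sequence is accessed through a decomposition that witnesses it. The last
  clause is decisive: it turns bounds valid along every orthonormal sequence into bounds on singular
  values.\<close>

lemma compact_op_svd:
  assumes T: "T \<in> compact_ops"
  obtains e f where "orthonormal_seq e" "orthonormal_seq f" "decseq (singular_values T)"
    "singular_values T \<longlonglongrightarrow> 0" "\<And>k. 0 \<le> singular_values T k"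
    "\<And>h. svd_terms (singular_values T) e f h sums T h"
    "\<And>k. T (e k) = of_real (singular_values T k) *\<^sub>C f k"
    "\<And>k. singular_values T k = norm (T (e k))"
proof -
  have "has_singular_values T (singular_values T)"
    unfolding singular_values_def using has_singular_values_exists[OF T] by (rule someI_ex)
  then obtain e f where ef: "orthonormal_seq e" "orthonormal_seq f"
    "\<And>h. svd_terms (singular_values T) e f h sums T h"
    and s: "decseq (singular_values T)" "singular_values T \<longlonglongrightarrow> 0"
    unfolding has_singular_values_def by blast
  have s0: "0 \<le> singular_values T k" for k using decseq_ge[OF s] .
  have Te: "T (e j) = of_real (singular_values T j) *\<^sub>C f j" for j
  proof -
    have "(\<lambda>k. (of_real (singular_values T k) * cinner (e j) (e k)) *\<^sub>C f k)
        = (\<lambda>k. if k = j then of_real (singular_values T j) *\<^sub>C f j else 0)"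
      using ef(1) by (auto simp: orthonormal_seq_def)
    with ef(3)[of "e j"] have "(\<lambda>k. if k = j then of_real (singular_values T j) *\<^sub>C f j else 0) sums T (e j)" by simp
    then show ?thesis using sums_single[of j "\<lambda>_. of_real (singular_values T j) *\<^sub>C f j"] by (rule sums_unique2)
  qed
  have "singular_values T k = norm (T (e k))" for k
    using s0[of k] orthonormal_seq_norm[OF ef(2)] by (simp add: Te)
  with that ef s s0 Te show thesis by blast
qed

section \<open>Compactness and Schatten criteria along orthonormal sequences\<close>

lemma compact_bounded_combinations:
  fixes w :: "nat \<Rightarrow> 'a::euclidean_space l2"
  shows "compact {(\<Sum>k<n. c k *\<^sub>C w k) | c. \<forall>k<n. cmod (c k) \<le> 1}"
proof (induction n)
  case (Suc n)
  let ?K = "\<lambda>n. {(\<Sum>k<n. c k *\<^sub>C w k) | c. \<forall>k<n. cmod (c k) \<le> 1}"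
  have lin: "bounded_linear (\<lambda>c. c *\<^sub>C w n)"
    by (rule bounded_linear_intro[where K="norm (w n)"])
      (simp_all add: scaleC_add_left scaleR_eq_scaleC scaleR_conv_of_real)
  have "compact ((\<lambda>(x, c). x + c *\<^sub>C w n) ` (?K n \<times> cball 0 1))"
    by (intro compact_continuous_image compact_Times Suc compact_cball)
      (auto simp: case_prod_beta intro!: continuous_intros bounded_linear.continuous_on[OF lin])
  moreover have "?K (Suc n) = (\<lambda>(x, c). x + c *\<^sub>C w n) ` (?K n \<times> cball 0 1)"
  proof (intro equalityI subsetI)
    fix x assume "x \<in> ?K (Suc n)"
    then obtain c where "x = (\<Sum>k<Suc n. c k *\<^sub>C w k)" "\<forall>k<Suc n. cmod (c k) \<le> 1" by blast
    then show "x \<in> (\<lambda>(x, c). x + c *\<^sub>C w n) ` (?K n \<times> cball 0 1)"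
      by (intro image_eqI[of _ _ "(\<Sum>k<n. c k *\<^sub>C w k, c n)"]) auto
  next
    fix x assume "x \<in> (\<lambda>(x, c). x + c *\<^sub>C w n) ` (?K n \<times> cball 0 1)"
    then obtain c d where "x = (\<Sum>k<n. c k *\<^sub>C w k) + d *\<^sub>C w n" "\<forall>k<n. cmod (c k) \<le> 1" "cmod d \<le> 1" by auto
    then show "x \<in> ?K (Suc n)"
      by (auto intro!: exI[of _ "\<lambda>k. if k < n then c k else d"])
  qed
  ultimately show ?case by simp
qed simp

text \<open>The greedy construction again, now with vectors that reach the supremum only up to the
  factor 2, because attainment would presuppose compactness. As \<open>T (e n)\<close> tends to 0,
  finite-rank approximation is uniform on the unit ball, and its image is totally bounded.\<close>

lemma compact_opsI_orthonormal:
  fixes T :: "'a::euclidean_space l2 \<Rightarrow> 'a l2"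
  assumes Tb: "T \<in> bounded_ops" and lim: "\<And>e. orthonormal_seq e \<Longrightarrow> (\<lambda>k. T (e k)) \<longlonglongrightarrow> 0"
  shows "T \<in> compact_ops"
proof -
  let ?P = "\<lambda>f (n::nat) v. norm v = 1 \<and> (\<forall>k<n. cinner v (f k) = 0) \<and>
    (\<forall>h. (\<forall>k<n. cinner h (f k) = 0) \<longrightarrow> norm (T h) \<le> 2 * norm (T v) * norm h)"
  have "\<exists>f. \<forall>n. ?P f n (f n)"
  proof (rule dependent_wellorder_choice[where P="?P"])
    fix n :: nat and f assume "\<And>y. y < n \<Longrightarrow> ?P f y (f y)"
    then have e: "orthonormal_on {..<n} f" by (intro orthonormal_on_lessThanI) blast
    define U where "U = {h. (\<forall>k<n. cinner h (f k) = 0) \<and> norm h = 1}"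
    obtain \<sigma> where "0 \<le> \<sigma>" and M_le: "\<And>h. (\<forall>k<n. cinner h (f k) = 0) \<Longrightarrow> norm (T h) \<le> \<sigma> * norm h"
      and near: "\<And>r. r < \<sigma> \<Longrightarrow> \<exists>h\<in>U. r < norm (T h)" and ne: "U \<noteq> {}"
      by (rule norm_on_complement_sup[OF Tb e]) (auto simp: U_def)
    have "\<exists>v\<in>U. \<sigma> \<le> 2 * norm (T v)"
    proof (cases "\<sigma> = 0")
      case True
      with ne show ?thesis by auto
    next
      case False
      then show ?thesis using near[of "\<sigma> / 2"] \<open>0 \<le> \<sigma>\<close> by (force intro: less_imp_le)
    qed
    then obtain v where v: "v \<in> U" "\<sigma> \<le> 2 * norm (T v)" by blast
    have "norm (T h) \<le> 2 * norm (T v) * norm h" if "\<forall>k<n. cinner h (f k) = 0" for h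
      using order_trans[OF M_le[OF that] mult_right_mono[OF v(2) norm_ge_zero]] .
    then show "\<exists>v. ?P f n v" using v(1) by (intro exI[of _ v]) (auto simp: U_def)
  qed auto
  then obtain e where e: "\<And>n. ?P e n (e n)" by blast
  have eo: "orthonormal_seq e"
    by (rule orthonormal_seqI) (use e in blast)
  have approx: "norm (T h - (\<Sum>k<n. cinner h (e k) *\<^sub>C T (e k))) \<le> 2 * norm (T (e n))" if h: "norm h \<le> 1" for h n
  proof -
    let ?p = "h - (\<Sum>k<n. cinner h (e k) *\<^sub>C e k)"
    have "cinner ?p (e k) = 0" if "k < n" for k
      using that by (intro projection_orthogonal orthonormal_seq_imp_on[OF eo]) auto
    then have "norm (T ?p) \<le> 2 * norm (T (e n)) * norm ?p" using e by blast
    also have "\<dots> \<le> 2 * norm (T (e n)) * 1"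
      by (intro mult_left_mono order_trans[OF norm_minus_projection_le h] orthonormal_seq_imp_on[OF eo]) auto
    finally show ?thesis by (simp add: bounded_ops_diff[OF Tb] bounded_ops_sum[OF Tb] bounded_ops_scale[OF Tb])
  qed
  have "\<exists>F. finite F \<and> closure (T ` cball 0 1) \<subseteq> (\<Union>x\<in>F. ball x \<epsilon>)" if \<epsilon>: "\<epsilon> > 0" for \<epsilon>
  proof -
    have "(\<lambda>n. 2 * norm (T (e n))) \<longlonglongrightarrow> 0"
      using lim[OF eo] by (intro tendsto_mult_right_zero tendsto_norm_zero)
    from order_tendstoD(2)[OF this, of "\<epsilon> / 4"] \<epsilon>
    have "\<forall>\<^sub>F n in sequentially. 2 * norm (T (e n)) < \<epsilon> / 4" by simp
    then obtain n where n: "2 * norm (T (e n)) < \<epsilon> / 4"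
      by (auto simp: eventually_sequentially)
    let ?K = "{(\<Sum>k<n. c k *\<^sub>C T (e k)) | c. \<forall>k<n. cmod (c k) \<le> 1}"
    have "\<forall>\<epsilon>>0. \<exists>k. finite k \<and> ?K \<subseteq> (\<Union>x\<in>k. ball x \<epsilon>)"
      using compact_bounded_combinations[of "\<lambda>k. T (e k)" n] unfolding compact_eq_totally_bounded by blast
    then obtain F where F: "finite F" "?K \<subseteq> (\<Union>x\<in>F. ball x (\<epsilon> / 4))"
      using \<epsilon> by (meson divide_pos_pos zero_less_numeral)
    have "closure (T ` cball 0 1) \<subseteq> (\<Union>x\<in>F. ball x \<epsilon>)"
    proof
      fix y assume "y \<in> closure (T ` cball 0 1)"
      then obtain h where h: "norm h \<le> 1" "dist (T h) y < \<epsilon> / 4"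
        using \<epsilon> unfolding closure_approachable by (metis (no_types, lifting) divide_pos_pos imageE mem_cball_0 zero_less_numeral)
      let ?z = "\<Sum>k<n. cinner h (e k) *\<^sub>C T (e k)"
      have "cmod (cinner h (e k)) \<le> 1" for k
        using order_trans[OF l2_Cauchy_Schwarz[of h "e k"]] h(1) orthonormal_seq_norm[OF eo] by simp
      then have "?z \<in> ?K" by (intro CollectI exI[of _ "\<lambda>k. cinner h (e k)"]) simp
      with F obtain x where x: "x \<in> F" "dist x ?z < \<epsilon> / 4" by auto
      have "dist ?z (T h) < \<epsilon> / 4" using approx[OF h(1), of n] n by (simp add: dist_norm norm_minus_commute)
      then have "dist x y < \<epsilon>"
        using x(2) h(2) dist_triangle[of x y ?z] dist_triangle[of ?z y "T h"] \<epsilon> by linarith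
      with x(1) show "y \<in> (\<Union>x\<in>F. ball x \<epsilon>)" by auto
    qed
    with F show ?thesis by blast
  qed
  moreover have "uniform_space_class.complete (closure (T ` cball 0 1))" by (simp add: complete_eq_closed)
  ultimately show ?thesis using Tb by (simp add: compact_ops_def compact_eq_totally_bounded)
qed

text \<open>All orthonormal sequences are quantified over because singular vectors are available
  only for compact operators: summability first forces compactness and is then read along the
  singular vectors.\<close>

lemma schattenI:
  fixes T :: "'a::euclidean_space l2 \<Rightarrow> 'a l2"
  assumes Tb: "T \<in> bounded_ops" and q: "0 < q"
    and sm: "\<And>e. orthonormal_seq e \<Longrightarrow> summable (\<lambda>k. norm (T (e k)) powr q)"
  shows "T \<in> schatten (ennreal q)"
proof -
  have "(\<lambda>k. T (e k)) \<longlonglongrightarrow> 0" if "orthonormal_seq e" for e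
  proof -
    have "(\<lambda>k. (norm (T (e k)) powr q) powr (1 / q)) \<longlonglongrightarrow> 0 powr (1 / q)"
      using q by (intro tendsto_powr' summable_LIMSEQ_zero[OF sm[OF that]] tendsto_const) auto
    then show ?thesis using q by (simp add: powr_powr tendsto_norm_zero_iff)
  qed
  then have Tc: "T \<in> compact_ops" by (rule compact_opsI_orthonormal[OF Tb])
  obtain e where "orthonormal_seq e" "\<And>k. singular_values T k = norm (T (e k))"
    by (rule compact_op_svd[OF Tc]) blast
  with sm[of e] Tc q show ?thesis by (simp add: schatten_def)
qed

text \<open>The weights \<open>w j k\<close> have row and column sums at most 1, both by Bessel's
  inequality. Jensen with exponent \<open>q / 2\<close> acts along the rows, which is where
  \<open>2 \<le> q\<close> enters; the columns control the sum over \<open>j\<close>.\<close>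

lemma orthonormal_image_powr_sum:
  fixes T :: "'a::euclidean_space l2 \<Rightarrow> 'a l2"
  assumes e: "orthonormal_seq e" and f: "orthonormal_seq f"
    and T: "\<And>h. svd_terms s e f h sums T h"
    and s: "\<And>k. 0 \<le> s k" "summable (\<lambda>k. s k powr q)" and q: "2 \<le> q" and g: "orthonormal_seq g"
  shows "summable (\<lambda>j. norm (T (g j)) powr q)" "(\<Sum>j. norm (T (g j)) powr q) \<le> (\<Sum>k. s k powr q)"
proof -
  define w where "w j k = (cmod (cinner (g j) (e k)))\<^sup>2" for j k
  have w_summable: "summable (w j)" and w_le: "(\<Sum>k. w j k) \<le> 1" for j
    using bessel_seq[OF e, of "g j"] orthonormal_seq_norm[OF g] by (simp_all add: w_def[abs_def])
  have w0: "0 \<le> w j k" for j k by (simp add: w_def)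
  have w1: "w j k \<le> 1" for j k
  proof -
    have "cmod (cinner (g j) (e k)) \<le> 1"
      using l2_Cauchy_Schwarz[of "g j" "e k"] orthonormal_seq_norm[OF g] orthonormal_seq_norm[OF e] by simp
    then show ?thesis by (simp add: w_def power_le_one)
  qed
  have sq: "((s k)\<^sup>2) powr (q / 2) = s k powr q" for k
    using s(1)[of k] by (simp flip: powr_numeral add: powr_powr)
  have sw: "summable (\<lambda>k. s k powr q * w j k)" for j
    by (rule summable_comparison_test'[OF s(2), of 0]) (simp add: w0 w1 mult_left_le)
  have J: "summable (\<lambda>k. (s k)\<^sup>2 * w j k)" "(\<Sum>k. (s k)\<^sup>2 * w j k) powr (q / 2) \<le> (\<Sum>k. s k powr q * w j k)" for j
    using weighted_powr_jensen_suminf[of "q / 2" 1 "w j" "\<lambda>k. (s k)\<^sup>2"] q w_summable[of j] w_le[of j] w0 sw[of j]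
    by (simp_all add: sq)
  have normT: "norm (T (g j)) powr q \<le> (\<Sum>k. s k powr q * w j k)" for j
  proof -
    have eq: "(\<lambda>k. (cmod (of_real (s k) * cinner (g j) (e k)))\<^sup>2) = (\<lambda>k. (s k)\<^sup>2 * w j k)"
      by (auto simp: w_def norm_mult power_mult_distrib)
    have "(norm (T (g j)))\<^sup>2 = (\<Sum>k. (s k)\<^sup>2 * w j k)"
      using orthonormal_series(2)[OF f, of "\<lambda>k. of_real (s k) * cinner (g j) (e k)"] J(1)[of j] sums_unique[OF T[of "g j"]]
      unfolding eq by simp
    moreover have "norm (T (g j)) powr q = ((norm (T (g j)))\<^sup>2) powr (q / 2)"
      by (simp flip: powr_numeral add: powr_powr)
    ultimately show ?thesis using J(2)[of j] by simp
  qed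
  have bound: "(\<Sum>j<n. norm (T (g j)) powr q) \<le> (\<Sum>k. s k powr q)" for n
  proof -
    have "(\<Sum>j<n. norm (T (g j)) powr q) \<le> (\<Sum>j<n. \<Sum>k. s k powr q * w j k)"
      by (intro sum_mono normT)
    also have "\<dots> = (\<Sum>k. \<Sum>j<n. s k powr q * w j k)"
      by (rule suminf_sum[symmetric]) (rule sw)
    also have "\<dots> \<le> (\<Sum>k. s k powr q)"
    proof (rule suminf_le)
      fix k
      have "(\<Sum>j<n. w j k) = (\<Sum>j<n. (cmod (cinner (e k) (g j)))\<^sup>2)"
        by (simp add: w_def cinner_commute[of "g _" "e k"])
      also have "\<dots> \<le> 1"
        using bessel[OF _ orthonormal_seq_imp_on[OF g], of "{..<n}" "e k"] orthonormal_seq_norm[OF e] by simp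
      finally show "(\<Sum>j<n. s k powr q * w j k) \<le> s k powr q"
        by (simp add: sum_distrib_left[symmetric] mult_left_le)
    qed (auto intro: summable_sum sw s)
    finally show ?thesis .
  qed
  show sm: "summable (\<lambda>j. norm (T (g j)) powr q)"
    by (rule summableI_nonneg_bounded[OF _ bound]) simp
  show "(\<Sum>j. norm (T (g j)) powr q) \<le> (\<Sum>k. s k powr q)"
    by (rule suminf_le_const[OF sm bound])
qed

lemma powr_summable_mono:
  fixes s :: "nat \<Rightarrow> real"
  assumes s: "s \<longlonglongrightarrow> 0" "\<And>k. 0 \<le> s k" "summable (\<lambda>k. s k powr p)" and pq: "p \<le> q"
  shows "summable (\<lambda>k. s k powr q)"
proof -
  have "\<forall>\<^sub>F k in sequentially. s k < 1" using s(1) by (rule order_tendstoD) simp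
  then obtain N where N: "\<And>k. k \<ge> N \<Longrightarrow> s k < 1" by (auto simp: eventually_sequentially)
  show ?thesis
  proof (rule summable_comparison_test'[OF s(3), of N])
    fix k assume "k \<ge> N"
    then show "norm (s k powr q) \<le> s k powr p"
      using N[of k] s(2)[of k] pq by (cases "s k = 0") (auto intro: powr_mono')
  qed
qed

section \<open>Plancherel's theorem, Moyal's identity and Hilbert--Schmidt operators\<close>

text \<open>Orthogonality to every modulation of \<open>m\<close> says that the Fourier transform of
  an integrable function, the product of \<open>h\<close> with the conjugate of \<open>m\<close>,
  vanishes. The cases of interest are a Gaussian, the ambiguity function of a Gaussian, and a
  Gaussian times a short-time Fourier transform.\<close>

lemma l2_exponentials_total:
  fixes h :: "'a::euclidean_space l2"
  assumes m: "m \<in> Lp 2" "AE x in lborel. m x \<noteq> 0"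
    and orth: "\<And>u. cinner h (abs_l2 (\<lambda>x. m x * echar u x)) = 0"
  shows "h = 0"
proof -
  have [measurable]: "m \<in> borel_measurable borel" using m by (simp add: Lp_2_iff)
  have me: "(\<lambda>x. m x * echar u x) \<in> Lp 2" for u
    using m(1) by (simp add: Lp_2_iff norm_mult)
  have "ft (\<lambda>x. rep_l2 h x * cnj (m x)) u = 0" for u
  proof -
    have "0 = cinner (abs_l2 (rep_l2 h)) (abs_l2 (\<lambda>x. m x * echar (- u) x))" using orth by simp
    also have "\<dots> = ft (\<lambda>x. rep_l2 h x * cnj (m x)) u"
      unfolding cinner_abs[OF rep_l2_Lp me] by (simp add: ft_def mult.assoc)
    finally show ?thesis by simp
  qed
  then have "AE x in lborel. rep_l2 h x * cnj (m x) = 0"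
    by (intro ft_eq_zero_imp_AE_zero[OF Lp_2_integrable_mult[OF rep_l2_Lp m(1)]] AE_I2)
  then have "AE x in lborel. rep_l2 h x = rep_l2 (0::'a l2) x"
    using m(2) rep_abs_l2[OF Lp_2_zero, where 'a='a] unfolding zero_l2.abs_eq[symmetric]
    by eventually_elim auto
  then show ?thesis by (rule l2_eqI)
qed

lemma gauss_Lp_2: "(\<lambda>x. complex_of_real (gauss x)) \<in> Lp 2"
proof -
  have "integrable lborel (\<lambda>x. (gauss (x::'a))\<^sup>2)"
  proof (rule Bochner_Integration.integrable_bound[OF integrable_gauss])
    show "AE x in lborel. norm ((gauss (x::'a))\<^sup>2) \<le> norm (gauss x)"
      by (simp add: power2_eq_square mult_left_le)
  qed measurable
  then show ?thesis by (simp add: Lp_2_iff)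
qed

lemma ft_add: "integrable lborel h \<Longrightarrow> integrable lborel k \<Longrightarrow> ft (\<lambda>t. h t + k t) u = ft h u + ft k u"
  by (simp add: ft_def distrib_right)

lemma ft_scale: "ft (\<lambda>t. c * h t) u = c * ft h u"
  by (simp add: ft_def mult.assoc)

lemma ft_Lp_2: "integrable lborel h \<Longrightarrow> h \<in> Lp 2 \<Longrightarrow> ft h \<in> Lp 2"
  using ft_contraction[of h] by (auto simp: Lp_2_iff_nn intro: le_less_trans)

text \<open>The defect \<open>\<parallel>h\<parallel>\<^sup>2 - \<parallel>ft h\<parallel>\<^sup>2\<close> is a non-negative quadratic form that vanishes on modulated
  Gaussians, and hence on a dense subspace.\<close>

definition plancherel_defect :: "('a::euclidean_space \<Rightarrow> complex) \<Rightarrow> real" where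
  "plancherel_defect h = (norm (abs_l2 h))\<^sup>2 - (norm (abs_l2 (ft h)))\<^sup>2"

lemma
  assumes "integrable lborel h" "h \<in> Lp 2"
  shows plancherel_defect_nonneg: "0 \<le> plancherel_defect h"
    and plancherel_defect_le: "plancherel_defect h \<le> (norm (abs_l2 h))\<^sup>2"
proof -
  have "ennreal ((norm (abs_l2 (ft h)))\<^sup>2) \<le> ennreal ((norm (abs_l2 h))\<^sup>2)"
    unfolding norm_abs_l2[OF assms(2)] norm_abs_l2[OF ft_Lp_2[OF assms]] by (rule ft_contraction[OF assms(1)])
  then show "0 \<le> plancherel_defect h" by (simp add: plancherel_defect_def)
qed (simp add: plancherel_defect_def)

text \<open>The defect obeys the parallelogram law, and the defect of the difference of
  \<open>h\<close> and \<open>k\<close> is non-negative.\<close>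

lemma plancherel_defect_add_le:
  assumes h: "integrable lborel h" "h \<in> Lp 2" and k: "integrable lborel k" "k \<in> Lp 2"
  shows "plancherel_defect (\<lambda>t. h t + k t) \<le> 2 * plancherel_defect h + 2 * plancherel_defect k"
proof -
  let ?m = "\<lambda>t. - 1 * k t"
  have m: "integrable lborel ?m" "?m \<in> Lp 2"
    using k(1) Lp_2_scale[OF k(2), of "- 1"] by simp_all
  have "ft (\<lambda>t. h t + k t) = (\<lambda>u. ft h u + ft k u)" "ft (\<lambda>t. h t + ?m t) = (\<lambda>u. ft h u + ft ?m u)"
    "ft ?m = (\<lambda>u. - 1 * ft k u)"
    using ft_add[OF h(1) k(1)] ft_add[OF h(1) m(1)] ft_scale[of "- 1" k] by blast+
  note ft_eq = this
  note A = abs_l2_add[OF h(2) k(2), symmetric] abs_l2_add[OF h(2) m(2), symmetric] abs_l2_scale[OF k(2), of "- 1", symmetric]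
    abs_l2_add[OF ft_Lp_2[OF h] ft_Lp_2[OF k], symmetric] abs_l2_add[OF ft_Lp_2[OF h] ft_Lp_2[OF m], symmetric]
    abs_l2_scale[OF ft_Lp_2[OF k], of "- 1", symmetric]
  have par: "(norm (x + y))\<^sup>2 + (norm (x + (- 1) *\<^sub>C y))\<^sup>2 = 2 * (norm x)\<^sup>2 + 2 * (norm y)\<^sup>2" for x y :: "'b::euclidean_space l2"
    unfolding scaleC_minus scaleC_one power2_norm_eq_inner by (simp add: inner_simps inner_commute)
  have "plancherel_defect (\<lambda>t. h t + k t) + plancherel_defect (\<lambda>t. h t + ?m t) = 2 * plancherel_defect h + 2 * plancherel_defect k"
    using par[of "abs_l2 h" "abs_l2 k"] par[of "abs_l2 (ft h)" "abs_l2 (ft k)"] A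
    unfolding plancherel_defect_def ft_eq by (simp only: A) (simp add: algebra_simps)
  moreover have "0 \<le> plancherel_defect (\<lambda>t. h t + ?m t)"
    by (rule plancherel_defect_nonneg[OF Bochner_Integration.integrable_add[OF h(1) m(1)] Lp_2_add[OF h(2) m(2)]])
  ultimately show ?thesis by linarith
qed

lemma plancherel_defect_gauss:
  fixes u :: "'a::euclidean_space"
  defines "h \<equiv> \<lambda>t. complex_of_real (gauss t) * echar u t"
  shows "integrable lborel h" "h \<in> Lp 2" "plancherel_defect h = 0"
proof -
  show i: "integrable lborel h" unfolding h_def by (intro integrable_mult_echar integrable_of_real integrable_gauss)
  show L: "h \<in> Lp 2" using gauss_Lp_2[where 'a='a] by (simp add: Lp_2_iff h_def norm_mult)
  have "ft h v = of_real (gauss (u + v))" for v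
    by (subst integral_gauss_echar[symmetric]) (simp add: ft_def h_def echar_add mult.assoc echar_commute[of v])
  then have "ennreal ((norm (abs_l2 (ft h)))\<^sup>2) = (\<integral>\<^sup>+v. (gauss (u + v))\<^sup>2 \<partial>lborel)"
    unfolding norm_abs_l2[OF ft_Lp_2[OF i L]] by simp
  also have "\<dots> = (\<integral>\<^sup>+v. (gauss (v::'a))\<^sup>2 \<partial>lborel)"
    using lborel_nn_integral_affine[of 1 "\<lambda>v::'a. ennreal ((gauss v)\<^sup>2)" u] by simp
  also have "\<dots> = ennreal ((norm (abs_l2 h))\<^sup>2)"
    unfolding norm_abs_l2[OF L] by (simp add: h_def norm_mult)
  finally show "plancherel_defect h = 0" by (simp add: plancherel_defect_def)
qed

theorem plancherel:
  fixes h :: "'a::euclidean_space \<Rightarrow> complex"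
  assumes h: "integrable lborel h" "h \<in> Lp 2"
  shows "(\<integral>\<^sup>+u. (cmod (ft h u))\<^sup>2 \<partial>lborel) = (\<integral>\<^sup>+t. (cmod (h t))\<^sup>2 \<partial>lborel)"
proof -
  define S where "S = {abs_l2 k | k :: 'a \<Rightarrow> complex. integrable lborel k \<and> k \<in> Lp 2 \<and> plancherel_defect k = 0}"
  have scale: "c *\<^sub>C f \<in> S" if f: "f \<in> S" for c f
  proof -
    obtain k where k: "f = abs_l2 k" "integrable lborel k" "k \<in> Lp 2" "plancherel_defect k = 0"
      using f by (auto simp: S_def)
    have "ft (\<lambda>t. c * k t) = (\<lambda>u. c * ft k u)" using ft_scale[of c k] by blast
    then have "plancherel_defect (\<lambda>t. c * k t) = (cmod c)\<^sup>2 * plancherel_defect k"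
      by (simp add: plancherel_defect_def abs_l2_scale[OF k(3), symmetric] abs_l2_scale[OF ft_Lp_2[OF k(2,3)], symmetric]
          power_mult_distrib algebra_simps)
    then show ?thesis
      using k Lp_2_scale[OF k(3), of c] unfolding S_def
      by (intro CollectI exI[of _ "\<lambda>t. c * k t"]) (simp add: abs_l2_scale)
  qed
  have dense: "\<exists>g\<in>S. norm (abs_l2 h - g) < e" if "e > 0" for e
  proof (rule l2_dense_subspace[OF _ scale _ _ that])
    show "f + g \<in> S" if fg: "f \<in> S" "g \<in> S" for f g
    proof -
      obtain k where k: "f = abs_l2 k" "integrable lborel k" "k \<in> Lp 2" "plancherel_defect k = 0"
        using fg unfolding S_def by blast
      obtain l where l: "g = abs_l2 l" "integrable lborel l" "l \<in> Lp 2" "plancherel_defect l = 0"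
        using fg unfolding S_def by blast
      have i: "integrable lborel (\<lambda>t. k t + l t)" "(\<lambda>t. k t + l t) \<in> Lp 2"
        using k l by (auto intro: Lp_2_add)
      have "plancherel_defect (\<lambda>t. k t + l t) = 0"
        using plancherel_defect_add_le[OF k(2,3) l(2,3)] plancherel_defect_nonneg[OF i] k l by simp
      then show ?thesis using i k l unfolding S_def
        by (intro CollectI exI[of _ "\<lambda>t. k t + l t"]) (simp add: abs_l2_add)
    qed
    have gS: "abs_l2 (\<lambda>t. complex_of_real (gauss t) * echar u t) \<in> S" for u
      using plancherel_defect_gauss[of u] unfolding S_def by blast
    show "0 \<in> S" using scale[OF gS, of 0] by simp
    show "f = 0" if "\<And>g. g \<in> S \<Longrightarrow> cinner f g = 0" for f
      by (rule l2_exponentials_total[OF gauss_Lp_2]) (simp_all add: that gS)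
  qed
  \<comment> \<open>For \<open>k\<close> in the dense subspace the defect of \<open>h\<close> is at
    most twice that of the difference, hence at most twice the squared distance; this is the origin
    of \<open>sqrt (e / 2)\<close>.\<close>
  have "plancherel_defect h \<le> 0 + e" if e: "e > 0" for e
  proof -
    have "sqrt (e / 2) > 0" using e by simp
    from dense[OF this] obtain k where k: "integrable lborel k" "k \<in> Lp 2" "plancherel_defect k = 0"
      and hk: "norm (abs_l2 h - abs_l2 k) < sqrt (e / 2)"
      unfolding S_def by blast
    have m: "integrable lborel (\<lambda>t. h t + - 1 * k t)" "(\<lambda>t. h t + - 1 * k t) \<in> Lp 2"
      using h k Lp_2_add[OF h(2) Lp_2_scale[OF k(2), of "- 1"]] by simp_all
    have eq: "abs_l2 (\<lambda>t. h t + - 1 * k t) = abs_l2 h - abs_l2 k"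
      using h(2) k(2) Lp_2_scale[OF k(2), of "- 1"]
      by (simp only: abs_l2_add[symmetric] abs_l2_scale[symmetric]) simp
    have "plancherel_defect h = plancherel_defect (\<lambda>t. (h t + - 1 * k t) + k t)" by simp
    also have "\<dots> \<le> 2 * plancherel_defect (\<lambda>t. h t + - 1 * k t) + 2 * plancherel_defect k"
      by (rule plancherel_defect_add_le[OF m k(1,2)])
    also have "\<dots> \<le> 2 * (norm (abs_l2 h - abs_l2 k))\<^sup>2"
      using plancherel_defect_le[OF m] k(3) unfolding eq by simp
    also have "\<dots> \<le> 2 * (sqrt (e / 2))\<^sup>2"
      using hk by (intro mult_left_mono power_mono) auto
    finally show ?thesis using e by simp
  qed
  then have "plancherel_defect h \<le> 0" by (rule field_le_epsilon)
  with plancherel_defect_nonneg[OF h] have "(norm (abs_l2 (ft h)))\<^sup>2 = (norm (abs_l2 h))\<^sup>2"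
    by (simp add: plancherel_defect_def)
  then show ?thesis
    unfolding norm_abs_l2[OF h(2), symmetric] norm_abs_l2[OF ft_Lp_2[OF h], symmetric] by simp
qed

section \<open>Time-frequency shifts and the short-time Fourier transform\<close>

lemma shift_Lp_2: "f \<in> Lp 2 \<Longrightarrow> (\<lambda>t. echar \<xi> t * f (t - x)) \<in> Lp 2"
  using Lp_2_shift[of f \<xi> x] by (simp add: echar_def)

lemma tf_shift_abs: "f \<in> Lp 2 \<Longrightarrow> tf_shift (x, \<xi>) (abs_l2 f) = abs_l2 (\<lambda>t. echar \<xi> t * f (t - x))"
  by (simp add: tf_shift.abs_eq l2_rel_def echar_def)

lemma tf_shift_rep: "tf_shift (x, \<xi>) f = abs_l2 (\<lambda>t. echar \<xi> t * rep_l2 f (t - x))"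
  using tf_shift_abs[OF rep_l2_Lp[of f]] by simp

lemma tf_shift_add: "tf_shift z (f + g) = tf_shift z f + tf_shift z g"
proof (cases z)
  case (Pair x \<xi>)
  have "tf_shift (x, \<xi>) (abs_l2 (rep_l2 f) + abs_l2 (rep_l2 g)) = tf_shift (x, \<xi>) (abs_l2 (rep_l2 f)) + tf_shift (x, \<xi>) (abs_l2 (rep_l2 g))"
    by (simp only: abs_l2_add tf_shift_abs rep_l2_Lp Lp_2_add shift_Lp_2 distrib_left)
  then show ?thesis by (simp add: Pair)
qed

lemma tf_shift_scaleC [simp]: "tf_shift z (c *\<^sub>C f) = c *\<^sub>C tf_shift z f"
proof (cases z)
  case (Pair x \<xi>)
  have "tf_shift (x, \<xi>) (c *\<^sub>C abs_l2 (rep_l2 f)) = c *\<^sub>C tf_shift (x, \<xi>) (abs_l2 (rep_l2 f))"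
    by (simp only: abs_l2_scale tf_shift_abs rep_l2_Lp Lp_2_scale shift_Lp_2 mult.left_commute)
  then show ?thesis by (simp add: Pair)
qed

lemma cinner_tf_shift [simp]: "cinner (tf_shift z f) (tf_shift z g) = cinner f g"
proof (cases z)
  case (Pair x \<xi>)
  have "cinner (tf_shift z f) (tf_shift z g) = (LINT t|lborel. rep_l2 f (t - x) * cnj (rep_l2 g (t - x)))"
    unfolding Pair tf_shift_rep cinner_abs[OF shift_Lp_2[OF rep_l2_Lp] shift_Lp_2[OF rep_l2_Lp]]
    by (intro Bochner_Integration.integral_cong) (simp_all add: mult.assoc[symmetric] mult.commute)
  also have "\<dots> = cinner f g"
    unfolding cinner_rep using lborel_integral_affine[of 1 "\<lambda>t. rep_l2 f t * cnj (rep_l2 g t)" "- x"] by simp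
  finally show ?thesis .
qed

lemma norm_tf_shift [simp]: "norm (tf_shift z f) = norm f"
  using cinner_tf_shift[of z f f] unfolding cinner_self of_real_eq_iff by (simp add: power2_eq_iff_nonneg)

lemma tf_shift_zero [simp]: "tf_shift 0 f = f"
  using tf_shift_rep[of 0 0 f] by (simp add: zero_prod_def)

lemma tf_shift_compose:
  "tf_shift (x, \<xi>) (tf_shift (y, \<eta>) f) = echar (- \<eta>) x *\<^sub>C tf_shift (x + y, \<xi> + \<eta>) f"
proof -
  have "tf_shift (x, \<xi>) (tf_shift (y, \<eta>) f) = abs_l2 (\<lambda>t. echar \<xi> t * (echar \<eta> (t - x) * rep_l2 f (t - x - y)))"
    by (simp only: tf_shift_rep[of y \<eta>] tf_shift_abs shift_Lp_2 rep_l2_Lp)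
  also have "(\<lambda>t. echar \<xi> t * (echar \<eta> (t - x) * rep_l2 f (t - x - y)))
      = (\<lambda>t. echar (- \<eta>) x * (echar (\<xi> + \<eta>) t * rep_l2 f (t - (x + y))))"
    using echar_add_right[of \<eta> _ "- x"] by (simp add: echar_add echar_minus_right algebra_simps)
  also have "abs_l2 \<dots> = echar (- \<eta>) x *\<^sub>C tf_shift (x + y, \<xi> + \<eta>) f"
    by (simp only: tf_shift_rep abs_l2_scale shift_Lp_2 rep_l2_Lp)
  finally show ?thesis .
qed

text \<open>The symplectic rotation: \<open>sympJ z \<bullet> w\<close> is the symplectic form,
  which governs the phase lost when two time-frequency shifts are exchanged.\<close>

definition sympJ :: "'a::euclidean_space \<times> 'a \<Rightarrow> 'a \<times> 'a" where
  "sympJ = (\<lambda>(x, \<xi>). (\<xi>, - x))"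

lemma symp_symp [simp]: "sympJ (sympJ z) = - z"
  by (cases z) (simp add: sympJ_def)

lemma linear_symp: "linear sympJ"
  by (rule linearI) (auto simp: sympJ_def split: prod.splits)

lemma norm_symp [simp]: "norm (sympJ z) = norm z"
  by (cases z) (simp add: sympJ_def norm_prod_def add.commute)

lemma inner_symp_left: "sympJ z \<bullet> w = - (z \<bullet> sympJ w)"
  by (cases z; cases w) (simp add: sympJ_def inner_commute)

text \<open>Moving the shift by \<open>w\<close> past the shift by \<open>z\<close> costs only a
  phase, and the common shift by \<open>z\<close> then cancels by unitarity. This covariance is what
  turns Berezin transforms into Fourier transforms.\<close>

lemma stft_tf_shift: "stft (tf_shift z g) (tf_shift z f) w = echar (sympJ z) w * stft g f w"
proof (cases z; cases w)
  fix x \<xi> y \<eta> assume z: "z = (x, \<xi>)" and w: "w = (y, \<eta>)"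
  have "tf_shift w (tf_shift z g) = (echar (- \<xi>) y * echar \<eta> x) *\<^sub>C tf_shift z (tf_shift w g)"
    unfolding z w tf_shift_compose by (simp add: mult.assoc add.commute)
  then have "stft (tf_shift z g) (tf_shift z f) w = cnj (echar (- \<xi>) y * echar \<eta> x) * stft g f w"
    by (simp add: stft_def)
  moreover have "cnj (echar (- \<xi>) y * echar \<eta> x) = echar (sympJ z) w"
    by (simp add: z w sympJ_def echar_cis cis_mult cis_cnj ring_distribs inner_commute)
  ultimately show ?thesis by simp
qed

text \<open>The shift by \<open>- w\<close> inverts the shift by \<open>w\<close> up to a phase. The
  identity transfers non-vanishing from one order of the two windows to the other.\<close>

lemma norm_stft_minus: "cmod (stft f g (- w)) = cmod (stft g f w)"
proof (cases w)
  case (Pair y \<eta>)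
  have "stft f g (- w) = cinner (tf_shift w g) (tf_shift w (tf_shift (- w) f))" by (simp add: stft_def)
  also have "tf_shift w (tf_shift (- w) f) = echar \<eta> y *\<^sub>C f"
    using tf_shift_compose[of y \<eta> "- y" "- \<eta>" f] by (simp add: Pair flip: zero_prod_def)
  finally have "cmod (stft f g (- w)) = cmod (cinner (tf_shift w g) f)" by (simp add: norm_mult)
  also have "\<dots> = cmod (stft g f w)"
    unfolding stft_def by (subst cinner_commute) simp
  finally show ?thesis .
qed

lemma norm_stft_le: "cmod (stft g f z) \<le> norm f * norm g"
  using l2_Cauchy_Schwarz[of f "tf_shift z g"] by (simp add: stft_def)

lemma stft_eq_ft: "stft g f (x, \<xi>) = ft (\<lambda>t. rep_l2 f t * cnj (rep_l2 g (t - x))) (- \<xi>)"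
proof -
  have "stft g f (x, \<xi>) = cinner (abs_l2 (rep_l2 f)) (abs_l2 (\<lambda>t. echar \<xi> t * rep_l2 g (t - x)))"
    by (simp add: stft_def tf_shift_rep)
  also have "\<dots> = (LINT t|lborel. rep_l2 f t * cnj (echar \<xi> t * rep_l2 g (t - x)))"
    by (rule cinner_abs[OF rep_l2_Lp shift_Lp_2[OF rep_l2_Lp]])
  finally show ?thesis by (simp add: ft_def mult_ac)
qed

lemma borel_measurable_stft [measurable]: "stft g f \<in> borel_measurable borel"
proof -
  have "(\<lambda>z. LINT t|lborel. rep_l2 f t * cnj (rep_l2 g (t - fst z)) * echar (- snd z) t) \<in> borel_measurable (borel \<Otimes>\<^sub>M borel)"
    by (rule lborel.borel_measurable_lebesgue_integral) measurable
  moreover have "(\<lambda>z. LINT t|lborel. rep_l2 f t * cnj (rep_l2 g (t - fst z)) * echar (- snd z) t) = stft g f"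
    by (auto simp: stft_eq_ft ft_def)
  ultimately show ?thesis by (simp add: borel_prod)
qed

text \<open>Plancherel in the frequency variable on each slice \<open>h x\<close>. A product of two
  square-integrable functions is in general only integrable, so the total energy is computed first
  by Tonelli; its finiteness makes almost every slice square-integrable.\<close>

lemma nn_integral_stft: "(\<integral>\<^sup>+z. (cmod (stft g f z))\<^sup>2 \<partial>lborel) = ennreal ((norm f)\<^sup>2 * (norm g)\<^sup>2)"
proof -
  define h where "h x t = rep_l2 f t * cnj (rep_l2 g (t - x))" for x t
  have [measurable]: "case_prod h \<in> borel_measurable (borel \<Otimes>\<^sub>M borel)"
    unfolding h_def by measurable
  have hm [measurable]: "h x \<in> borel_measurable borel" for x unfolding h_def by measurable
  have hi: "integrable lborel (h x)" for x
  proof -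
    have "(\<lambda>t. rep_l2 g (t - x)) \<in> Lp 2" using shift_Lp_2[OF rep_l2_Lp[of g], of 0 x] by simp
    then show ?thesis unfolding h_def[abs_def] by (intro Lp_2_integrable_mult rep_l2_Lp)
  qed
  have total: "(\<integral>\<^sup>+x. \<integral>\<^sup>+t. (cmod (h x t))\<^sup>2 \<partial>lborel \<partial>lborel) = ennreal ((norm f)\<^sup>2 * (norm g)\<^sup>2)"
  proof -
    have "(\<integral>\<^sup>+x. \<integral>\<^sup>+t. (cmod (h x t))\<^sup>2 \<partial>lborel \<partial>lborel) = (\<integral>\<^sup>+t. \<integral>\<^sup>+x. (cmod (h x t))\<^sup>2 \<partial>lborel \<partial>lborel)"
      by (rule lborel_pair.Fubini'[symmetric]) measurable
    also have "\<dots> = (\<integral>\<^sup>+t. ennreal ((cmod (rep_l2 f t))\<^sup>2) * ennreal ((norm g)\<^sup>2) \<partial>lborel)"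
    proof (rule nn_integral_cong)
      fix t
      have "(\<integral>\<^sup>+x. (cmod (h x t))\<^sup>2 \<partial>lborel) = ennreal ((cmod (rep_l2 f t))\<^sup>2) * (\<integral>\<^sup>+x. (cmod (rep_l2 g (t - x)))\<^sup>2 \<partial>lborel)"
        by (subst nn_integral_cmult[symmetric]) (auto simp: h_def norm_mult power_mult_distrib ennreal_mult)
      also have "(\<integral>\<^sup>+x. (cmod (rep_l2 g (t - x)))\<^sup>2 \<partial>lborel) = ennreal ((norm g)\<^sup>2)"
        unfolding norm_l2_nn_integral
        using lborel_nn_integral_affine[of "- 1" "\<lambda>x. ennreal ((cmod (rep_l2 g x))\<^sup>2)" t] by simp
      finally show "(\<integral>\<^sup>+x. (cmod (h x t))\<^sup>2 \<partial>lborel) = ennreal ((cmod (rep_l2 f t))\<^sup>2) * ennreal ((norm g)\<^sup>2)" .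
    qed
    also have "\<dots> = ennreal ((norm f)\<^sup>2) * ennreal ((norm g)\<^sup>2)"
      by (simp add: nn_integral_multc norm_l2_nn_integral)
    finally show ?thesis by (simp add: ennreal_mult)
  qed
  have "AE x in lborel. (\<integral>\<^sup>+t. (cmod (h x t))\<^sup>2 \<partial>lborel) \<noteq> \<infinity>"
    by (rule nn_integral_noteq_infinite) (simp_all add: total)
  then have fin: "AE x in lborel. h x \<in> Lp 2"
    by eventually_elim (simp add: Lp_2_iff_nn less_top)
  have "(\<integral>\<^sup>+z. (cmod (stft g f z))\<^sup>2 \<partial>lborel) = (\<integral>\<^sup>+x. \<integral>\<^sup>+\<xi>. (cmod (stft g f (x, \<xi>)))\<^sup>2 \<partial>lborel \<partial>lborel)"
    unfolding lborel_prod[symmetric] by (rule lborel.nn_integral_fst[symmetric]) (simp add: lborel_prod)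
  also have "\<dots> = (\<integral>\<^sup>+x. \<integral>\<^sup>+t. (cmod (h x t))\<^sup>2 \<partial>lborel \<partial>lborel)"
  proof (rule nn_integral_cong_AE, use fin in eventually_elim)
    case (elim x)
    have "(\<integral>\<^sup>+\<xi>. (cmod (stft g f (x, \<xi>)))\<^sup>2 \<partial>lborel) = (\<integral>\<^sup>+\<xi>. (cmod (ft (h x) \<xi>))\<^sup>2 \<partial>lborel)"
      using lborel_nn_integral_affine[of "- 1" "\<lambda>\<xi>. ennreal ((cmod (ft (h x) \<xi>))\<^sup>2)" 0]
      by (simp add: stft_eq_ft h_def[abs_def])
    then show ?case using plancherel[OF hi elim] by simp
  qed
  finally show ?thesis using total by simp
qed

lemma stft_Lp_2: "stft g f \<in> Lp 2"
  by (simp add: Lp_2_iff_nn nn_integral_stft)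

text \<open>The conjugate of the short-time Fourier transform is used so that the weak form of a
  Hilbert--Schmidt operator becomes an inner product, linear in its kernel.\<close>

definition stft_conj :: "'a::euclidean_space l2 \<Rightarrow> 'a l2 \<Rightarrow> ('a \<times> 'a) l2" where
  "stft_conj g f = abs_l2 (\<lambda>w. cnj (stft g f w))"

lemma cnj_stft_Lp_2: "(\<lambda>w. cnj (stft g f w)) \<in> Lp 2"
  using stft_Lp_2[of g f] by (simp add: Lp_2_iff)

lemma stft_conj_add_left: "stft_conj (g + g') f = stft_conj g f + stft_conj g' f"
  unfolding stft_conj_def abs_l2_add[OF cnj_stft_Lp_2 cnj_stft_Lp_2]
  by (simp add: stft_def tf_shift_add cinner_add_right)

lemma stft_conj_add_right: "stft_conj g (f + f') = stft_conj g f + stft_conj g f'"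
  unfolding stft_conj_def abs_l2_add[OF cnj_stft_Lp_2 cnj_stft_Lp_2]
  by (simp add: stft_def cinner_add_left)

lemma stft_conj_scale_left [simp]: "stft_conj (c *\<^sub>C g) f = c *\<^sub>C stft_conj g f"
  unfolding stft_conj_def abs_l2_scale[OF cnj_stft_Lp_2] by (simp add: stft_def)

lemma stft_conj_scale_right [simp]: "stft_conj g (c *\<^sub>C f) = cnj c *\<^sub>C stft_conj g f"
  unfolding stft_conj_def abs_l2_scale[OF cnj_stft_Lp_2] by (simp add: stft_def)

lemma norm_stft_conj [simp]: "norm (stft_conj g f) = norm g * norm f"
proof -
  have "ennreal ((norm (stft_conj g f))\<^sup>2) = ennreal ((norm g * norm f)\<^sup>2)"
    unfolding stft_conj_def norm_abs_l2[OF cnj_stft_Lp_2]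
    by (simp add: nn_integral_stft power_mult_distrib mult.commute)
  then show ?thesis by (simp add: power2_eq_iff_nonneg)
qed

text \<open>The norm identity is polarised in \<open>g\<close> and then in \<open>f\<close>. The
  second form takes its arguments in the order \<open>f'\<close>, \<open>f\<close>, because
  \<open>stft_conj\<close> is conjugate-linear in the signal.\<close>

theorem moyal: "cinner (stft_conj g f) (stft_conj g' f') = cinner g g' * cnj (cinner f f')"
proof -
  have 1: "cinner (stft_conj g f) (stft_conj g' f) = cinner g g' * of_real ((norm f)\<^sup>2)" for g g' f
  proof -
    have "cinner (stft_conj g f) (stft_conj g' f) - cinner g g' * of_real ((norm f)\<^sup>2) = 0"
      by (rule cinner_polarization[where S="\<lambda>g g'. cinner (stft_conj g f) (stft_conj g' f) - cinner g g' * of_real ((norm f)\<^sup>2)"])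
        (simp_all add: stft_conj_add_left cinner_add_left cinner_add_right cinner_self power_mult_distrib algebra_simps)
    then show ?thesis by simp
  qed
  have "cinner (stft_conj g f) (stft_conj g' f') - cinner g g' * cinner f' f = 0"
    by (rule cinner_polarization[where S="\<lambda>f' f. cinner (stft_conj g f) (stft_conj g' f') - cinner g g' * cinner f' f"])
      (simp_all add: 1 cinner_self stft_conj_add_right cinner_add_left cinner_add_right algebra_simps)
  then show ?thesis by (simp add: cinner_commute[of f f'])
qed

section \<open>Hilbert--Schmidt operators and their kernels on phase space\<close>

lemma cinner_stft_conj: "cinner F (stft_conj g f) = (LINT w|lborel. rep_l2 F w * stft g f w)"
proof -
  have "cinner F (stft_conj g f) = cinner (abs_l2 (rep_l2 F)) (abs_l2 (\<lambda>w. cnj (stft g f w)))" by (simp add: stft_conj_def)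
  then show ?thesis unfolding cinner_abs[OF rep_l2_Lp cnj_stft_Lp_2] by simp
qed

lemma stft_conj_orthonormal:
  assumes "orthonormal_seq e" "\<And>k. norm (g k) = 1"
  shows "orthonormal_seq (\<lambda>k. stft_conj (g k) (e k))"
  using assms by (auto simp: orthonormal_seq_def moyal norm_eq_1_iff_cinner)

text \<open>Formally the integral of \<open>F w\<close> times the adjoint of the shift by
  \<open>w\<close>, so \<open>F\<close> is a form of the spreading function of the operator. The
  weak identity determines the operator that \<open>SOME\<close> picks.\<close>

definition hs_op :: "('a::euclidean_space \<times> 'a) l2 \<Rightarrow> 'a l2 \<Rightarrow> 'a l2" where
  "hs_op F = (SOME A. A \<in> bounded_ops \<and> (\<forall>f g. cinner (A f) g = cinner F (stft_conj g f)) \<and>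
     (\<forall>f. norm (A f) \<le> norm F * norm f))"

lemma hs_op_bounded [simp]: "hs_op F \<in> bounded_ops"
  and cinner_hs_op: "cinner (hs_op F f) g = cinner F (stft_conj g f)"
  and norm_hs_op_le: "norm (hs_op F f) \<le> norm F * norm f"
proof -
  have "\<exists>A\<in>bounded_ops. (\<forall>f g. cinner (A f) g = cinner F (stft_conj g f)) \<and> (\<forall>f. norm (A f) \<le> norm F * norm f)"
  proof (rule sesquilinear_operator_exists)
    show "cmod (cinner F (stft_conj y x)) \<le> norm F * norm x * norm y" for x y
      using l2_Cauchy_Schwarz[of F "stft_conj y x"] by (simp add: mult_ac)
  qed (simp_all add: stft_conj_add_left stft_conj_add_right cinner_add_right)
  then have "hs_op F \<in> bounded_ops \<and> (\<forall>f g. cinner (hs_op F f) g = cinner F (stft_conj g f)) \<and>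
     (\<forall>f. norm (hs_op F f) \<le> norm F * norm f)"
    unfolding hs_op_def Bex_def by (rule someI_ex)
  then show "hs_op F \<in> bounded_ops" "cinner (hs_op F f) g = cinner F (stft_conj g f)" "norm (hs_op F f) \<le> norm F * norm f"
    by blast+
qed

lemma hs_op_diff: "hs_op (F - G) f = hs_op F f - hs_op G f"
  by (rule cinner_eqI) (simp add: cinner_hs_op cinner_diff_left)

text \<open>By Moyal's identity the vectors \<open>stft_conj (g k) (e k)\<close> are orthonormal
  whenever the \<open>g k\<close> are unit vectors, however these relate to each other. Taking
  \<open>g k\<close> in the direction of the image of \<open>e k\<close> turns Bessel's inequality
  for \<open>F\<close> into the Hilbert--Schmidt bound.\<close>

lemma hs_op_square_sum:
  assumes e: "orthonormal_seq e"
  shows "summable (\<lambda>k. (norm (hs_op F (e k)))\<^sup>2)" "(\<Sum>k. (norm (hs_op F (e k)))\<^sup>2) \<le> (norm F)\<^sup>2"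
proof -
  define g where "g k = (if hs_op F (e k) = 0 then e k else of_real (1 / norm (hs_op F (e k))) *\<^sub>C hs_op F (e k))" for k
  have g1: "norm (g k) = 1" for k
    using orthonormal_seq_norm[OF e] by (simp add: g_def norm_divide)
  have eq: "(cmod (cinner F (stft_conj (g k) (e k))))\<^sup>2 = (norm (hs_op F (e k)))\<^sup>2" for k
  proof (cases "hs_op F (e k) = 0")
    case True
    then show ?thesis using cinner_hs_op[of F "e k" "g k"] by simp
  next
    case False
    have "cinner F (stft_conj (g k) (e k)) = of_real (1 / norm (hs_op F (e k))) * cinner (hs_op F (e k)) (hs_op F (e k))"
      using False by (simp add: g_def cinner_hs_op[symmetric])
    also have "\<dots> = of_real (norm (hs_op F (e k)))"
      using False by (simp add: cinner_self power2_eq_square)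
    finally show ?thesis by simp
  qed
  show "summable (\<lambda>k. (norm (hs_op F (e k)))\<^sup>2)" "(\<Sum>k. (norm (hs_op F (e k)))\<^sup>2) \<le> (norm F)\<^sup>2"
    using bessel_seq[OF stft_conj_orthonormal[of e g, OF e g1], of F] by (simp_all add: eq)
qed

text \<open>By Moyal's identity \<open>stft_conj (f k) (e k)\<close> is the kernel of the rank-one
  operator that sends \<open>e k\<close> to \<open>f k\<close>. These kernels are orthonormal, so
  square-summable singular values give a convergent series of kernels.\<close>

lemma hs_op_representation:
  assumes Tc: "T \<in> compact_ops" and sm: "summable (\<lambda>k. (singular_values T k)\<^sup>2)"
  shows "\<exists>F. T = hs_op F"
proof -
  let ?s = "singular_values T"
  obtain e f where e: "orthonormal_seq e" and f: "orthonormal_seq f"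
    and T: "\<And>h. svd_terms ?s e f h sums T h"
    by (rule compact_op_svd[OF Tc]) blast
  note W = stft_conj_orthonormal[of e f, OF e orthonormal_seq_norm[OF f]]
  define F where "F = (\<Sum>k. of_real (?s k) *\<^sub>C stft_conj (f k) (e k))"
  have F: "(\<lambda>k. of_real (?s k) *\<^sub>C stft_conj (f k) (e k)) sums F"
    unfolding F_def using sm by (intro summable_sums orthonormal_series(1)[OF W]) simp
  have "T h = hs_op F h" for h
  proof (rule cinner_eqI)
    fix g
    have "(\<lambda>k. cinner ((of_real (?s k) * cinner h (e k)) *\<^sub>C f k) g) sums cinner (T h) g"
      by (rule bounded_linear.sums[OF bounded_linear_cinner_left T])
    moreover have "(\<lambda>k. cinner (of_real (?s k) *\<^sub>C stft_conj (f k) (e k)) (stft_conj g h)) sums cinner F (stft_conj g h)"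
      by (rule bounded_linear.sums[OF bounded_linear_cinner_left F])
    moreover have "cinner ((of_real (?s k) * cinner h (e k)) *\<^sub>C f k) g = cinner (of_real (?s k) *\<^sub>C stft_conj (f k) (e k)) (stft_conj g h)" for k
      unfolding cinner_scaleC_left moyal by (simp add: cinner_commute[of h "e k"])
    ultimately show "cinner (T h) g = cinner (hs_op F h) g"
      unfolding cinner_hs_op by (simp only:) (rule sums_unique2)
  qed
  then show ?thesis by blast
qed

lemma AE_lborel_linear:
  fixes f :: "'a::euclidean_space \<Rightarrow> 'a"
  assumes lin: "linear f" and inj: "inj f" and P: "AE x in lborel. P x"
  shows "AE x in lborel. P (f x)"
proof -
  obtain N where N: "N \<in> null_sets lborel" "{x. \<not> P x} \<subseteq> N"
    using P unfolding eventually_ae_filter by (auto simp: Collect_neg_eq)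
  have "negligible N" using N(1) by (auto simp: negligible_iff_null_sets null_sets_completionI)
  obtain g where g: "linear g" "\<And>x. g (f x) = x"
    using linear_injective_left_inverse[OF lin inj] by (auto simp: fun_eq_iff)
  have "negligible (g ` N)"
    using \<open>negligible N\<close> g(1) by (intro negligible_differentiable_image_negligible linear_imp_differentiable_on) auto
  then have "AE x in lebesgue. x \<notin> g ` N" by (intro AE_not_in) (simp add: negligible_iff_null_sets)
  then have "AE x in lebesgue. P (f x)"
  proof eventually_elim
    case (elim x)
    then have "f x \<notin> N" using g(2)[of x] by (metis imageI)
    then show ?case using N(2) by blast
  qed
  then show ?thesis by (simp add: AE_completion_iff)
qed

lemma inj_symp: "inj sympJ"
  by (rule injI) (metis symp_symp minus_minus)

lemma berezin_hs_op: "berezin \<phi>1 \<phi>2 (hs_op F) z = ft (\<lambda>w. rep_l2 F w * stft \<phi>1 \<phi>2 w) (sympJ z)"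
  by (simp add: berezin_def cinner_hs_op cinner_stft_conj stft_tf_shift ft_def mult_ac)

lemma integrable_rep_mult_stft: "integrable lborel (\<lambda>w. rep_l2 F w * stft g f w)"
  using Lp_2_integrable_mult[OF rep_l2_Lp cnj_stft_Lp_2, of F g f] by simp

text \<open>The ambiguity function of a Gaussian is a Gaussian times a phase. Completing the square
  around \<open>x /\<^sub>R 2\<close> with scale \<open>1 / sqrt 2\<close> merges the two factors
  into a single Gaussian, whose transform is known.\<close>

lemma stft_gauss_nonzero:
  fixes x \<xi> :: "'a::euclidean_space"
  shows "stft (abs_l2 (\<lambda>t. of_real (gauss t))) (abs_l2 (\<lambda>t. of_real (gauss t))) (x, \<xi>) \<noteq> 0"
proof -
  let ?g = "\<lambda>t::'a. complex_of_real (gauss t)"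
  let ?c = "1 / sqrt 2"
  have sq: "gauss (y - x) * gauss y = exp (- pi * (norm x)\<^sup>2 / 2) * gauss s" if y: "y = x /\<^sub>R 2 + ?c *\<^sub>R s" for y s
  proof -
    have "(norm (y - x))\<^sup>2 + (norm y)\<^sup>2 = (norm x)\<^sup>2 / 2 + (norm s)\<^sup>2"
    proof -
      have "y - x = ?c *\<^sub>R s - x /\<^sub>R 2"
        unfolding y by (simp add: algebra_simps) (simp flip: scaleR_add_left)
      then have "(norm (y - x))\<^sup>2 + (norm y)\<^sup>2 = 2 * (norm (?c *\<^sub>R s))\<^sup>2 + 2 * (norm (x /\<^sub>R 2))\<^sup>2"
        unfolding y power2_norm_eq_inner by (simp only: inner_diff_left inner_diff_right inner_add_left inner_add_right)
      then show ?thesis by (simp add: power_mult_distrib power_divide)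
    qed
    moreover have "gauss (y - x) * gauss y = exp (- pi * ((norm (y - x))\<^sup>2 + (norm y)\<^sup>2))"
      unfolding gauss_def by (simp only: exp_add[symmetric] distrib_left)
    moreover have "exp (- pi * ((norm x)\<^sup>2 / 2 + (norm s)\<^sup>2)) = exp (- pi * (norm x)\<^sup>2 / 2) * gauss s"
      unfolding gauss_def by (simp only: exp_add[symmetric] distrib_left times_divide_eq_right)
    ultimately show ?thesis by simp
  qed
  have "stft (abs_l2 ?g) (abs_l2 ?g) (x, \<xi>) = (LINT t|lborel. ?g t * cnj (echar \<xi> t * ?g (t - x)))"
    unfolding stft_def tf_shift_abs[OF gauss_Lp_2] cinner_abs[OF gauss_Lp_2 shift_Lp_2[OF gauss_Lp_2]] ..
  also have "\<dots> = (LINT t|lborel. of_real (gauss (t - x) * gauss t) * echar (- \<xi>) t)"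
    by (simp add: mult_ac)
  also have "\<dots> = ?c ^ DIM('a) *\<^sub>R (LINT s|lborel. of_real (gauss (x /\<^sub>R 2 + ?c *\<^sub>R s - x) * gauss (x /\<^sub>R 2 + ?c *\<^sub>R s)) * echar (- \<xi>) (x /\<^sub>R 2 + ?c *\<^sub>R s))"
    by (subst lborel_integral_affine[of ?c _ "x /\<^sub>R 2"]) simp_all
  also have "(\<lambda>s. complex_of_real (gauss (x /\<^sub>R 2 + ?c *\<^sub>R s - x) * gauss (x /\<^sub>R 2 + ?c *\<^sub>R s)) * echar (- \<xi>) (x /\<^sub>R 2 + ?c *\<^sub>R s))
      = (\<lambda>s. (of_real (exp (- pi * (norm x)\<^sup>2 / 2)) * echar (- \<xi>) (x /\<^sub>R 2)) * (?g s * echar (- (?c *\<^sub>R \<xi>)) s))"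
  proof
    fix s
    have "echar (- \<xi>) (x /\<^sub>R 2 + ?c *\<^sub>R s) = echar (- \<xi>) (x /\<^sub>R 2) * echar (- (?c *\<^sub>R \<xi>)) s"
      unfolding echar_add_right by (simp add: echar_def)
    then show "complex_of_real (gauss (x /\<^sub>R 2 + ?c *\<^sub>R s - x) * gauss (x /\<^sub>R 2 + ?c *\<^sub>R s)) * echar (- \<xi>) (x /\<^sub>R 2 + ?c *\<^sub>R s)
      = (of_real (exp (- pi * (norm x)\<^sup>2 / 2)) * echar (- \<xi>) (x /\<^sub>R 2)) * (?g s * echar (- (?c *\<^sub>R \<xi>)) s)"
      unfolding sq[OF refl, of s] by (simp only: of_real_mult mult_ac)
  qed
  finally have "stft (abs_l2 ?g) (abs_l2 ?g) (x, \<xi>) = ?c ^ DIM('a) *\<^sub>R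
      (of_real (exp (- pi * (norm x)\<^sup>2 / 2)) * echar (- \<xi>) (x /\<^sub>R 2) * of_real (gauss (- (?c *\<^sub>R \<xi>))))"
    by (simp only: integral_mult_right_zero integral_gauss_echar)
  moreover have "echar (- \<xi>) (x /\<^sub>R 2) \<noteq> 0" using norm_echar[of "- \<xi>" "x /\<^sub>R 2"] by (metis norm_zero zero_neq_one)
  ultimately show ?thesis by simp
qed

text \<open>Testing on the Gaussian shifted by \<open>sympJ u\<close> pairs \<open>F\<close> with
  the modulation by \<open>u\<close> of the Gaussian ambiguity function; as the latter vanishes
  nowhere, these modulations are total.\<close>

lemma hs_op_eq_zero_imp:
  assumes "\<And>f. hs_op F f = 0"
  shows "F = 0"
proof -
  let ?g = "abs_l2 (\<lambda>t. of_real (gauss t))"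
  show ?thesis
  proof (rule l2_exponentials_total[OF cnj_stft_Lp_2[of ?g ?g]])
    show "AE w in lborel. cnj (stft ?g ?g w) \<noteq> 0"
    proof (rule AE_I2)
      show "cnj (stft ?g ?g w) \<noteq> 0" for w by (cases w) (simp add: stft_gauss_nonzero)
    qed
    fix u
    have "cinner F (stft_conj (tf_shift (sympJ u) ?g) (tf_shift (sympJ u) ?g)) = 0"
      using assms by (simp add: cinner_hs_op[symmetric])
    moreover have "stft_conj (tf_shift (sympJ u) ?g) (tf_shift (sympJ u) ?g) = abs_l2 (\<lambda>w. cnj (stft ?g ?g w) * echar u w)"
      unfolding stft_conj_def stft_tf_shift by (simp add: mult.commute)
    ultimately show "cinner F (abs_l2 (\<lambda>w. cnj (stft ?g ?g w) * echar u w)) = 0" by simp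
  qed
qed

section \<open>Injectivity of the Berezin transform\<close>

lemma berezin_hs_op_eq_zero_imp:
  assumes V: "AE z in lborel. stft \<phi>1 \<phi>2 z \<noteq> 0"
    and B: "AE z in lborel. berezin \<phi>1 \<phi>2 (hs_op F) z = 0"
  shows "F = 0"
proof -
  let ?h = "\<lambda>w. rep_l2 F w * stft \<phi>1 \<phi>2 w"
  \<comment> \<open>The negative of \<open>sympJ\<close> is its inverse; being linear and injective,
    it pulls the exceptional null set back to a null set in the Fourier variable.\<close>
  have lin: "linear (\<lambda>u. - sympJ u)" by (intro linear_compose_neg linear_symp)
  have "AE u in lborel. ft ?h (sympJ (- sympJ u)) = 0"
    by (rule AE_lborel_linear[OF lin _ B[unfolded berezin_hs_op]])
      (auto intro!: injI dest: injD[OF inj_symp])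
  then have "AE u in lborel. ft ?h u = 0"
    by (simp add: linear_neg[OF linear_symp])
  then have "AE w in lborel. ?h w = 0"
    by (rule ft_eq_zero_imp_AE_zero[OF integrable_rep_mult_stft])
  then have "AE w in lborel. rep_l2 F w = rep_l2 0 w"
    using V rep_abs_l2[OF Lp_2_zero] unfolding zero_l2.abs_eq[symmetric]
    by eventually_elim auto
  then show ?thesis by (rule l2_eqI)
qed

lemma powr_two_of_nonneg: "0 \<le> x \<Longrightarrow> x powr 2 = x\<^sup>2" for x :: real
  by (cases "x = 0") (auto simp: powr_numeral)

lemma schatten_le_2_imp_hs_op:
  assumes T: "T \<in> schatten p" and p: "p \<le> 2"
  shows "\<exists>F. T = hs_op F"
proof -
  have p_top: "p \<noteq> \<infinity>" using p by (auto simp: top_unique)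
  have Tc: "T \<in> compact_ops" and sm: "summable (\<lambda>k. singular_values T k powr enn2real p)"
    using T p_top by (simp_all add: schatten_def)
  have p2: "enn2real p \<le> 2" using enn2real_mono[OF p] by simp
  have s: "singular_values T \<longlonglongrightarrow> 0" "\<And>k. 0 \<le> singular_values T k"
    by (rule compact_op_svd[OF Tc], assumption)+
  have "summable (\<lambda>k. (singular_values T k)\<^sup>2)"
    using powr_summable_mono[OF s sm p2] s(2) by (simp add: powr_two_of_nonneg)
  then show ?thesis by (rule hs_op_representation[OF Tc])
qed

lemma hs_op_summable_powr:
  assumes q: "2 \<le> q" and e: "orthonormal_seq e"
  shows "summable (\<lambda>k. norm (hs_op F (e k)) powr q)"
proof (rule powr_summable_mono[OF _ _ _ q])
  note sm = hs_op_square_sum(1)[OF e, of F]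
  show "summable (\<lambda>k. norm (hs_op F (e k)) powr 2)" using sm by (simp add: powr_two_of_nonneg)
  have "(\<lambda>k. sqrt ((norm (hs_op F (e k)))\<^sup>2)) \<longlonglongrightarrow> sqrt 0"
    by (intro tendsto_real_sqrt summable_LIMSEQ_zero[OF sm])
  then show "(\<lambda>k. norm (hs_op F (e k))) \<longlonglongrightarrow> 0" by simp
qed simp

lemma ennreal_ge_2_cases:
  fixes p :: ennreal
  assumes "2 \<le> p"
  obtains "p = \<infinity>" | q where "p = ennreal q" "2 \<le> q"
proof (cases p)
  case (real q)
  then have "2 \<le> q" using assms by (simp flip: ennreal_numeral)
  with real that show thesis by blast
qed (use that in auto)

lemma hs_op_schatten:
  assumes "2 \<le> p"
  shows "hs_op F \<in> schatten p"
  using assms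
proof (cases rule: ennreal_ge_2_cases)
  case 1
  have "hs_op F \<in> schatten (ennreal 2)"
    by (intro schattenI hs_op_summable_powr) auto
  then show ?thesis using 1 by (simp add: schatten_def)
next
  case (2 q)
  then show ?thesis by (auto intro!: schattenI hs_op_summable_powr)
qed

lemma integral_norm_stft_mult:
  "integrable lborel (\<lambda>z. cmod (stft g f z) * cmod (stft g' f' z))"
  "(LINT z|lborel. cmod (stft g f z) * cmod (stft g' f' z)) \<le> (norm f * norm g) * (norm f' * norm g')"
proof -
  show "integrable lborel (\<lambda>z. cmod (stft g f z) * cmod (stft g' f' z))"
    using integrable_norm[OF Lp_2_integrable_mult[OF stft_Lp_2[of g f] stft_Lp_2[of g' f']]] by (simp add: norm_mult)
  define v where "v g f z = complex_of_real (cmod (stft g f z))" for g f :: "'a l2" and z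
  have v: "v g f \<in> Lp 2" for g f
    using stft_Lp_2[of g f] unfolding Lp_2_iff v_def[abs_def] by simp
  have nv: "norm (abs_l2 (v g f)) = norm f * norm g" for g f
  proof -
    have "ennreal ((norm (abs_l2 (v g f)))\<^sup>2) = ennreal ((norm f * norm g)\<^sup>2)"
      unfolding norm_abs_l2[OF v] by (simp add: v_def nn_integral_stft power_mult_distrib)
    then show ?thesis by (simp add: power2_eq_iff_nonneg)
  qed
  have "cinner (abs_l2 (v g f)) (abs_l2 (v g' f')) = of_real (LINT z|lborel. cmod (stft g f z) * cmod (stft g' f' z))"
    unfolding cinner_abs[OF v v] integral_complex_of_real[symmetric] by (simp add: v_def)
  then have "\<bar>LINT z|lborel. cmod (stft g f z) * cmod (stft g' f' z)\<bar> \<le> (norm f * norm g) * (norm f' * norm g')"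
    using l2_Cauchy_Schwarz[of "abs_l2 (v g f)" "abs_l2 (v g' f')"] by (simp add: nv)
  then show "(LINT z|lborel. cmod (stft g f z) * cmod (stft g' f' z)) \<le> (norm f * norm g) * (norm f' * norm g')"
    by linarith
qed

text \<open>The decomposition of \<open>T\<close> bounds the transform at \<open>z\<close> by the
  sum of \<open>?s k * w k z\<close>. The weights have bounded sums over \<open>k\<close> and
  bounded integrals over \<open>z\<close>: Jensen in \<open>k\<close> uses the former, termwise
  integration the latter.\<close>

theorem berezin_in_Lp:
  fixes T :: "'a::euclidean_space l2 \<Rightarrow> 'a l2"
  assumes T: "T \<in> schatten p" and p: "1 \<le> p" "p \<le> 2"
  shows "berezin \<phi>1 \<phi>2 T \<in> Lp p"
proof -
  let ?s = "singular_values T"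
  define r where "r = enn2real p"
  have p_top: "p \<noteq> \<infinity>" using p by (auto simp: top_unique)
  have r: "1 \<le> r" using enn2real_mono[OF p(1)] p_top by (simp add: r_def less_top)
  have Tc: "T \<in> compact_ops" and sm: "summable (\<lambda>k. ?s k powr r)"
    using T p_top by (simp_all add: schatten_def r_def)
  obtain F where F: "T = hs_op F" using schatten_le_2_imp_hs_op[OF T p(2)] by blast
  have sympm [measurable]: "sympJ \<in> borel_measurable (borel :: ('a \<times> 'a) measure)"
    using linear_continuous_on[OF linear_linear[THEN iffD2, OF linear_symp], of UNIV]
    by (intro borel_measurable_continuous_onI) (simp add: linear_linear)
  have meas [measurable]: "berezin \<phi>1 \<phi>2 T \<in> borel_measurable borel"
  proof -
    have "(\<lambda>w. rep_l2 F w * stft \<phi>1 \<phi>2 w) \<in> borel_measurable borel" by measurable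
    then have "(\<lambda>z. ft (\<lambda>w. rep_l2 F w * stft \<phi>1 \<phi>2 w) (sympJ z)) \<in> borel_measurable borel"
      by (intro measurable_compose[OF sympm] borel_measurable_ft)
    then show ?thesis by (simp add: F berezin_hs_op[abs_def])
  qed
  obtain e f where e: "orthonormal_seq e" and f: "orthonormal_seq f" and s0: "\<And>k. 0 \<le> ?s k"
    and Ts: "\<And>h. svd_terms ?s e f h sums T h"
    by (rule compact_op_svd[OF Tc]) blast
  define w where "w k z = cmod (stft \<phi>2 (e k) z) * cmod (stft \<phi>1 (f k) z)" for k z
  \<comment> \<open>One constant for the sum over \<open>k\<close>, bounded by Bessel's inequality,
    and for the integral of each \<open>w k\<close>, bounded by Cauchy--Schwarz. The summand 1 keeps
    it positive when both windows are zero.\<close>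
  define C where "C = ((norm \<phi>2)\<^sup>2 + (norm \<phi>1)\<^sup>2) / 2 + 1"
  have C: "C > 0" by (simp add: C_def add_nonneg_pos)
  have [measurable]: "w k \<in> borel_measurable borel" for k unfolding w_def by measurable
  have w0: "0 \<le> w k z" for k z by (simp add: w_def)
  have w_int: "(\<integral>\<^sup>+z. w k z \<partial>lborel) \<le> ennreal C" for k
  proof -
    note I = integral_norm_stft_mult[of \<phi>2 "e k" \<phi>1 "f k"]
    have "(\<integral>\<^sup>+z. w k z \<partial>lborel) = ennreal (LINT z|lborel. w k z)"
      using I(1) by (intro nn_integral_eq_integral) (simp_all add: w_def)
    also have "\<dots> \<le> ennreal (norm \<phi>2 * norm \<phi>1)"
      using I(2) by (intro ennreal_leI) (simp add: w_def orthonormal_seq_norm[OF e] orthonormal_seq_norm[OF f])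
    also have "\<dots> \<le> ennreal C"
      using sum_squares_bound[of "norm \<phi>2" "norm \<phi>1"] by (intro ennreal_leI) (simp add: C_def field_simps)
    finally show ?thesis .
  qed
  have w_sum: "summable (\<lambda>k. w k z)" "(\<Sum>k. w k z) \<le> C" for z
  proof -
    let ?a = "\<lambda>k. (cmod (stft \<phi>2 (e k) z))\<^sup>2" and ?b = "\<lambda>k. (cmod (stft \<phi>1 (f k) z))\<^sup>2"
    have ab: "?a = (\<lambda>k. (cmod (cinner (tf_shift z \<phi>2) (e k)))\<^sup>2)" "?b = (\<lambda>k. (cmod (cinner (tf_shift z \<phi>1) (f k)))\<^sup>2)"
      by (auto simp: stft_def cinner_commute[of "tf_shift z _"])
    have a: "summable ?a" "suminf ?a \<le> (norm \<phi>2)\<^sup>2" and b: "summable ?b" "suminf ?b \<le> (norm \<phi>1)\<^sup>2"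
      unfolding ab using bessel_seq[OF e, of "tf_shift z \<phi>2"] bessel_seq[OF f, of "tf_shift z \<phi>1"] by simp_all
    have ab_sum: "summable (\<lambda>k. (?a k + ?b k) / 2)" using a b by (intro summable_divide summable_add)
    have le: "w k z \<le> (?a k + ?b k) / 2" for k
      using sum_squares_bound[of "cmod (stft \<phi>2 (e k) z)" "cmod (stft \<phi>1 (f k) z)"] by (simp add: w_def)
    show sw: "summable (\<lambda>k. w k z)"
      by (rule summable_comparison_test'[OF ab_sum, of 0]) (use le w0 in simp)
    have "(\<Sum>k. w k z) \<le> (\<Sum>k. (?a k + ?b k) / 2)" by (rule suminf_le[OF le sw ab_sum])
    also have "\<dots> = (suminf ?a + suminf ?b) / 2"
      using a b by (simp add: suminf_divide summable_add suminf_add)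
    also have "\<dots> \<le> ((norm \<phi>2)\<^sup>2 + (norm \<phi>1)\<^sup>2) / 2"
      by (intro divide_right_mono add_mono a b) simp
    also have "\<dots> \<le> C" by (simp add: C_def)
    finally show "(\<Sum>k. w k z) \<le> C" .
  qed
  have w_le: "w k z \<le> C" for k z
    using sum_le_suminf[OF w_sum(1)[of z], of "{k}"] w_sum(2)[of z] w0[of _ z] by simp
  have srw: "summable (\<lambda>k. ?s k powr r * w k z)" for z
    by (rule summable_comparison_test'[OF summable_mult2[OF sm, of C], of 0])
      (use w0 w_le in \<open>simp add: mult_left_mono\<close>)
  have pointwise: "cmod (berezin \<phi>1 \<phi>2 T z) powr r \<le> C powr (r - 1) * (\<Sum>k. ?s k powr r * w k z)" for z
  proof -
    note J = weighted_powr_jensen_suminf[OF r C w_sum(1) w0 w_sum(2) s0 srw, of z]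
    have "(\<lambda>k. cinner ((of_real (?s k) * cinner (tf_shift z \<phi>2) (e k)) *\<^sub>C f k) (tf_shift z \<phi>1)) sums berezin \<phi>1 \<phi>2 T z"
      unfolding berezin_def by (rule bounded_linear.sums[OF bounded_linear_cinner_left Ts])
    moreover have nb: "cmod (cinner ((of_real (?s k) * cinner (tf_shift z \<phi>2) (e k)) *\<^sub>C f k) (tf_shift z \<phi>1)) = ?s k * w k z" for k
      using s0[of k] by (simp add: w_def stft_def norm_mult cinner_commute[of "tf_shift z \<phi>2"])
    ultimately have "cmod (berezin \<phi>1 \<phi>2 T z) \<le> (\<Sum>k. ?s k * w k z)"
      using summable_norm[of "\<lambda>k. cinner ((of_real (?s k) * cinner (tf_shift z \<phi>2) (e k)) *\<^sub>C f k) (tf_shift z \<phi>1)"] J(1)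
      unfolding nb by (simp add: sums_iff)
    then have "cmod (berezin \<phi>1 \<phi>2 T z) powr r \<le> (\<Sum>k. ?s k * w k z) powr r"
      using r by (intro powr_mono2) auto
    with J(2) show ?thesis by simp
  qed
  have "(\<integral>\<^sup>+z. cmod (berezin \<phi>1 \<phi>2 T z) powr r \<partial>lborel)
      \<le> (\<integral>\<^sup>+z. (\<Sum>k. ennreal (C powr (r - 1) * (?s k powr r * w k z))) \<partial>lborel)"
  proof (rule nn_integral_mono)
    fix z
    have "C powr (r - 1) * (\<Sum>k. ?s k powr r * w k z) = (\<Sum>k. C powr (r - 1) * (?s k powr r * w k z))"
      by (rule suminf_mult[OF srw, symmetric])
    then show "ennreal (cmod (berezin \<phi>1 \<phi>2 T z) powr r) \<le> (\<Sum>k. ennreal (C powr (r - 1) * (?s k powr r * w k z)))"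
      using pointwise[of z] w0 by (subst suminf_ennreal2) (auto intro!: summable_mult srw ennreal_leI)
  qed
  also have "\<dots> = (\<Sum>k. \<integral>\<^sup>+z. ennreal (C powr (r - 1) * (?s k powr r * w k z)) \<partial>lborel)"
    by (rule nn_integral_suminf) measurable
  also have "\<dots> \<le> (\<Sum>k. ennreal (C powr (r - 1) * ?s k powr r * C))"
  proof (intro suminf_le)
    fix k
    have "(\<integral>\<^sup>+z. ennreal (C powr (r - 1) * (?s k powr r * w k z)) \<partial>lborel)
        = ennreal (C powr (r - 1) * ?s k powr r) * (\<integral>\<^sup>+z. w k z \<partial>lborel)"
      by (subst nn_integral_cmult[symmetric]) (auto simp: ennreal_mult'[symmetric] mult.assoc)
    also have "\<dots> \<le> ennreal (C powr (r - 1) * ?s k powr r) * ennreal C"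
      by (intro mult_left_mono w_int) auto
    finally show "(\<integral>\<^sup>+z. ennreal (C powr (r - 1) * (?s k powr r * w k z)) \<partial>lborel) \<le> ennreal (C powr (r - 1) * ?s k powr r * C)"
      using C by (simp add: ennreal_mult'[symmetric])
  qed auto
  also have "\<dots> = ennreal (\<Sum>k. C powr (r - 1) * ?s k powr r * C)"
    using C sm by (intro suminf_ennreal2) (auto intro!: summable_mult summable_mult2)
  also have "\<dots> < \<infinity>" by simp
  finally have "integrable lborel (\<lambda>z. cmod (berezin \<phi>1 \<phi>2 T z) powr r)"
    by (simp add: integrable_iff_bounded)
  then show ?thesis using p_top by (simp add: Lp_def r_def)
qed

theorem berezin_one_to_oneI:
  fixes \<phi>1 \<phi>2 :: "'a::euclidean_space l2"
  assumes p: "1 \<le> p" "p \<le> 2" and V: "AE z in lborel. stft \<phi>1 \<phi>2 z \<noteq> 0"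
  shows "berezin_one_to_one \<phi>1 \<phi>2 p"
  unfolding berezin_one_to_one_def
proof (intro conjI ballI impI)
  fix S T :: "'a l2 \<Rightarrow> 'a l2"
  assume "S \<in> schatten p" "T \<in> schatten p"
    and eq: "AE z in lborel. berezin \<phi>1 \<phi>2 S z = berezin \<phi>1 \<phi>2 T z"
  then obtain F G where FG: "S = hs_op F" "T = hs_op G"
    using schatten_le_2_imp_hs_op[OF _ p(2)] by metis
  have "berezin \<phi>1 \<phi>2 (hs_op (F - G)) z = berezin \<phi>1 \<phi>2 S z - berezin \<phi>1 \<phi>2 T z" for z
    by (simp add: berezin_def FG hs_op_diff cinner_diff_left)
  then have "F - G = 0" using eq by (intro berezin_hs_op_eq_zero_imp[OF V]) simp
  then show "S = T" by (simp add: FG)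
qed (rule berezin_in_Lp[OF _ p])

theorem berezin_one_to_one_imp:
  fixes \<phi>1 \<phi>2 :: "'a::euclidean_space l2"
  assumes p: "2 \<le> p" and inj: "berezin_one_to_one \<phi>1 \<phi>2 p"
  shows "AE z in lborel. stft \<phi>1 \<phi>2 z \<noteq> 0"
proof -
  \<comment> \<open>The zero set may have infinite measure; the Gaussian factor makes
    \<open>m\<close> square-integrable and is itself nowhere zero.\<close>
  define m where "m z = (if stft \<phi>1 \<phi>2 z = 0 then complex_of_real (gauss z) else 0)" for z
  have m: "m \<in> Lp 2"
  proof -
    have [measurable]: "m \<in> borel_measurable borel" unfolding m_def by measurable
    have "(\<integral>\<^sup>+z. (cmod (m z))\<^sup>2 \<partial>lborel) \<le> (\<integral>\<^sup>+z. (cmod (complex_of_real (gauss (z :: 'a \<times> 'a))))\<^sup>2 \<partial>lborel)"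
      by (intro nn_integral_mono ennreal_leI) (simp add: m_def)
    also have "\<dots> < \<infinity>" using gauss_Lp_2[where 'a="'a \<times> 'a"] unfolding Lp_2_iff_nn by blast
    finally show ?thesis unfolding Lp_2_iff_nn by simp
  qed
  define F where "F = abs_l2 m"
  have zero: "berezin \<phi>1 \<phi>2 (hs_op G) z = 0" if "G = F \<or> G = 0" for G z
  proof -
    have "AE w in lborel. rep_l2 G w * stft \<phi>1 \<phi>2 w = 0"
    proof (cases "G = 0")
      case True
      show ?thesis
        using rep_abs_l2[OF Lp_2_zero, where 'a="'a \<times> 'a"] unfolding zero_l2.abs_eq[symmetric] True by eventually_elim simp
    next
      case False
      then show ?thesis using that rep_abs_l2[OF m] unfolding F_def[symmetric] by (auto simp: m_def elim!: eventually_mono)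
    qed
    then have "ft (\<lambda>w. rep_l2 G w * stft \<phi>1 \<phi>2 w) u = (LINT w|(lborel :: ('a \<times> 'a) measure). 0)" for u
      unfolding ft_def by (intro integral_cong_AE) (auto elim!: eventually_mono)
    then show ?thesis by (simp add: berezin_hs_op)
  qed
  have "AE z in lborel. berezin \<phi>1 \<phi>2 (hs_op F) z = berezin \<phi>1 \<phi>2 (hs_op 0) z"
    by (simp add: zero)
  then have "hs_op F = hs_op 0"
    using inj hs_op_schatten[OF p, of F] hs_op_schatten[OF p, of 0] unfolding berezin_one_to_one_def by blast
  then have "hs_op F f = 0" for f using norm_hs_op_le[of 0 f] by simp
  then have "F = 0" by (rule hs_op_eq_zero_imp)
  with rep_abs_l2[OF m] rep_abs_l2[OF Lp_2_zero, where 'a="'a \<times> 'a"]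
  have "AE z in lborel. m z = 0" unfolding F_def zero_l2.abs_eq[symmetric] by (auto elim: eventually_elim2)
  then show ?thesis by eventually_elim (auto simp: m_def split: if_splits)
qed

section \<open>Localization operators\<close>

lemma stft_add: "stft g (f + f') z = stft g f z + stft g f' z"
  and stft_scale: "stft g (c *\<^sub>C f) z = c * stft g f z"
  by (simp_all add: stft_def cinner_add_left)

lemma norm_abs_stft: "norm (abs_l2 (stft g f)) = norm f * norm g"
proof -
  have "ennreal ((norm (abs_l2 (stft g f)))\<^sup>2) = ennreal ((norm f * norm g)\<^sup>2)"
    unfolding norm_abs_l2[OF stft_Lp_2] by (simp add: nn_integral_stft power_mult_distrib)
  then show ?thesis by (simp add: power2_eq_iff_nonneg)
qed

abbreviation loc_form ::
    "'a::euclidean_space l2 \<Rightarrow> 'a l2 \<Rightarrow> ('a \<times> 'a \<Rightarrow> complex) \<Rightarrow> 'a l2 \<Rightarrow> 'a l2 \<Rightarrow> complex" where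
  "loc_form \<phi>1 \<phi>2 a f g \<equiv> (LINT z|lborel. a z * stft \<phi>1 f z * cnj (stft \<phi>2 g z))"

text \<open>The product \<open>w\<close> of the two moduli is integrable and bounded, with the same
  constant \<open>M\<close>. The bounded part \<open>c\<close> of the symbol is paired with the
  integral of \<open>w\<close>, the integrable part \<open>b\<close> with its bound.\<close>

lemma loc_form_bound:
  fixes a :: "'a::euclidean_space \<times> 'a \<Rightarrow> complex"
  assumes a [measurable]: "a \<in> borel_measurable borel" and c: "0 \<le> c"
    and b: "integrable lborel b" "\<And>z. 0 \<le> b z" and ab: "AE z in lborel. cmod (a z) \<le> c + b z"
  shows "integrable lborel (\<lambda>z. a z * stft \<phi>1 f z * cnj (stft \<phi>2 g z))"
    and "cmod (loc_form \<phi>1 \<phi>2 a f g)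
      \<le> (c + (LINT z|lborel. b z)) * (norm \<phi>1 * norm \<phi>2) * norm f * norm g"
proof -
  define w where "w z = cmod (stft \<phi>1 f z) * cmod (stft \<phi>2 g z)" for z
  define M where "M = (norm f * norm \<phi>1) * (norm g * norm \<phi>2)"
  have wi: "integrable lborel w" and wI: "(LINT z|lborel. w z) \<le> M"
    using integral_norm_stft_mult[of \<phi>1 f \<phi>2 g] by (simp_all add: w_def[abs_def] M_def)
  have w0: "0 \<le> w z" for z by (simp add: w_def)
  have wM: "w z \<le> M" for z
    unfolding w_def M_def by (intro mult_mono norm_stft_le) auto
  have ui: "integrable lborel (\<lambda>z. c * w z + b z * M)"
    using wi b(1) by simp
  have le: "AE z in lborel. cmod (a z * stft \<phi>1 f z * cnj (stft \<phi>2 g z)) \<le> c * w z + b z * M"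
    using ab
  proof eventually_elim
    case (elim z)
    have "cmod (a z * stft \<phi>1 f z * cnj (stft \<phi>2 g z)) = cmod (a z) * w z"
      by (simp add: norm_mult w_def)
    also have "\<dots> \<le> (c + b z) * w z" by (rule mult_right_mono[OF elim w0])
    also have "\<dots> \<le> c * w z + b z * M"
      using mult_left_mono[OF wM[of z] b(2)[of z]] by (simp add: distrib_right)
    finally show ?case .
  qed
  have M0: "0 \<le> M" by (simp add: M_def)
  show i: "integrable lborel (\<lambda>z. a z * stft \<phi>1 f z * cnj (stft \<phi>2 g z))"
  proof (rule Bochner_Integration.integrable_bound[OF ui])
    show "AE z in lborel. cmod (a z * stft \<phi>1 f z * cnj (stft \<phi>2 g z)) \<le> norm (c * w z + b z * M)"
      using le by eventually_elim simp
  qed measurable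
  have "cmod (loc_form \<phi>1 \<phi>2 a f g)
      \<le> (LINT z|lborel. cmod (a z * stft \<phi>1 f z * cnj (stft \<phi>2 g z)))"
    by (rule integral_norm_bound)
  also have "\<dots> \<le> (LINT z|lborel. c * w z + b z * M)"
    using i ui le by (intro integral_mono_AE) auto
  also have "\<dots> = c * (LINT z|lborel. w z) + (LINT z|lborel. b z) * M"
    using wi b(1) by simp
  also have "\<dots> \<le> c * M + (LINT z|lborel. b z) * M"
    using wI c by (intro add_right_mono mult_left_mono)
  finally show "cmod (loc_form \<phi>1 \<phi>2 a f g)
      \<le> (c + (LINT z|lborel. b z)) * (norm \<phi>1 * norm \<phi>2) * norm f * norm g"
    by (simp add: M_def algebra_simps)
qed

lemma loc_op_eqI:
  assumes "A \<in> bounded_ops"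
    and "\<And>f g. cinner (A f) g = loc_form \<phi>1 \<phi>2 a f g"
  shows "loc_op \<phi>1 \<phi>2 a = A"
  unfolding loc_op_def
proof (rule the_equality)
  fix A' assume "A' \<in> bounded_ops \<and> (\<forall>f g. cinner (A' f) g = loc_form \<phi>1 \<phi>2 a f g)"
  then show "A' = A" by (intro ext cinner_eqI) (simp add: assms(2))
qed (use assms in blast)

lemma loc_op_Lp:
  fixes a :: "'a::euclidean_space \<times> 'a \<Rightarrow> complex"
  assumes a: "a \<in> Lp (ennreal q)" and q: "1 \<le> q"
  shows "loc_op \<phi>1 \<phi>2 a \<in> bounded_ops"
    and "cinner (loc_op \<phi>1 \<phi>2 a f) g = loc_form \<phi>1 \<phi>2 a f g"
proof -
  have am: "a \<in> borel_measurable borel" and ai: "integrable lborel (\<lambda>z. cmod (a z) powr q)"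
    using a q by (simp_all add: Lp_def)
  let ?b = "\<lambda>z. cmod (a z) powr q"
  \<comment> \<open>Dominating the symbol by a bounded plus an integrable part treats every finite
    exponent alike and takes the place of Hoelder's inequality.\<close>
  have "AE z in lborel. cmod (a z) \<le> 1 + ?b z" using le_one_plus_powr[OF q] by simp
  note fb = loc_form_bound[OF am _ ai _ this, simplified]
  have "\<exists>A\<in>bounded_ops. (\<forall>f g. cinner (A f) g = loc_form \<phi>1 \<phi>2 a f g) \<and>
     (\<forall>f. norm (A f) \<le> (1 + (LINT z|lborel. ?b z)) * (norm \<phi>1 * norm \<phi>2) * norm f)"
  proof (rule sesquilinear_operator_exists)
    fix x y :: "'a l2" and d :: complex
    show "loc_form \<phi>1 \<phi>2 a (d *\<^sub>C x) y = d * loc_form \<phi>1 \<phi>2 a x y"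
      by (simp add: stft_scale mult_ac flip: integral_mult_right_zero)
    show "loc_form \<phi>1 \<phi>2 a x (d *\<^sub>C y) = cnj d * loc_form \<phi>1 \<phi>2 a x y"
      by (simp add: stft_scale mult_ac flip: integral_mult_right_zero)
  qed (use fb in \<open>simp_all add: stft_add distrib_left distrib_right\<close>)
  then obtain A where A: "A \<in> bounded_ops" "\<And>f g. cinner (A f) g = loc_form \<phi>1 \<phi>2 a f g"
    by blast
  with loc_op_eqI[OF A] show "loc_op \<phi>1 \<phi>2 a \<in> bounded_ops"
    "cinner (loc_op \<phi>1 \<phi>2 a f) g = loc_form \<phi>1 \<phi>2 a f g" by simp_all
qed

text \<open>Jensen with the squared modulus of \<open>stft \<phi>1 (e k)\<close> as weight bounds
  the \<open>q\<close>-th power of each image norm by an integral linear in that weight. Summed over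
  \<open>k\<close> inside the integral, the weights are bounded by Bessel's inequality at every
  \<open>z\<close>.\<close>

theorem loc_op_schatten:
  fixes a :: "'a::euclidean_space \<times> 'a \<Rightarrow> complex"
  assumes a: "a \<in> Lp (ennreal q)" and q: "2 \<le> q"
  shows "loc_op \<phi>1 \<phi>2 a \<in> schatten (ennreal q)"
proof -
  have "1 \<le> q" using q by simp
  note A = loc_op_Lp[OF a this, of \<phi>1 \<phi>2]
  let ?A = "loc_op \<phi>1 \<phi>2 a"
  have am [measurable]: "a \<in> borel_measurable borel" and ai: "integrable lborel (\<lambda>z. cmod (a z) powr q)"
    using a q by (simp_all add: Lp_def)
  define C where "C = (norm \<phi>1)\<^sup>2 + 1"
  have C: "C > 0" by (simp add: C_def add_nonneg_pos)
  show ?thesis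
  proof (rule schattenI[OF A(1)])
    fix e :: "nat \<Rightarrow> 'a l2" assume e: "orthonormal_seq e"
    note e1 = orthonormal_seq_norm[OF e]
    define w where "w k z = (cmod (stft \<phi>1 (e k) z))\<^sup>2" for k z
    have w0: "0 \<le> w k z" for k z by (simp add: w_def)
    have wi: "integrable lborel (w k)" for k
      using stft_Lp_2[of \<phi>1 "e k"] by (simp add: Lp_2_iff w_def[abs_def])
    have wI: "(LINT z|lborel. w k z) \<le> C" for k
    proof -
      have "ennreal (LINT z|lborel. w k z) = (\<integral>\<^sup>+z. w k z \<partial>lborel)"
        by (intro nn_integral_eq_integral[symmetric] wi) (simp add: w0)
      also have "\<dots> = ennreal ((norm \<phi>1)\<^sup>2)" by (simp add: w_def nn_integral_stft e1)
      finally have "(LINT z|lborel. w k z) = (norm \<phi>1)\<^sup>2"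
        using integral_nonneg_AE[of "w k" lborel] w0 by simp
      then show ?thesis by (simp add: C_def)
    qed
    have w_le: "w k z \<le> (norm \<phi>1)\<^sup>2" for k z
      using power_mono[OF norm_stft_le[of \<phi>1 "e k" z] norm_ge_zero, of 2] by (simp add: w_def e1)
    have aw: "integrable lborel (\<lambda>z. cmod (a z) powr q * w k z)" for k
    proof (rule Bochner_Integration.integrable_bound)
      show "integrable lborel (\<lambda>z. cmod (a z) powr q * (norm \<phi>1)\<^sup>2)" using ai by simp
      show "(\<lambda>z. cmod (a z) powr q * w k z) \<in> borel_measurable lborel" unfolding w_def by measurable
      show "AE z in lborel. norm (cmod (a z) powr q * w k z) \<le> norm (cmod (a z) powr q * (norm \<phi>1)\<^sup>2)"
        by (auto simp: abs_mult w0 intro!: mult_left_mono w_le)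
    qed
    have sq: "((cmod (a z))\<^sup>2) powr (q / 2) = cmod (a z) powr q" for z
      unfolding powr_two_of_nonneg[OF norm_ge_zero, symmetric] powr_powr by simp
    have J: "integrable lborel (\<lambda>z. (cmod (a z))\<^sup>2 * w k z)"
      "(LINT z|lborel. (cmod (a z))\<^sup>2 * w k z) powr (q / 2) \<le> C powr (q / 2 - 1) * (LINT z|lborel. cmod (a z) powr q * w k z)" for k
      using weighted_powr_jensen[where p="q / 2" and C=C and M=lborel and w="w k" and s="\<lambda>z. (cmod (a z))\<^sup>2"] q C wi[of k] wI[of k] w0 aw[of k]
      by (simp_all add: sq)
    have norm_le: "norm (?A (e k)) powr q \<le> norm \<phi>2 powr q * (C powr (q / 2 - 1) * (LINT z|lborel. cmod (a z) powr q * w k z))" for k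
    proof -
      let ?v = "\<lambda>z. a z * stft \<phi>1 (e k) z"
      have vsq: "(cmod (?v z))\<^sup>2 = (cmod (a z))\<^sup>2 * w k z" for z
        by (simp add: w_def norm_mult power_mult_distrib)
      have v: "?v \<in> Lp 2" unfolding Lp_2_iff vsq using J(1) by simp
      have "ennreal ((norm (abs_l2 ?v))\<^sup>2) = ennreal (LINT z|lborel. (cmod (a z))\<^sup>2 * w k z)"
        unfolding norm_abs_l2[OF v] vsq by (intro nn_integral_eq_integral J) (simp add: w0)
      then have nv: "(norm (abs_l2 ?v))\<^sup>2 = (LINT z|lborel. (cmod (a z))\<^sup>2 * w k z)"
        using w0 by (subst (asm) ennreal_inj) (auto intro!: integral_nonneg_AE)
      \<comment> \<open>The weak identity is tested against the image itself, so that after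
        Cauchy--Schwarz one factor of its norm cancels.\<close>
      have "cinner (?A (e k)) (?A (e k)) = cinner (abs_l2 ?v) (abs_l2 (stft \<phi>2 (?A (e k))))"
        unfolding A(2) cinner_abs[OF v stft_Lp_2] ..
      then have "cmod (cinner (?A (e k)) (?A (e k))) \<le> norm (abs_l2 ?v) * (norm (?A (e k)) * norm \<phi>2)"
        using l2_Cauchy_Schwarz[of "abs_l2 ?v" "abs_l2 (stft \<phi>2 (?A (e k)))"] by (simp only: norm_abs_stft)
      then have "(norm (?A (e k)))\<^sup>2 \<le> norm (abs_l2 ?v) * (norm (?A (e k)) * norm \<phi>2)"
        by (simp add: cinner_self norm_power)
      then have "norm (?A (e k)) \<le> norm \<phi>2 * norm (abs_l2 ?v)"
        by (cases "?A (e k) = 0") (auto simp: power2_eq_square mult_ac)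
      then have "norm (?A (e k)) powr q \<le> (norm \<phi>2 * norm (abs_l2 ?v)) powr q"
        using q by (intro powr_mono2) auto
      also have "\<dots> = norm \<phi>2 powr q * ((norm (abs_l2 ?v))\<^sup>2) powr (q / 2)"
        unfolding powr_two_of_nonneg[OF norm_ge_zero, symmetric] powr_powr by (simp add: powr_mult)
      also have "\<dots> \<le> norm \<phi>2 powr q * (C powr (q / 2 - 1) * (LINT z|lborel. cmod (a z) powr q * w k z))"
        unfolding nv by (intro mult_left_mono J) auto
      finally show ?thesis .
    qed
    have "(\<Sum>k<n. norm (?A (e k)) powr q) \<le> norm \<phi>2 powr q * (C powr (q / 2 - 1) * (LINT z|lborel. cmod (a z) powr q * (norm \<phi>1)\<^sup>2))" for n
    proof -
      have "(\<Sum>k<n. norm (?A (e k)) powr q) \<le> (\<Sum>k<n. norm \<phi>2 powr q * (C powr (q / 2 - 1) * (LINT z|lborel. cmod (a z) powr q * w k z)))"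
        by (intro sum_mono norm_le)
      also have "\<dots> = norm \<phi>2 powr q * (C powr (q / 2 - 1) * (LINT z|lborel. (\<Sum>k<n. cmod (a z) powr q * w k z)))"
        by (subst Bochner_Integration.integral_sum) (simp_all add: aw sum_distrib_left)
      also have "\<dots> \<le> norm \<phi>2 powr q * (C powr (q / 2 - 1) * (LINT z|lborel. cmod (a z) powr q * (norm \<phi>1)\<^sup>2))"
      proof (intro mult_left_mono integral_mono)
        show "integrable lborel (\<lambda>z. \<Sum>k<n. cmod (a z) powr q * w k z)" by (intro Bochner_Integration.integrable_sum aw)
        show "integrable lborel (\<lambda>z. cmod (a z) powr q * (norm \<phi>1)\<^sup>2)" using ai by simp
        fix z
        have "(\<Sum>k<n. w k z) = (\<Sum>k<n. (cmod (cinner (tf_shift z \<phi>1) (e k)))\<^sup>2)"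
          by (simp add: w_def stft_def cinner_commute[of "tf_shift z \<phi>1"])
        also have "\<dots> \<le> (norm \<phi>1)\<^sup>2"
          using bessel[OF _ orthonormal_seq_imp_on[OF e], of "{..<n}" "tf_shift z \<phi>1"] by simp
        finally show "(\<Sum>k<n. cmod (a z) powr q * w k z) \<le> cmod (a z) powr q * (norm \<phi>1)\<^sup>2"
          by (simp add: sum_distrib_left[symmetric] mult_left_mono)
      qed auto
      finally show ?thesis .
    qed
    then show "summable (\<lambda>k. norm (?A (e k)) powr q)" by (intro summableI_nonneg_bounded) auto
  qed (use q in simp)
qed

section \<open>Approximation by localization operators\<close>

lemma stft_mult_bounded_Lp_2:
  assumes b: "b \<in> Lp 2"
  shows "(\<lambda>w. b w * cnj (stft g f w)) \<in> Lp 2"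
proof -
  have [measurable]: "b \<in> borel_measurable borel" using b by (simp add: Lp_2_iff)
  have "integrable lborel (\<lambda>w. (cmod (b w * cnj (stft g f w)))\<^sup>2)"
  proof (rule Bochner_Integration.integrable_bound)
    show "integrable lborel (\<lambda>w. (cmod (b w))\<^sup>2 * (norm f * norm g)\<^sup>2)" using b by (simp add: Lp_2_iff)
    show "AE w in lborel. norm ((cmod (b w * cnj (stft g f w)))\<^sup>2) \<le> norm ((cmod (b w))\<^sup>2 * (norm f * norm g)\<^sup>2)"
    proof (rule AE_I2)
      fix w
      have "(cmod (b w))\<^sup>2 * (cmod (stft g f w))\<^sup>2 \<le> (cmod (b w))\<^sup>2 * (norm f * norm g)\<^sup>2"
        by (intro mult_left_mono power_mono norm_stft_le) auto
      then show "norm ((cmod (b w * cnj (stft g f w)))\<^sup>2) \<le> norm ((cmod (b w))\<^sup>2 * (norm f * norm g)\<^sup>2)"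
        by (simp add: norm_mult power_mult_distrib)
    qed
  qed measurable
  then show ?thesis by (simp add: Lp_2_iff)
qed

lemma loc_op_ft:
  fixes b :: "'a::euclidean_space \<times> 'a \<Rightarrow> complex"
  assumes bi: "integrable lborel b" and b: "b \<in> Lp 2"
  shows "loc_op \<phi>1 \<phi>2 (\<lambda>z. ft b (sympJ z)) = hs_op (abs_l2 (\<lambda>w. b w * cnj (stft \<phi>2 \<phi>1 w)))"
proof (rule loc_op_eqI[OF hs_op_bounded])
  fix f g
  define h where "h z = stft \<phi>1 f z * cnj (stft \<phi>2 g z)" for z
  have hi: "integrable lborel h" unfolding h_def[abs_def] by (rule Lp_2_integrable_mult[OF stft_Lp_2 stft_Lp_2])
  \<comment> \<open>Products of two short-time Fourier transforms keep this shape under the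
    symplectic Fourier transform: covariance absorbs the character into shifts of
    \<open>\<phi>2\<close> and \<open>g\<close>, and Moyal's identity then pairs window with window
    and signal with signal.\<close>
  have ft_h: "ft h (- sympJ w) = cnj (stft \<phi>2 \<phi>1 w) * stft g f w" for w
  proof -
    have "ft h (- sympJ w) = (LINT z|lborel. cnj (stft (tf_shift w \<phi>2) (tf_shift w g) z) * cnj (cnj (stft \<phi>1 f z)))"
      by (simp add: ft_def h_def stft_tf_shift mult_ac)
    also have "\<dots> = cinner (stft_conj (tf_shift w \<phi>2) (tf_shift w g)) (stft_conj \<phi>1 f)"
      unfolding stft_conj_def by (rule cinner_abs[OF cnj_stft_Lp_2 cnj_stft_Lp_2, symmetric])
    also have "\<dots> = cnj (stft \<phi>2 \<phi>1 w) * stft g f w"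
      unfolding moyal stft_def by (subst (1 2) cinner_commute) simp
    finally show ?thesis .
  qed
  have "(LINT z|lborel. ft b (sympJ z) * h z) = (LINT w|lborel. b w * ft h (- sympJ w))"
  proof (rule ft_multiplication_formula_adjoint[OF bi hi])
    show "sympJ \<in> borel_measurable (borel :: ('a \<times> 'a) measure)"
      by (intro borel_measurable_continuous_onI linear_continuous_on linear_linear[THEN iffD2] linear_symp)
    show "sympJ u \<bullet> t = - sympJ t \<bullet> u" for u t :: "'a \<times> 'a"
      using inner_symp_left[of u t] by (simp add: inner_commute)
  qed
  also have "\<dots> = (LINT w|lborel. (b w * cnj (stft \<phi>2 \<phi>1 w)) * cnj (cnj (stft g f w)))"
    by (simp add: ft_h mult_ac)
  also have "\<dots> = cinner (abs_l2 (\<lambda>w. b w * cnj (stft \<phi>2 \<phi>1 w))) (stft_conj g f)"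
    unfolding stft_conj_def by (rule cinner_abs[OF stft_mult_bounded_Lp_2[OF b] cnj_stft_Lp_2, symmetric])
  finally show "cinner (hs_op (abs_l2 (\<lambda>w. b w * cnj (stft \<phi>2 \<phi>1 w))) f) g
      = (LINT z|lborel. ft b (sympJ z) * stft \<phi>1 f z * cnj (stft \<phi>2 g z))"
    by (simp add: cinner_hs_op h_def mult.assoc)
qed

lemma bounded_integrable_Lp:
  assumes i: "integrable lborel a" and K: "\<And>z. cmod (a z) \<le> K" and q: "1 \<le> q"
  shows "a \<in> Lp q"
proof (cases "q = \<infinity>")
  case True
  then show ?thesis using i K by (auto simp: Lp_def)
next
  case False
  define r where "r = enn2real q"
  have r: "1 \<le> r" using enn2real_mono[OF q] False by (simp add: r_def less_top)
  have [measurable]: "a \<in> borel_measurable borel" using i by auto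
  have "integrable lborel (\<lambda>z. cmod (a z) powr r)"
  proof (rule Bochner_Integration.integrable_bound)
    show "integrable lborel (\<lambda>z. K powr (r - 1) * cmod (a z))" using i by simp
    show "AE z in lborel. norm (cmod (a z) powr r) \<le> norm (K powr (r - 1) * cmod (a z))"
    proof (rule AE_I2)
      fix z
      have "cmod (a z) powr r = cmod (a z) powr (r - 1) * cmod (a z)"
        by (cases "a z = 0") (simp_all add: powr_minus_one_mult)
      also have "\<dots> \<le> K powr (r - 1) * cmod (a z)"
        using r K by (intro mult_right_mono powr_mono2) auto
      finally show "norm (cmod (a z) powr r) \<le> norm (K powr (r - 1) * cmod (a z))" by simp
    qed
  qed measurable
  then show ?thesis using False by (simp add: Lp_def r_def)
qed

text \<open>The symbols produced are integrable and bounded, so the same construction serves every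
  exponent \<open>q\<close>, including infinity.\<close>

lemma loc_op_hs_dense:
  fixes \<phi>1 \<phi>2 :: "'a::euclidean_space l2"
  assumes V: "AE z in lborel. stft \<phi>1 \<phi>2 z \<noteq> 0" and q: "1 \<le> q" and \<delta>: "\<delta> > 0"
  shows "\<exists>a\<in>Lp q. \<exists>F. loc_op \<phi>1 \<phi>2 a = hs_op F \<and> norm (G - F) < \<delta>"
proof -
  let ?c = "\<lambda>w. cnj (stft \<phi>2 \<phi>1 w)"
  \<comment> \<open>The hypothesis concerns \<open>stft \<phi>1 \<phi>2\<close>, while the kernels
    carry \<open>stft \<phi>2 \<phi>1\<close>; the moduli agree after a reflection.\<close>
  have "AE w in lborel. stft \<phi>1 \<phi>2 (- w) \<noteq> 0"
    by (rule AE_lborel_linear[OF _ _ V]) (auto intro: linear_compose_neg linear_ident injI)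
  then have c: "AE w in lborel. ?c w \<noteq> 0"
  proof eventually_elim
    case (elim w)
    have "cmod (stft \<phi>1 \<phi>2 (- w)) = cmod (stft \<phi>2 \<phi>1 w)"
      by (rule norm_stft_minus)
    with elim show ?case by auto
  qed
  \<comment> \<open>The first two conditions are those of \<open>loc_op_ft\<close>. The third does
    not follow from them and places the symbol in \<open>Lp q\<close>.\<close>
  define good where "good b \<longleftrightarrow> integrable lborel b \<and> b \<in> Lp 2 \<and> integrable lborel (\<lambda>z. ft b (sympJ z))" for b :: "'a \<times> 'a \<Rightarrow> complex"
  define S where "S = {abs_l2 (\<lambda>w. b w * ?c w) | b. good b}"
  have scale: "d *\<^sub>C F \<in> S" if F: "F \<in> S" for d F
  proof -
    obtain b where b: "F = abs_l2 (\<lambda>w. b w * ?c w)" "good b" using F unfolding S_def by blast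
    have "good (\<lambda>w. d * b w)"
      using b(2) Lp_2_scale[of b d] ft_scale[of d b] by (simp add: good_def)
    moreover have "d *\<^sub>C F = abs_l2 (\<lambda>w. d * b w * ?c w)"
      using b(2) unfolding b(1) good_def by (simp add: abs_l2_scale stft_mult_bounded_Lp_2 mult.assoc)
    ultimately show ?thesis
      unfolding S_def by - (intro CollectI exI[of _ "\<lambda>w. d * b w"] conjI; assumption)
  qed
  have exp_S: "abs_l2 (\<lambda>w. (complex_of_real (gauss w) * ?c w) * echar u w) \<in> S" for u
  proof -
    let ?b = "\<lambda>w. complex_of_real (gauss w) * echar u w"
    \<comment> \<open>The transform of a modulated Gaussian is a translated one. As
      \<open>sympJ\<close> preserves the norm, the rotation disappears and the symbol is a translate
      of \<open>gauss\<close>, hence integrable.\<close>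
    have "ft ?b (sympJ z) = of_real (gauss (- sympJ u + z))" for z
    proof -
      have "ft ?b (sympJ z) = of_real (gauss (u + sympJ z))"
        by (subst integral_gauss_echar[symmetric]) (simp add: ft_def echar_add mult.assoc)
      moreover have "u + sympJ z = sympJ (- sympJ u + z)"
        by (simp add: linear_diff[OF linear_symp])
      ultimately show ?thesis by (simp add: gauss_def)
    qed
    moreover have "integrable lborel (\<lambda>z. complex_of_real (gauss (- sympJ u + z)))"
      using integrable_scaled_gauss[of 1 "- sympJ u"] by (simp add: integrable_of_real)
    ultimately have "good ?b"
      using plancherel_defect_gauss(1,2)[of u] by (simp add: good_def)
    moreover have "(\<lambda>w. (complex_of_real (gauss w) * ?c w) * echar u w) = (\<lambda>w. ?b w * ?c w)"
      by (simp add: mult_ac)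
    ultimately show ?thesis
      unfolding S_def by - (intro CollectI exI[of _ ?b] conjI; simp)
  qed
  have "\<exists>F\<in>S. norm (G - F) < \<delta>"
  proof (rule l2_dense_subspace[OF _ scale _ _ \<delta>])
    show "F + F' \<in> S" if FF: "F \<in> S" "F' \<in> S" for F F'
    proof -
      obtain b where b: "F = abs_l2 (\<lambda>w. b w * ?c w)" "good b" using FF unfolding S_def by blast
      obtain b' where b': "F' = abs_l2 (\<lambda>w. b' w * ?c w)" "good b'" using FF unfolding S_def by blast
      have "good (\<lambda>w. b w + b' w)"
        using b(2) b'(2) Lp_2_add[of b b'] ft_add[of b b'] by (simp add: good_def)
      moreover have "F + F' = abs_l2 (\<lambda>w. (b w + b' w) * ?c w)"
        using b(2) b'(2) unfolding b(1) b'(1) good_def by (simp add: abs_l2_add stft_mult_bounded_Lp_2 distrib_right)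
      ultimately show ?thesis
        unfolding S_def by - (intro CollectI exI[of _ "\<lambda>w. b w + b' w"] conjI; assumption)
    qed
    show "0 \<in> S" using scale[OF exp_S, of 0] by simp
    show "F = 0" if "\<And>F'. F' \<in> S \<Longrightarrow> cinner F F' = 0" for F
    proof (rule l2_exponentials_total)
      show "(\<lambda>w. complex_of_real (gauss w) * ?c w) \<in> Lp 2" by (rule stft_mult_bounded_Lp_2[OF gauss_Lp_2])
      show "AE w in lborel. complex_of_real (gauss w) * ?c w \<noteq> 0" using c by eventually_elim simp
    qed (rule that[OF exp_S])
  qed
  then obtain b where b: "good b" "norm (G - abs_l2 (\<lambda>w. b w * ?c w)) < \<delta>" unfolding S_def by blast
  have "(\<lambda>z. ft b (sympJ z)) \<in> Lp q"
    by (rule bounded_integrable_Lp[OF _ norm_ft_le q]) (use b in \<open>simp add: good_def\<close>)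
  with b show ?thesis by (auto simp: good_def intro!: bexI[of _ "\<lambda>z. ft b (sympJ z)"] loc_op_ft)
qed

text \<open>Truncation subtracts rank-one kernels and leaves the singular vectors unchanged. With
  zeros in front the coefficients are in general no longer decreasing, so the tail is estimated
  through its series and not through \<open>singular_values\<close>.\<close>

lemma svd_tail:
  fixes T :: "'a::euclidean_space l2 \<Rightarrow> 'a l2"
  assumes e: "orthonormal_seq e" and f: "orthonormal_seq f"
    and T: "\<And>h. svd_terms s e f h sums T h"
  defines "G \<equiv> \<lambda>N. \<Sum>k<N. of_real (s k) *\<^sub>C stft_conj (f k) (e k)"
  shows "svd_terms (\<lambda>k. if k < N then 0 else s k) e f h sums (T h - hs_op (G N) h)"
proof -
  have "hs_op (G N) h = (\<Sum>k<N. (of_real (s k) * cinner h (e k)) *\<^sub>C f k)"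
    by (rule cinner_eqI) (simp add: cinner_hs_op G_def cinner_sum_left moyal cinner_commute[of h "e _"] mult_ac)
  moreover have "(\<lambda>k. if k < N then (of_real (s k) * cinner h (e k)) *\<^sub>C f k else 0) sums (\<Sum>k<N. (of_real (s k) * cinner h (e k)) *\<^sub>C f k)"
    using sums_If_finite_set[of "{..<N}" "\<lambda>k. (of_real (s k) * cinner h (e k)) *\<^sub>C f k"] by simp
  ultimately have "(\<lambda>k. (of_real (s k) * cinner h (e k)) *\<^sub>C f k - (if k < N then (of_real (s k) * cinner h (e k)) *\<^sub>C f k else 0))
      sums (T h - hs_op (G N) h)"
    using sums_diff[OF T] by simp
  moreover have "(\<lambda>k. (of_real (s k) * cinner h (e k)) *\<^sub>C f k - (if k < N then (of_real (s k) * cinner h (e k)) *\<^sub>C f k else 0))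
      = svd_terms (\<lambda>k. if k < N then 0 else s k) e f h"
    by auto
  ultimately show ?thesis by simp
qed

lemma svd_tail_norm_le:
  fixes T :: "'a::euclidean_space l2 \<Rightarrow> 'a l2"
  assumes e: "orthonormal_seq e" and f: "orthonormal_seq f"
    and T: "\<And>h. svd_terms s e f h sums T h"
    and s: "\<And>k. 0 \<le> s k" "\<And>k. s k \<le> M"
  shows "norm (T h) \<le> M * norm h"
proof -
  have M: "0 \<le> M" using order_trans[OF s(1) s(2)] .
  note B = bessel_seq[OF e, of h]
  have le: "(cmod (of_real (s k) * cinner h (e k)))\<^sup>2 \<le> M\<^sup>2 * (cmod (cinner h (e k)))\<^sup>2" for k
    unfolding norm_mult power_mult_distrib using s by (intro mult_right_mono power_mono) auto
  have sm: "summable (\<lambda>k. (cmod (of_real (s k) * cinner h (e k)))\<^sup>2)"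
    by (rule summable_comparison_test'[OF summable_mult[OF B(1), of "M\<^sup>2"], of 0]) (use le in simp)
  have "(norm (T h))\<^sup>2 = (\<Sum>k. (cmod (of_real (s k) * cinner h (e k)))\<^sup>2)"
    using orthonormal_series(2)[OF f sm] sums_unique[OF T[of h]] by simp
  also have "\<dots> \<le> (\<Sum>k. M\<^sup>2 * (cmod (cinner h (e k)))\<^sup>2)"
    by (rule suminf_le[OF le sm summable_mult[OF B(1)]])
  also have "\<dots> = M\<^sup>2 * (\<Sum>k. (cmod (cinner h (e k)))\<^sup>2)" by (rule suminf_mult[OF B(1)])
  also have "\<dots> \<le> M\<^sup>2 * (norm h)\<^sup>2" by (intro mult_left_mono B) simp
  finally have "(norm (T h))\<^sup>2 \<le> (M * norm h)\<^sup>2" by (simp add: power_mult_distrib)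
  then show ?thesis by (rule power2_le_imp_le) (simp add: M)
qed

lemma loc_ops_dense_compact:
  fixes T :: "'a::euclidean_space l2 \<Rightarrow> 'a l2"
  assumes V: "AE z in lborel. stft \<phi>1 \<phi>2 z \<noteq> 0" and Tc: "T \<in> compact_ops" and \<epsilon>: "\<epsilon> > 0"
  shows "\<exists>a\<in>Lp \<infinity>. loc_op \<phi>1 \<phi>2 a \<in> schatten \<infinity> \<and> onorm (\<lambda>f. T f - loc_op \<phi>1 \<phi>2 a f) < \<epsilon>"
proof -
  let ?s = "singular_values T"
  obtain e f where e: "orthonormal_seq e" and f: "orthonormal_seq f" and dec: "decseq ?s"
    and lim: "?s \<longlonglongrightarrow> 0" and s0: "\<And>k. 0 \<le> ?s k"
    and Ts: "\<And>h. svd_terms ?s e f h sums T h"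
    by (rule compact_op_svd[OF Tc]) blast
  \<comment> \<open>The tail and the kernel approximation take \<open>\<epsilon> / 3\<close> each;
    the remaining third keeps the inequality strict after the supremum in
    \<open>onorm\<close>.\<close>
  obtain N where N: "?s N < \<epsilon> / 3"
    using order_tendstoD(2)[OF lim, of "\<epsilon> / 3"] \<epsilon> by (auto simp: eventually_sequentially)
  define G where "G = (\<Sum>k<N. of_real (?s k) *\<^sub>C stft_conj (f k) (e k))"
  obtain a F where a: "a \<in> Lp \<infinity>" "loc_op \<phi>1 \<phi>2 a = hs_op F" "norm (G - F) < \<epsilon> / 3"
    using loc_op_hs_dense[OF V, of \<infinity> "\<epsilon> / 3" G] \<epsilon> by auto
  have T_le: "norm (T h - hs_op F h) \<le> (2 * \<epsilon> / 3) * norm h" for h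
  proof -
    have "norm (T h - hs_op G h) \<le> ?s N * norm h"
    proof (rule svd_tail_norm_le[OF e f])
      show "svd_terms (\<lambda>k. if k < N then 0 else ?s k) e f h sums (T h - hs_op G h)" for h
        unfolding G_def by (rule svd_tail[OF e f Ts])
      show "(if k < N then 0 else ?s k) \<le> ?s N" for k
        using s0[of N] dec by (auto simp: decseq_def)
    qed (simp add: s0)
    also have "\<dots> \<le> \<epsilon> / 3 * norm h" using N by (intro mult_right_mono) auto
    finally have 1: "norm (T h - hs_op G h) \<le> \<epsilon> / 3 * norm h" .
    have "norm (hs_op (G - F) h) \<le> \<epsilon> / 3 * norm h"
      using a(3) by (intro order_trans[OF norm_hs_op_le] mult_right_mono) auto
    then have 2: "norm (hs_op G h - hs_op F h) \<le> \<epsilon> / 3 * norm h" by (simp add: hs_op_diff)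
    have "norm (T h - hs_op F h) \<le> norm (T h - hs_op G h) + norm (hs_op G h - hs_op F h)"
      using norm_triangle_ineq[of "T h - hs_op G h" "hs_op G h - hs_op F h"] by simp
    also have "\<dots> \<le> \<epsilon> / 3 * norm h + \<epsilon> / 3 * norm h" by (rule add_mono[OF 1 2])
    finally show ?thesis by simp
  qed
  have "onorm (\<lambda>h. T h - hs_op F h) \<le> 2 * \<epsilon> / 3"
    by (rule onorm_bound[OF _ T_le]) (use \<epsilon> in simp)
  also have "\<dots> < \<epsilon>" using \<epsilon> by simp
  finally show ?thesis using a(1) hs_op_schatten[of \<infinity> F] unfolding a(2)[symmetric]
    by (intro bexI[of _ a]) auto
qed

text \<open>A crude substitute for Minkowski's inequality; its constant is absorbed in the choice of
  \<open>\<eta>\<close> below.\<close>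

lemma powr_add_le:
  fixes x y :: real
  assumes "0 \<le> x" "0 \<le> y" "0 < q"
  shows "(x + y) powr q \<le> 2 powr q * (x powr q + y powr q)"
proof -
  have "(x + y) powr q \<le> (2 * max x y) powr q"
    using assms by (intro powr_mono2) auto
  also have "\<dots> = 2 powr q * max x y powr q" using assms by (simp add: powr_mult)
  also have "\<dots> \<le> 2 powr q * (x powr q + y powr q)"
    by (intro mult_left_mono) (auto simp: max_def)
  finally show ?thesis .
qed

lemma loc_ops_dense_schatten:
  fixes T :: "'a::euclidean_space l2 \<Rightarrow> 'a l2"
  assumes V: "AE z in lborel. stft \<phi>1 \<phi>2 z \<noteq> 0" and q: "2 \<le> q"
    and T: "T \<in> schatten (ennreal q)" and \<epsilon>: "\<epsilon> > 0"
  shows "\<exists>a\<in>Lp (ennreal q). loc_op \<phi>1 \<phi>2 a \<in> schatten (ennreal q) \<and>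
    schatten_norm (ennreal q) (\<lambda>f. T f - loc_op \<phi>1 \<phi>2 a f) < \<epsilon>"
proof -
  have q1: "1 \<le> ennreal q" and q2: "2 \<le> ennreal q" using q by (simp_all flip: ennreal_1 ennreal_numeral)
  let ?s = "singular_values T"
  have Tc: "T \<in> compact_ops" and sm: "summable (\<lambda>k. ?s k powr q)"
    using T q by (simp_all add: schatten_def)
  obtain e f where e: "orthonormal_seq e" and f: "orthonormal_seq f" and s0: "\<And>k. 0 \<le> ?s k"
    and Ts: "\<And>h. svd_terms ?s e f h sums T h"
    by (rule compact_op_svd[OF Tc]) blast
  \<comment> \<open>The two contributions add up to at most
    \<open>2 powr q * (\<eta> + \<eta>)\<close>, which is then half of
    \<open>\<epsilon> powr q\<close>.\<close>
  define \<eta> where "\<eta> = \<epsilon> powr q / (4 * 2 powr q)"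
  have \<eta>: "\<eta> > 0" using \<epsilon> by (simp add: \<eta>_def)
  obtain N where N: "\<bar>\<Sum>k. ?s (k + N) powr q\<bar> < \<eta>"
    using suminf_exist_split[OF \<eta> sm] by auto
  define s' where "s' k = (if k < N then 0 else ?s k)" for k
  have s'0: "0 \<le> s' k" for k by (simp add: s'_def s0)
  have s'sm: "summable (\<lambda>k. s' k powr q)"
    by (rule summable_comparison_test'[OF sm, of 0]) (simp add: s'_def)
  have s'_sum: "(\<Sum>k. s' k powr q) \<le> \<eta>"
  proof -
    have "(\<Sum>k. s' k powr q) = (\<Sum>k. s' (k + N) powr q) + (\<Sum>k<N. s' k powr q)"
      by (rule suminf_split_initial_segment[OF s'sm])
    also have "\<dots> = (\<Sum>k. ?s (k + N) powr q)" by (simp add: s'_def)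
    also have "\<dots> \<le> \<eta>" using N by (simp add: abs_less_iff)
    finally show ?thesis .
  qed
  define G where "G = (\<Sum>k<N. of_real (?s k) *\<^sub>C stft_conj (f k) (e k))"
  \<comment> \<open>The bound 1 makes \<open>q\<close>-th powers at most squares, as
    \<open>2 \<le> q\<close>; the bound \<open>sqrt \<eta>\<close> controls the sum of these
    squares.\<close>
  define \<delta> where "\<delta> = min 1 (sqrt \<eta>)"
  have \<delta>: "\<delta> > 0" using \<eta> by (simp add: \<delta>_def)
  obtain a F where a: "a \<in> Lp (ennreal q)" "loc_op \<phi>1 \<phi>2 a = hs_op F" "norm (G - F) < \<delta>"
    using loc_op_hs_dense[OF V q1 \<delta>, of G] by auto
  define R where "R h = T h - hs_op F h" for h
  have Rb: "R \<in> bounded_ops"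
    unfolding R_def[abs_def] by (intro bounded_ops_minus compact_opsD[OF Tc] hs_op_bounded)
  \<comment> \<open>Shown for every \<open>g\<close>, since the singular vectors of \<open>R\<close>
    are obtained only after this estimate has placed \<open>R\<close> in the Schatten class.\<close>
  have main: "summable (\<lambda>k. norm (R (g k)) powr q)" "(\<Sum>k. norm (R (g k)) powr q) \<le> 2 powr q * (\<eta> + \<eta>)"
    if g: "orthonormal_seq g" for g
  proof -
    note U = orthonormal_image_powr_sum[OF e f svd_tail[OF e f Ts, of N, folded s'_def G_def] s'0 s'sm q g]
    note H = hs_op_square_sum[OF g, of "G - F"]
    have GF: "(norm (G - F))\<^sup>2 \<le> \<eta>"
    proof -
      have "norm (G - F) \<le> sqrt \<eta>" using a(3) by (simp add: \<delta>_def)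
      then have "(norm (G - F))\<^sup>2 \<le> (sqrt \<eta>)\<^sup>2" by (intro power_mono) auto
      then show ?thesis using \<eta> by simp
    qed
    have H_le: "norm (hs_op (G - F) (g k)) powr q \<le> (norm (hs_op (G - F) (g k)))\<^sup>2" for k
    proof -
      have "norm (hs_op (G - F) (g k)) \<le> 1"
        using norm_hs_op_le[of "G - F" "g k"] a(3) orthonormal_seq_norm[OF g, of k] by (simp add: \<delta>_def)
      then have "norm (hs_op (G - F) (g k)) powr q \<le> norm (hs_op (G - F) (g k)) powr 2"
        using q by (intro powr_mono') auto
      then show ?thesis by (simp add: powr_two_of_nonneg)
    qed
    have R_le: "norm (R (g k)) powr q \<le> 2 powr q * (norm (T (g k) - hs_op G (g k)) powr q + (norm (hs_op (G - F) (g k)))\<^sup>2)" for k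
    proof -
      have "norm (R (g k)) \<le> norm (T (g k) - hs_op G (g k)) + norm (hs_op (G - F) (g k))"
        using norm_triangle_ineq[of "T (g k) - hs_op G (g k)" "hs_op (G - F) (g k)"] by (simp add: R_def hs_op_diff)
      then have "norm (R (g k)) powr q \<le> (norm (T (g k) - hs_op G (g k)) + norm (hs_op (G - F) (g k))) powr q"
        using q by (intro powr_mono2) auto
      also have "\<dots> \<le> 2 powr q * (norm (T (g k) - hs_op G (g k)) powr q + norm (hs_op (G - F) (g k)) powr q)"
        using q by (intro powr_add_le) auto
      also have "\<dots> \<le> 2 powr q * (norm (T (g k) - hs_op G (g k)) powr q + (norm (hs_op (G - F) (g k)))\<^sup>2)"
        by (intro mult_left_mono add_left_mono H_le) auto
      finally show ?thesis .
    qed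
    have bs: "summable (\<lambda>k. 2 powr q * (norm (T (g k) - hs_op G (g k)) powr q + (norm (hs_op (G - F) (g k)))\<^sup>2))"
      by (intro summable_mult summable_add U H)
    show Rsm: "summable (\<lambda>k. norm (R (g k)) powr q)"
      by (rule summable_comparison_test'[OF bs, of 0]) (use R_le in simp)
    have "(\<Sum>k. norm (R (g k)) powr q) \<le> (\<Sum>k. 2 powr q * (norm (T (g k) - hs_op G (g k)) powr q + (norm (hs_op (G - F) (g k)))\<^sup>2))"
      by (rule suminf_le[OF R_le Rsm bs])
    also have "\<dots> = 2 powr q * ((\<Sum>k. norm (T (g k) - hs_op G (g k)) powr q) + (\<Sum>k. (norm (hs_op (G - F) (g k)))\<^sup>2))"
      by (simp only: suminf_mult[OF summable_add[OF U(1) H(1)]] suminf_add[OF U(1) H(1), symmetric])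
    also have "\<dots> \<le> 2 powr q * (\<eta> + \<eta>)"
      by (intro mult_left_mono add_mono order_trans[OF U(2) s'_sum] order_trans[OF H(2) GF]) simp
    finally show "(\<Sum>k. norm (R (g k)) powr q) \<le> 2 powr q * (\<eta> + \<eta>)" .
  qed
  have "R \<in> schatten (ennreal q)" using q by (intro schattenI[OF Rb] main) auto
  then have "R \<in> compact_ops" by (simp add: schatten_def)
  then obtain g where g: "orthonormal_seq g" "\<And>k. singular_values R k = norm (R (g k))"
    by (rule compact_op_svd) blast
  have "(\<Sum>k. singular_values R k powr q) \<le> 2 powr q * (\<eta> + \<eta>)"
    unfolding g(2) by (rule main(2)[OF g(1)])
  also have "\<dots> < \<epsilon> powr q" using \<epsilon> by (simp add: \<eta>_def field_simps)
  finally have lt: "(\<Sum>k. singular_values R k powr q) < \<epsilon> powr q" .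
  have "0 \<le> (\<Sum>k. singular_values R k powr q)" unfolding g(2) by (intro suminf_nonneg main g) simp
  then have "(\<Sum>k. singular_values R k powr q) powr (1 / q) < (\<epsilon> powr q) powr (1 / q)"
    using lt q by (intro powr_less_mono2) auto
  then have "schatten_norm (ennreal q) R < \<epsilon>"
    using q \<epsilon> by (simp add: schatten_norm_def powr_powr)
  then show ?thesis
    using a(1) hs_op_schatten[OF q2, of F] unfolding a(2)[symmetric]
    by (intro bexI[of _ a]) (simp_all add: R_def[abs_def] a(2))
qed

lemma conjugate_index_cases:
  fixes p :: ennreal
  assumes "1 \<le> p" "p \<le> 2"
  obtains "p / (p - 1) = \<infinity>" | q where "p / (p - 1) = ennreal q" "2 \<le> q"
proof (cases "p = 1")
  case True
  then show thesis using that(1) conjugate_index_1 by simp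
next
  case False
  have "p \<noteq> \<infinity>" using assms by (auto simp: top_unique)
  then obtain r where r: "p = ennreal r" "0 \<le> r" by (cases p) auto
  have r12: "1 < r" "r \<le> 2"
    using assms False r by (simp_all flip: ennreal_1 ennreal_numeral add: less_le)
  have "p - 1 = ennreal (r - 1)" using r by (simp add: ennreal_minus flip: ennreal_1)
  then have "p / (p - 1) = ennreal (r / (r - 1))" using r r12 by (simp add: divide_ennreal)
  moreover have "2 \<le> r / (r - 1)" using r12 by (simp add: field_simps)
  ultimately show thesis by (rule that(2))
qed

theorem loc_ops_norm_dense:
  fixes \<phi>1 \<phi>2 :: "'a::euclidean_space l2"
  assumes V: "AE z in lborel. stft \<phi>1 \<phi>2 z \<noteq> 0" and p: "1 \<le> p" "p \<le> 2"
  shows "norm_dense_in_schatten (p / (p - 1)) {loc_op \<phi>1 \<phi>2 a | a. a \<in> Lp (p / (p - 1))}"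
  using p
proof (cases rule: conjugate_index_cases)
  case 1
  show ?thesis
    unfolding 1 norm_dense_in_schatten_def
  proof (intro conjI impI ballI allI)
    fix T :: "'a l2 \<Rightarrow> 'a l2" and \<epsilon> :: real assume "T \<in> schatten \<infinity>" "\<epsilon> > 0"
    then have "T \<in> compact_ops" by (simp add: schatten_def)
    from loc_ops_dense_compact[OF V this \<open>\<epsilon> > 0\<close>]
    show "\<exists>A\<in>{loc_op \<phi>1 \<phi>2 a | a. a \<in> Lp \<infinity>} \<inter> schatten \<infinity>. schatten_norm \<infinity> (\<lambda>f. T f - A f) < \<epsilon>"
      by (auto simp: schatten_norm_def)
  qed simp
next
  case (2 q)
  show ?thesis
    unfolding 2(1) norm_dense_in_schatten_def
  proof (intro conjI impI ballI allI)
    show "{loc_op \<phi>1 \<phi>2 a | a. a \<in> Lp (ennreal q)} \<subseteq> schatten (ennreal q)"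
      using loc_op_schatten[OF _ 2(2)] by blast
    fix T :: "'a l2 \<Rightarrow> 'a l2" and \<epsilon> :: real assume "T \<in> schatten (ennreal q)" "\<epsilon> > 0"
    from loc_ops_dense_schatten[OF V 2(2) this]
    show "\<exists>A\<in>{loc_op \<phi>1 \<phi>2 a | a. a \<in> Lp (ennreal q)} \<inter> schatten (ennreal q). schatten_norm (ennreal q) (\<lambda>f. T f - A f) < \<epsilon>"
      by blast
  qed
qed

theorem proposition1p2:
  fixes \<phi>1 \<phi>2 :: "(real ^ 'd) l2"
  shows "(\<forall>p::ennreal. 1 \<le> p \<and> p \<le> 2 \<and> (AE z in lborel. stft \<phi>1 \<phi>2 z \<noteq> 0) \<longrightarrow>
            berezin_one_to_one \<phi>1 \<phi>2 p \<and>
            norm_dense_in_schatten (p / (p - 1)) {loc_op \<phi>1 \<phi>2 a | a. a \<in> Lp (p / (p - 1))})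
       \<and> (\<forall>p::ennreal. 2 \<le> p \<and> berezin_one_to_one \<phi>1 \<phi>2 p \<longrightarrow>
            (AE z in lborel. stft \<phi>1 \<phi>2 z \<noteq> 0))"
  by (intro conjI allI impI; elim conjE)
    (rule berezin_one_to_oneI loc_ops_norm_dense berezin_one_to_one_imp; assumption)+

end
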